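(* Let $\Phi:\mathbf U^*(2n)\to\mathbb C^{2n\times 2n}$ be the $\mathbf{Sp}(n)$-invariant matrix-valued map given by $$\Phi:x\mapsto xx^*,\qquad \Phi=[\phi_{kl}]_{k,l=1}^{2n}.$$ For any $1\le l\le n$, the set $$\mathcal F_l=\{\phi_{kl}/\phi_{ll}:\mathbf U^*(2n)\to\mathbb C\ |\ k\neq l\}$$ is an orthogonal harmonic family on $\mathbf U^*(2n)$ of $\mathbb R^+\times\mathbf{Sp}(n)$-invariant maps, inducing a globally defined orthogonal harmonic family on the irreducible Riemannian symmetric space $\mathbf{SU}^*(2n)/\mathbf{Sp}(n)$.
   Context: For a semi-Riemannian manifold $(M,g)$ let $\tau$ be its Laplacian, extended complex linearly to complex-valued functions, and put $\kappa(\phi,\psi)=g(\mathrm{grad}(\phi),\mathrm{grad}(\psi))$ for $\phi,\psi:M\to\mathbb C$, with $g$ extended complex bilinearly to $T^{\mathbb C}M$. A set $\Omega$ of complex-valued functions on $M$ is an orthogonal harmonic family if $\tau(\phi)=0$ and $\kappa(\phi,\psi)=0$ for all $\phi,\psi\in\Omega$ (including $\phi=\psi$). Let $J=\begin{pmatrix}0&I_n\\-I_n&0\end{pmatrix}$ and $$\mathbf U^*(2n)=\{z\in\mathbf{GL}_{2n}(\mathbb C)\ |\ zJ=J\bar z\},\quad \mathbf{SU}^*(2n)=\{z\in\mathbf{SL}_{2n}(\mathbb C)\ |\ zJ=J\bar z\},\quad \mathbf{Sp}(n)=\mathbf{SU}^*(2n)\cap\mathbf{SU}(2n).$$ $\mathbf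 U^*(2n)$ carries the bi-invariant semi-Riemannian metric induced by the form $(X,Y)\mapsto\mathrm{Re}(\mathrm{trace}\,XY)$ on its Lie algebra $\mathfrak u^*(2n)$. There is an orthogonal decomposition $\mathfrak u^*(2n)=\mathfrak{sp}(n)\oplus\mathfrak p$ with $\mathfrak p$ the Hermitian elements of $\mathfrak u^*(2n)$; the restriction of the form to $\mathfrak p$ induces a $\mathbf U^*(2n)$-invariant Riemannian metric on $\mathbf U^*(2n)/\mathbf{Sp}(n)$. The determinant of any element of $\mathbf U^*(2n)$ is positive, and the isomorphism $\mathbb R^+\times\mathbf{SU}^*(2n)\to\mathbf U^*(2n)$, $(r,z)\mapsto rz$, induces an isometry $\mathbb R^+\times\mathbf{SU}^*(2n)/\mathbf{Sp}(n)\cong\mathbf U^*(2n)/\mathbf{Sp}(n)$, which determines the metric on $\mathbf{SU}^*(2n)/\mathbf{Sp}(n)$. $\mathbf{Sp}(n)$-invariance means invariance under right multiplication by elements of $\mathbf{Sp}(n)$; $\mathbb R^+$-invariance means invariance under $x\mapsto rx$, $r>0$. The index $k$ ranges over $1,\dots,2n$. The induced maps on $\mathbf{SU}^*(2n)/\mathbf{Sp}(n)$ send $x\,\mathbf{Sp}(n)$ to the value at $x$. *)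

theory Defs
  imports "HOL-Analysis.Analysis"
begin

section \<open>Smooth functions and the Levi-Civita calculus in coordinates\<close>

text \<open>
  Coordinate domains are relatively open subsets \<open>D\<close> of a linear subspace \<open>V\<close> of a Euclidean
  space, rather than open subsets of some \<open>real^'d\<close>: the manifolds below have dimensions
  (such as $2n^2-n-1$) that are not the cardinality of a natural index type.
\<close>

definition dderiv :: "('e::real_vector \<Rightarrow> 'b::real_normed_vector) \<Rightarrow> 'e \<Rightarrow> 'e \<Rightarrow> 'b" where
  "dderiv f y v = vector_derivative (\<lambda>t::real. f (y + t *\<^sub>R v)) (at 0)"

primrec Ck_on :: "nat \<Rightarrow> 'e::euclidean_space set \<Rightarrow> 'e set \<Rightarrow> ('e \<Rightarrow> 'b::real_normed_vector) \<Rightarrow> bool"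
where
  "Ck_on 0 V D f \<longleftrightarrow> continuous_on D f"
| "Ck_on (Suc k) V D f \<longleftrightarrow> f differentiable_on D \<and> (\<forall>v\<in>V. Ck_on k V D (\<lambda>y. dderiv f y v))"

definition smooth_on ::
  "'e::euclidean_space set \<Rightarrow> 'e set \<Rightarrow> ('e \<Rightarrow> 'b::real_normed_vector) \<Rightarrow> bool" where
  "smooth_on V D f \<longleftrightarrow> (\<forall>k. Ck_on k V D f)"

text \<open>
  In the following, \<open>g y u w\<close> is a field of nondegenerate symmetric bilinear forms on \<open>V\<close>.
  The vectors selected by \<open>THE\<close> exist and are unique because of nondegeneracy.
\<close>

definition grad_in ::
  "'e::euclidean_space set \<Rightarrow> ('e \<Rightarrow> 'e \<Rightarrow> 'e \<Rightarrow> real) \<Rightarrow> ('e \<Rightarrow> real) \<Rightarrow> 'e \<Rightarrow> 'e" where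
  "grad_in V g f y = (THE u. u \<in> V \<and> (\<forall>w\<in>V. g y u w = dderiv f y w))"

text \<open>
  The Christoffel symbol \<open>\<Gamma>\<^sub>y(u,w)\<close>: the Koszul formula for the Levi-Civita connection,
  applied to constant (hence commuting) vector fields.
\<close>

definition christoffel ::
  "'e::euclidean_space set \<Rightarrow> ('e \<Rightarrow> 'e \<Rightarrow> 'e \<Rightarrow> real) \<Rightarrow> 'e \<Rightarrow> 'e \<Rightarrow> 'e \<Rightarrow> 'e" where
  "christoffel V g y u w =
    (THE z. z \<in> V \<and> (\<forall>x\<in>V. 2 * g y z x =
       dderiv (\<lambda>y'. g y' w x) y u + dderiv (\<lambda>y'. g y' u x) y w - dderiv (\<lambda>y'. g y' u w) y x))"

definition cov_deriv ::
  "'e::euclidean_space set \<Rightarrow> ('e \<Rightarrow> 'e \<Rightarrow> 'e \<Rightarrow> real) \<Rightarrow> ('e \<Rightarrow> 'e) \<Rightarrow> 'e \<Rightarrow> 'e \<Rightarrow> 'e" where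
  "cov_deriv V g X y v = dderiv X y v + christoffel V g y v (X y)"

text \<open>
  The trace of a linear endomorphism \<open>L\<close> of \<open>V\<close>. The basis is orthonormal for the ambient
  Euclidean inner product, which is only a device for reading off diagonal entries and is
  unrelated to the metric \<open>g\<close>.
\<close>

definition trace_on :: "'e::euclidean_space set \<Rightarrow> ('e \<Rightarrow> 'e) \<Rightarrow> real" where
  "trace_on V L =
    (let B = SOME B. pairwise orthogonal B \<and> (\<forall>b\<in>B. norm b = 1) \<and> span B = V
     in \<Sum>b\<in>B. L b \<bullet> b)"

definition div_in ::
  "'e::euclidean_space set \<Rightarrow> ('e \<Rightarrow> 'e \<Rightarrow> 'e \<Rightarrow> real) \<Rightarrow> ('e \<Rightarrow> 'e) \<Rightarrow> 'e \<Rightarrow> real" where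
  "div_in V g X y = trace_on V (cov_deriv V g X y)"

definition laplacian_in ::
  "'e::euclidean_space set \<Rightarrow> ('e \<Rightarrow> 'e \<Rightarrow> 'e \<Rightarrow> real) \<Rightarrow> ('e \<Rightarrow> real) \<Rightarrow> 'e \<Rightarrow> real" where
  "laplacian_in V g f = div_in V g (grad_in V g f)"


section \<open>Semi-Riemannian manifolds and orthogonal harmonic families\<close>

text \<open>
  The data of a semi-Riemannian manifold: the set of points, the model space \<open>V\<close>, an atlas given
  by local parametrizations (a pair \<open>(D, \<sigma>)\<close> consists of a relatively open \<open>D \<subseteq> V\<close> and an
  injective \<open>\<sigma>\<close> from \<open>D\<close> into the points, i.e. the inverse of a chart), and the coordinate
  expression of the metric with respect to every parametrization.
\<close>

record ('m, 'e) semi_riem =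
  points :: "'m set"
  model :: "'e set"
  params :: "('e set \<times> ('e \<Rightarrow> 'm)) set"
  metric :: "'e set \<times> ('e \<Rightarrow> 'm) \<Rightarrow> 'e \<Rightarrow> 'e \<Rightarrow> 'e \<Rightarrow> real"

definition smooth_fun ::
  "('m, 'e::euclidean_space) semi_riem \<Rightarrow> ('m \<Rightarrow> 'b::real_normed_vector) \<Rightarrow> bool" where
  "smooth_fun M \<phi> \<longleftrightarrow> (\<forall>(D, \<sigma>) \<in> params M. smooth_on (model M) D (\<phi> \<circ> \<sigma>))"

text \<open>
  Gradient, metric and Laplacian at a point are evaluated in some parametrization around it;
  the values of \<open>laplacian\<close> and \<open>kappa\<close> do not depend on which one.
\<close>

definition param_at ::
  "('m, 'e::euclidean_space) semi_riem \<Rightarrow> 'm \<Rightarrow> 'e set \<times> ('e \<Rightarrow> 'm)" where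
  "param_at M p = (SOME c. c \<in> params M \<and> p \<in> snd c ` fst c)"

definition coord :: "('m, 'e::euclidean_space) semi_riem \<Rightarrow> 'm \<Rightarrow> 'e" where
  "coord M p = the_inv_into (fst (param_at M p)) (snd (param_at M p)) p"

definition metric_at :: "('m, 'e::euclidean_space) semi_riem \<Rightarrow> 'm \<Rightarrow> 'e \<Rightarrow> 'e \<Rightarrow> real" where
  "metric_at M p = metric M (param_at M p) (coord M p)"

definition real_grad :: "('m, 'e::euclidean_space) semi_riem \<Rightarrow> ('m \<Rightarrow> real) \<Rightarrow> 'm \<Rightarrow> 'e" where
  "real_grad M f p =
    grad_in (model M) (metric M (param_at M p)) (f \<circ> snd (param_at M p)) (coord M p)"

definition real_laplacian ::
  "('m, 'e::euclidean_space) semi_riem \<Rightarrow> ('m \<Rightarrow> real) \<Rightarrow> 'm \<Rightarrow> real" where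
  "real_laplacian M f p =
    laplacian_in (model M) (metric M (param_at M p)) (f \<circ> snd (param_at M p)) (coord M p)"

definition laplacian ::
  "('m, 'e::euclidean_space) semi_riem \<Rightarrow> ('m \<Rightarrow> complex) \<Rightarrow> 'm \<Rightarrow> complex" where
  "laplacian M \<phi> p = Complex (real_laplacian M (Re \<circ> \<phi>) p) (real_laplacian M (Im \<circ> \<phi>) p)"

text \<open>
  \<open>grad \<phi> = grad (Re \<phi>) + i grad (Im \<phi>)\<close>, and the metric is extended complex \<^emph>\<open>bilinearly\<close>.
\<close>

definition kappa ::
  "('m, 'e::euclidean_space) semi_riem \<Rightarrow> ('m \<Rightarrow> complex) \<Rightarrow> ('m \<Rightarrow> complex) \<Rightarrow> 'm \<Rightarrow> complex" where
  "kappa M \<phi> \<psi> p =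
    (let g = metric_at M p;
         a = real_grad M (Re \<circ> \<phi>) p; b = real_grad M (Im \<circ> \<phi>) p;
         c = real_grad M (Re \<circ> \<psi>) p; d = real_grad M (Im \<circ> \<psi>) p
     in Complex (g a c - g b d) (g a d + g b c))"

definition orthogonal_harmonic_family ::
  "('m, 'e::euclidean_space) semi_riem \<Rightarrow> ('m \<Rightarrow> complex) set \<Rightarrow> bool" where
  "orthogonal_harmonic_family M \<Omega> \<longleftrightarrow>
    (\<forall>\<phi>\<in>\<Omega>. smooth_fun M \<phi>) \<and>
    (\<forall>\<phi>\<in>\<Omega>. \<forall>p\<in>points M. laplacian M \<phi> p = 0) \<and>
    (\<forall>\<phi>\<in>\<Omega>. \<forall>\<psi>\<in>\<Omega>. \<forall>p\<in>points M. kappa M \<phi> \<psi> p = 0)"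


section \<open>The groups\<close>

text \<open>
  $2n \times 2n$ matrices have rows and columns indexed by \<open>'n + 'n\<close> with $n$ = \<open>CARD('n)\<close>; the
  indices $1,\dots,n$ are the \<open>Inl i\<close> and $n+1,\dots,2n$ are the \<open>Inr i\<close>.
\<close>

type_synonym 'n cmat = "complex ^ ('n + 'n) ^ ('n + 'n)"

definition Jmat :: "'n::finite cmat" where
  "Jmat = (\<chi> i j. case i of
      Inl a \<Rightarrow> (if j = Inr a then 1 else 0)
    | Inr a \<Rightarrow> (if j = Inl a then - 1 else 0))"

definition cnj_mat :: "'n::finite cmat \<Rightarrow> 'n cmat" where
  "cnj_mat z = (\<chi> i j. cnj (z $ i $ j))"

definition adj_mat :: "'n::finite cmat \<Rightarrow> 'n cmat" where
  "adj_mat z = transpose (cnj_mat z)"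

definition U_star :: "'n::finite cmat set" where
  "U_star = {z. invertible z \<and> z ** Jmat = Jmat ** cnj_mat z}"

definition SU_star :: "'n::finite cmat set" where
  "SU_star = {z. det z = 1 \<and> z ** Jmat = Jmat ** cnj_mat z}"

definition SU_group :: "'n::finite cmat set" where
  "SU_group = {z. z ** adj_mat z = mat 1 \<and> det z = 1}"

definition Sp_group :: "'n::finite cmat set" where
  "Sp_group = SU_star \<inter> SU_group"

definition u_star_alg :: "'n::finite cmat set" where
  "u_star_alg = {X. X ** Jmat = Jmat ** cnj_mat X}"

definition p_space :: "'n::finite cmat set" where
  "p_space = {X \<in> u_star_alg. adj_mat X = X}"

definition p0_space :: "'n::finite cmat set" where
  "p0_space = {X \<in> p_space. trace X = 0}"

definition trace_form :: "'n::finite cmat \<Rightarrow> 'n cmat \<Rightarrow> real" where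
  "trace_form X Y = Re (trace (X ** Y))"


section \<open>The semi-Riemannian manifold \<open>U\<^sup>*(2n)\<close>\<close>

text \<open>
  \<open>U_star\<close> is an open subset of the real vector space \<open>u_star_alg\<close>, and the inclusion is a global
  chart. The metric is the left (and right) translate of \<open>trace_form\<close>.
\<close>

definition U_star_manifold :: "('n::finite cmat, 'n cmat) semi_riem" where
  "U_star_manifold = \<lparr>
     points = U_star,
     model = u_star_alg,
     params = {(U_star, \<lambda>x. x)},
     metric = (\<lambda>_ x v w. trace_form (matrix_inv x ** v) (matrix_inv x ** w)) \<rparr>"


section \<open>The Riemannian manifold \<open>SU\<^sup>*(2n)/Sp(n)\<close>\<close>

definition Sp_coset :: "'n::finite cmat \<Rightarrow> 'n cmat set" where
  "Sp_coset x = (\<lambda>k. x ** k) ` Sp_group"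

definition SU_star_mod_Sp :: "'n::finite cmat set set" where
  "SU_star_mod_Sp = Sp_coset ` SU_star"

text \<open>The orthogonal projection of \<open>u_star_alg\<close> onto \<open>p_space\<close> along the Lie algebra of \<open>Sp(n)\<close>.\<close>

definition p_part :: "'n::finite cmat \<Rightarrow> 'n cmat" where
  "p_part X = (1/2) *\<^sub>R (X + adj_mat X)"

definition smooth_lift ::
  "'n::finite cmat set \<Rightarrow> ('n cmat \<Rightarrow> 'n cmat set) \<Rightarrow> ('n cmat \<Rightarrow> 'n cmat) \<Rightarrow> bool" where
  "smooth_lift D \<sigma> s \<longleftrightarrow>
    smooth_on p0_space D s \<and> (\<forall>y\<in>D. s y \<in> U_star \<and> \<sigma> y = Sp_coset (s y))"

text \<open>
  For a map \<open>\<sigma> = \<pi> \<circ> s\<close> into \<open>U\<^sup>*(2n)/Sp(n)\<close>, where \<open>s\<close> is smooth and \<open>\<pi>\<close> is the projection, the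
  differential of \<open>\<sigma>\<close> at \<open>y\<close> in the direction \<open>v\<close> corresponds under left translation by \<open>s y\<close> to
  the element \<open>lift_diff s y v\<close> of \<open>p_space\<close>, the tangent space at the base point.
\<close>

definition lift_diff :: "('n::finite cmat \<Rightarrow> 'n cmat) \<Rightarrow> 'n cmat \<Rightarrow> 'n cmat \<Rightarrow> 'n cmat" where
  "lift_diff s y v = p_part (matrix_inv (s y) ** dderiv s y v)"

text \<open>
  The quotient carries the unique manifold structure for which \<open>\<pi>\<close> is a smooth submersion. Its
  local parametrizations with values in \<open>SU\<^sup>*(2n)/Sp(n)\<close> are the injective immersions, defined on
  open subsets of the space \<open>p0_space\<close> of the right dimension, that lift to smooth maps into the
  group. (If \<open>\<sigma>\<close> has values in \<open>SU_star_mod_Sp\<close>, its lifts have values in \<open>SU_star\<close>.)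
\<close>

definition quotient_params :: "('n::finite cmat set \<times> ('n cmat \<Rightarrow> 'n cmat set)) set" where
  "quotient_params =
    {(D, \<sigma>). openin (top_of_set p0_space) D \<and> inj_on \<sigma> D \<and> \<sigma> ` D \<subseteq> SU_star_mod_Sp \<and>
       (\<exists>s. smooth_lift D \<sigma> s \<and>
          (\<forall>y\<in>D. \<forall>v\<in>p0_space. lift_diff s y v = 0 \<longrightarrow> v = 0))}"

text \<open>
  The metric of \<open>U\<^sup>*(2n)/Sp(n)\<close> is the invariant metric that agrees with \<open>trace_form\<close> on
  \<open>p_space\<close>; \<open>quotient_metric\<close> is its pull-back along a parametrization, and does not depend on the
  lift. The isometry sending \<open>(r, z Sp(n))\<close> to \<open>rz Sp(n)\<close> identifies \<open>SU\<^sup>*(2n)/Sp(n)\<close> with the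
  slice \<open>r = 1\<close>, that is, with the set of cosets \<open>z Sp(n)\<close>, \<open>z \<in> SU_star\<close>, inside
  \<open>U\<^sup>*(2n)/Sp(n)\<close>, so its metric is the restricted one.
\<close>

definition quotient_metric ::
  "'n::finite cmat set \<times> ('n cmat \<Rightarrow> 'n cmat set) \<Rightarrow> 'n cmat \<Rightarrow> 'n cmat \<Rightarrow> 'n cmat \<Rightarrow> real" where
  "quotient_metric c y v w =
    (let s = SOME s. smooth_lift (fst c) (snd c) s
     in trace_form (lift_diff s y v) (lift_diff s y w))"

definition SU_star_mod_Sp_manifold :: "('n::finite cmat set, 'n cmat) semi_riem" where
  "SU_star_mod_Sp_manifold = \<lparr>
     points = SU_star_mod_Sp,
     model = p0_space,
     params = quotient_params,
     metric = quotient_metric \<rparr>"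


section \<open>The functions\<close>

definition Phi :: "'n::finite cmat \<Rightarrow> 'n cmat" where
  "Phi x = x ** adj_mat x"

definition family :: "'n::finite + 'n \<Rightarrow> ('n cmat \<Rightarrow> complex) set" where
  "family l = {(\<lambda>x. Phi x $ k $ l / Phi x $ l $ l) | k. k \<noteq> l}"

definition induced :: "('n::finite cmat \<Rightarrow> complex) \<Rightarrow> 'n cmat set \<Rightarrow> complex" where
  "induced f C = (THE c. \<forall>x\<in>C. f x = c)"

end

theory Submission
  imports Defs
begin

text \<open>
  Let \<open>e\<^sub>i\<close> be a frame at a point that is orthonormal for the metric up to signs \<open>\<epsilon>\<^sub>i\<close>. The Koszul
  formula gives \<open>\<tau>(f) = \<Sum> \<epsilon>\<^sub>i (\<partial>\<^sub>i \<partial>\<^sub>i f - df(\<Gamma>(e\<^sub>i, e\<^sub>i)))\<close> and \<open>\<kappa>(f, h) = \<Sum> \<epsilon>\<^sub>i \<partial>\<^sub>i f \<partial>\<^sub>i h\<close>, derivatives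
  being taken in the fixed directions \<open>e\<^sub>i\<close>. Hence \<open>\<tau>(a/b) = 0\<close> and \<open>\<kappa>(a/b, a'/b) = 0\<close> as soon as
  \<open>a, a', b\<close> satisfy \<open>\<tau>(a) = \<nu> a\<close> and \<open>\<kappa>(a, a') = \<mu> a a'\<close> with common constants.

  Both metrics have the form \<open>c Re tr (P\<inverse> dP P\<inverse> dP)\<close>: on the group \<open>P(x) = x\<close> and \<open>c = 1\<close>, on the
  quotient \<open>P(x) = x x\<^sup>*\<close> and \<open>c = 1/4\<close>. For such metrics \<open>\<Gamma>(e, e)\<close> represents
  \<open>P\<^sub>e\<^sub>e - P\<^sub>e P\<inverse> P\<^sub>e\<close>. Translating an orthonormal basis of the Lie algebra to the point, the two
  conditions on the entries of one column of \<open>x x\<^sup>*\<close> reduce to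
  \<open>\<Sum> E\<^sub>a\<^sub>b E\<^sub>d\<^sub>c = (\<delta>\<^sub>a\<^sub>c \<delta>\<^sub>b\<^sub>d - J\<^sub>a\<^sub>d J\<^sub>c\<^sub>b)/2\<close>, summed over an orthonormal basis of the Hermitian part; since
  \<open>J\<close> is antisymmetric, its contribution to \<open>\<kappa>\<close> vanishes within a column.
\<close>

section \<open>Directional derivatives and \<open>Ck_on\<close>\<close>

text \<open>The quotient admits arbitrary parametrizations, and \<open>param_at\<close> and
  \<open>quotient_metric\<close> choose a chart and a lift without specifying them. The computations
  on the quotient therefore use no explicit chart: for a lift \<open>s\<close> the matrix
  \<open>Phi (s y)\<close> depends only on the coset, and the metric, the functions and the
  immersion condition can all be read off from it. The factor 1/4 comes from
  \<open>d(Phi o s) = 2 s L adj(s)\<close>, where \<open>L\<close> is the Hermitian part of the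
  logarithmic derivative of \<open>s\<close>. Explicit parametrizations occur only to show that
  every coset is covered, without which the choice in \<open>param_at\<close> would be meaningless.
  A second obstacle is that gradients and Christoffel vectors are given by \<open>THE\<close>:
  differentiability of the gradient has to be established before the Laplacian can be expanded. The
  constants \<nu> and \<mu> matter only through being common to all entries of a column; on the
  quotient this permits \<nu> to contain a summand that is never evaluated.\<close>

locale chart_domain =
  fixes V D :: "'e::euclidean_space set"
  assumes subspace_V: "subspace V" and openin_D: "openin (top_of_set V) D"
begin

lemma D_subset_V: "D \<subseteq> V"
  using openin_D openin_imp_subset by auto

text \<open>Directions in \<open>V\<close> keep the line inside \<open>V\<close>, so relative
  openness of \<open>D\<close> becomes openness of the parameter set. Hence \<open>dderiv\<close> is
  a genuine two-sided derivative even where \<open>D\<close> has empty interior in the ambient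
  space.\<close>

lemma open_line:
  assumes "y \<in> D" "v \<in> V"
  shows "open {t::real. y + t *\<^sub>R v \<in> D}"
proof -
  obtain T where T: "open T" "D = V \<inter> T"
    using openin_D by (auto simp: openin_open)
  have "y + t *\<^sub>R v \<in> V" for t
    using assms D_subset_V subspace_V by (auto intro: subspace_add subspace_scale)
  then have "{t. y + t *\<^sub>R v \<in> D} = (\<lambda>t. y + t *\<^sub>R v) -` T"
    using T by auto
  moreover have "open ((\<lambda>t::real. y + t *\<^sub>R v) -` T)"
    by (rule open_vimage[OF T(1)]) (intro continuous_intros)
  ultimately show ?thesis by simp
qed

lemma eventually_line:
  assumes "y \<in> D" "v \<in> V"
  shows "eventually (\<lambda>t::real. y + t *\<^sub>R v \<in> D) (nhds 0)"
  using eventually_nhds_in_open[OF open_line[OF assms], of 0] assms by simp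

lemma has_derivative_line:
  assumes f: "(f has_derivative f') (at y within D)" and y: "y \<in> D" and v: "v \<in> V"
  shows "((\<lambda>t. f (y + t *\<^sub>R v)) has_vector_derivative f' v) (at 0)"
proof -
  let ?S = "{t::real. y + t *\<^sub>R v \<in> D}"
  have h: "((\<lambda>t::real. y + t *\<^sub>R v) has_derivative (\<lambda>t. t *\<^sub>R v)) (at 0 within ?S)"
    by (auto intro!: derivative_eq_intros)
  have f2: "(f has_derivative f') (at (y + 0 *\<^sub>R v) within ((\<lambda>t. y + t *\<^sub>R v) ` ?S))"
    using has_derivative_subset[OF f, of "(\<lambda>t. y + t *\<^sub>R v) ` ?S"] by auto
  have "((\<lambda>t. f (y + t *\<^sub>R v)) has_derivative (\<lambda>t. f' (t *\<^sub>R v))) (at 0 within ?S)"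
    using diff_chain_within[OF h f2] by (simp add: o_def)
  then have "((\<lambda>t. f (y + t *\<^sub>R v)) has_derivative (\<lambda>t. f' (t *\<^sub>R v))) (at 0)"
    using at_within_open[of 0 ?S] open_line[OF y v] y by simp
  moreover have "(\<lambda>t. f' (t *\<^sub>R v)) = (\<lambda>t. t *\<^sub>R f' v)"
    using f by (auto simp: has_derivative_def linear_simps)
  ultimately show ?thesis by (simp add: has_vector_derivative_def)
qed

lemma dderiv_eq:
  assumes "(f has_derivative f') (at y within D)" "y \<in> D" "v \<in> V"
  shows "dderiv f y v = f' v"
  unfolding dderiv_def by (rule vector_derivative_at[OF has_derivative_line[OF assms]])

lemma dderiv_line:
  assumes "f differentiable_on D" "y \<in> D" "v \<in> V"
  shows "((\<lambda>t. f (y + t *\<^sub>R v)) has_vector_derivative dderiv f y v) (at 0)"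
proof -
  obtain f' where f': "(f has_derivative f') (at y within D)"
    using assms by (auto simp: differentiable_on_def differentiable_def)
  show ?thesis using has_derivative_line[OF f' assms(2,3)] dderiv_eq[OF f' assms(2,3)] by simp
qed

text \<open>A derivative within \<open>D\<close> is not determined transversally to
  \<open>V\<close>. Only its restriction to \<open>V\<close> is canonical, so the linear map is
  obtained as some extension instead of being named.\<close>

lemma dderiv_linear:
  assumes "f differentiable_on D" "y \<in> D"
  obtains f' where "linear f'" "\<And>v. v \<in> V \<Longrightarrow> dderiv f y v = f' v"
proof -
  obtain f' where f': "(f has_derivative f') (at y within D)"
    using assms by (auto simp: differentiable_on_def differentiable_def)
  show thesis
    using that[of f'] dderiv_eq[OF f' assms(2)] f' has_derivative_linear by blast
qed

lemma dderiv_add_dir: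
  assumes "f differentiable_on D" "y \<in> D" "v \<in> V" "w \<in> V"
  shows "dderiv f y (v + w) = dderiv f y v + dderiv f y w"
proof -
  obtain f' where f': "linear f'" "\<And>v. v \<in> V \<Longrightarrow> dderiv f y v = f' v"
    using dderiv_linear[OF assms(1,2)] by blast
  have "v + w \<in> V" using assms subspace_V by (simp add: subspace_add)
  then show ?thesis using f' assms by (simp add: linear_add)
qed

lemma dderiv_scale_dir:
  assumes "f differentiable_on D" "y \<in> D" "v \<in> V"
  shows "dderiv f y (c *\<^sub>R v) = c *\<^sub>R dderiv f y v"
proof -
  obtain f' where f': "linear f'" "\<And>v. v \<in> V \<Longrightarrow> dderiv f y v = f' v"
    using dderiv_linear[OF assms(1,2)] by blast
  have "c *\<^sub>R v \<in> V" using assms subspace_V by (simp add: subspace_scale)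
  then show ?thesis using f' assms by (simp add: linear_scale)
qed

lemma dderiv_cong:
  assumes "\<And>z. z \<in> D \<Longrightarrow> f z = h z" "y \<in> D" "v \<in> V"
  shows "dderiv f y v = dderiv h y v"
  unfolding dderiv_def
  by (rule vector_derivative_cong_eq)
    (use eventually_line[OF assms(2,3)] assms(1) in \<open>auto elim: eventually_mono\<close>)

lemma dderiv_bounded_linear:
  assumes "bounded_linear L" "f differentiable_on D" "y \<in> D" "v \<in> V"
  shows "dderiv (\<lambda>z. L (f z)) y v = L (dderiv f y v)"
  unfolding dderiv_def[of "\<lambda>z. L (f z)"]
  using bounded_linear.has_vector_derivative[OF assms(1) dderiv_line[OF assms(2-4)]]
  by (rule vector_derivative_at)

lemma dderiv_add:
  assumes "f differentiable_on D" "h differentiable_on D" "y \<in> D" "v \<in> V"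
  shows "dderiv (\<lambda>z. f z + h z) y v = dderiv f y v + dderiv h y v"
  unfolding dderiv_def[of "\<lambda>z. f z + h z"]
  using has_vector_derivative_add[OF dderiv_line[OF assms(1,3,4)] dderiv_line[OF assms(2,3,4)]]
  by (rule vector_derivative_at)

lemma dderiv_bilinear:
  assumes "bounded_bilinear B" "f differentiable_on D" "h differentiable_on D" "y \<in> D" "v \<in> V"
  shows "dderiv (\<lambda>z. B (f z) (h z)) y v = B (f y) (dderiv h y v) + B (dderiv f y v) (h y)"
  unfolding dderiv_def[of "\<lambda>z. B (f z) (h z)"]
  using bounded_bilinear.has_vector_derivative[OF assms(1)
      dderiv_line[OF assms(2,4,5)] dderiv_line[OF assms(3,4,5)]]
  by (intro vector_derivative_at) simp

lemma dderiv_bounded_linear_id: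
  assumes "bounded_linear L"
  shows "dderiv L y v = L v"
proof -
  have "((\<lambda>t::real. L (y + t *\<^sub>R v)) has_vector_derivative L v) (at 0)"
    using assms by (auto simp: linear_simps intro!: derivative_eq_intros)
  then show ?thesis unfolding dderiv_def by (rule vector_derivative_at)
qed

lemma dderiv_const [simp]: "dderiv (\<lambda>z. c) y v = 0"
  by (simp add: dderiv_def vector_derivative_at)

section \<open>Congruence and closure properties of differentiability and of
  \<open>Ck_on\<close>\<close>

lemma differentiable_on_cong:
  fixes f h :: "'e \<Rightarrow> 'c::real_normed_vector"
  assumes "\<And>z. z \<in> D \<Longrightarrow> f z = h z"
  shows "f differentiable_on D \<longleftrightarrow> h differentiable_on D"
proof -
  have *: "h' differentiable_on D" if f': "f' differentiable_on D" and eq: "\<And>z. z \<in> D \<Longrightarrow> f' z = h' z"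
    for f' h' :: "'e \<Rightarrow> 'c"
    unfolding differentiable_on_def
  proof
    fix y assume y: "y \<in> D"
    obtain d where "(f' has_derivative d) (at y within D)"
      using f' y by (auto simp: differentiable_on_def differentiable_def)
    from has_derivative_transform[OF y _ this, of h'] eq
    show "h' differentiable (at y within D)"
      unfolding differentiable_def by auto
  qed
  show ?thesis using *[of f h] *[of h f] assms by auto
qed

lemma Ck_on_cong:
  assumes "\<And>z. z \<in> D \<Longrightarrow> f z = h z"
  shows "Ck_on k V D f \<longleftrightarrow> Ck_on k V D h"
  using assms
proof (induction k arbitrary: f h)
  case 0
  have "continuous_on D f \<longleftrightarrow> continuous_on D h"
    by (rule continuous_on_cong) (simp_all add: 0)
  then show ?case by (simp only: Ck_on.simps)
next
  case (Suc k)
  have "Ck_on k V D (\<lambda>y. dderiv f y v) \<longleftrightarrow> Ck_on k V D (\<lambda>y. dderiv h y v)" if "v \<in> V" for v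
    by (rule Suc.IH, rule dderiv_cong) (use Suc.prems that in auto)
  moreover have "f differentiable_on D \<longleftrightarrow> h differentiable_on D"
    by (rule differentiable_on_cong) (rule Suc.prems)
  ultimately show ?case unfolding Ck_on.simps by blast
qed

text \<open>The closure properties below run through this rule: the derivative is needed only as an
  expression \<open>h v y\<close> valid on \<open>D\<close>, and the regularity of that expression
  comes from the induction hypothesis.\<close>

lemma Ck_on_SucI:
  assumes "f differentiable_on D" "\<And>v. v \<in> V \<Longrightarrow> Ck_on k V D (h v)"
    and "\<And>v y. v \<in> V \<Longrightarrow> y \<in> D \<Longrightarrow> dderiv f y v = h v y"
  shows "Ck_on (Suc k) V D f"
proof -
  have "Ck_on k V D (\<lambda>y. dderiv f y v)" if "v \<in> V" for v
    using Ck_on_cong[of "\<lambda>y. dderiv f y v" "h v" k] assms(2,3) that by auto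
  then show ?thesis using assms(1) by auto
qed

lemma Ck_on_SucD:
  assumes "Ck_on (Suc k) V D f"
  shows "f differentiable_on D" "v \<in> V \<Longrightarrow> Ck_on k V D (\<lambda>y. dderiv f y v)"
  using assms by auto

lemma Ck_on_Suc_imp: "Ck_on (Suc k) V D f \<Longrightarrow> Ck_on k V D f"
proof (induction k arbitrary: f)
  case 0
  then show ?case by (auto intro: differentiable_imp_continuous_on)
next
  case (Suc k)
  show ?case
    by (rule Ck_on_SucI[where h = "\<lambda>v y. dderiv f y v"])
      (auto simp del: Ck_on.simps intro: Ck_on_SucD[OF Suc.prems] Suc.IH)
qed

lemma Ck_on_const: "Ck_on k V D (\<lambda>y. c)"
proof (induction k arbitrary: c)
  case (Suc k)
  then show ?case by (auto simp: differentiable_on_def)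
qed simp

lemma Ck_on_bounded_linear_id:
  assumes "bounded_linear L"
  shows "Ck_on k V D L"
proof (cases k)
  case 0
  then show ?thesis using linear_continuous_on[OF assms] by simp
next
  case (Suc k')
  then show ?thesis
    using assms Ck_on_const
    by (auto simp: dderiv_bounded_linear_id bounded_linear_imp_differentiable_on simp del: Ck_on.simps(1))
qed

lemma Ck_on_bounded_linear:
  assumes L: "bounded_linear L"
  shows "Ck_on k V D f \<Longrightarrow> Ck_on k V D (\<lambda>y. L (f y))"
proof (induction k arbitrary: f)
  case 0
  then show ?case using bounded_linear.continuous_on[OF L] by auto
next
  case (Suc k)
  have "(\<lambda>y. L (f y)) differentiable_on D"
    using Suc.prems bounded_linear.has_derivative[OF L]
    unfolding Ck_on.simps differentiable_on_def differentiable_def by blast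
  then show ?case
    by (intro Ck_on_SucI[where h = "\<lambda>v y. L (dderiv f y v)"] Suc.IH
        Ck_on_SucD(2)[OF Suc.prems] dderiv_bounded_linear[OF L] Ck_on_SucD(1)[OF Suc.prems])
qed

lemma Ck_on_add: "Ck_on k V D f \<Longrightarrow> Ck_on k V D h \<Longrightarrow> Ck_on k V D (\<lambda>y. f y + h y)"
proof (induction k arbitrary: f h)
  case 0
  then show ?case by (auto intro: continuous_on_add)
next
  case (Suc k)
  note Df = Ck_on_SucD[OF Suc.prems(1)] and Dh = Ck_on_SucD[OF Suc.prems(2)]
  show ?case
    by (intro Ck_on_SucI[where h = "\<lambda>v y. dderiv f y v + dderiv h y v"] Suc.IH
        Df Dh dderiv_add differentiable_on_add)
qed

lemma Ck_on_sum: "(\<And>i. i \<in> I \<Longrightarrow> Ck_on k V D (f i)) \<Longrightarrow> Ck_on k V D (\<lambda>y. \<Sum>i\<in>I. f i y)"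
  by (induction I rule: infinite_finite_induct) (auto intro: Ck_on_const Ck_on_add)

lemma differentiable_on_bilinear:
  assumes "bounded_bilinear B" "f differentiable_on D" "h differentiable_on D"
  shows "(\<lambda>y. B (f y) (h y)) differentiable_on D"
  using assms bounded_bilinear.FDERIV[OF assms(1)]
  unfolding differentiable_on_def differentiable_def by blast

lemma Ck_on_bilinear:
  assumes B: "bounded_bilinear B"
  shows "Ck_on k V D f \<Longrightarrow> Ck_on k V D h \<Longrightarrow> Ck_on k V D (\<lambda>y. B (f y) (h y))"
proof (induction k arbitrary: f h)
  case 0
  then show ?case by (auto intro: bounded_bilinear.continuous_on[OF B])
next
  case (Suc k)
  note Df = Ck_on_SucD[OF Suc.prems(1)] and Dh = Ck_on_SucD[OF Suc.prems(2)]
  show ?case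
    by (intro Ck_on_SucI[where h = "\<lambda>v y. B (f y) (dderiv h y v) + B (dderiv f y v) (h y)"]
        Ck_on_add Suc.IH Df Dh Ck_on_Suc_imp[OF Suc.prems(1)] Ck_on_Suc_imp[OF Suc.prems(2)]
        dderiv_bilinear[OF B] differentiable_on_bilinear[OF B])
qed

lemmas Ck_on_mult = Ck_on_bilinear[OF bounded_bilinear_mult]

lemma Ck_on_prod:
  fixes f :: "'i \<Rightarrow> 'e \<Rightarrow> 'b::{real_normed_field}"
  shows "(\<And>i. i \<in> I \<Longrightarrow> Ck_on k V D (f i)) \<Longrightarrow> Ck_on k V D (\<lambda>y. \<Prod>i\<in>I. f i y)"
  by (induction I rule: infinite_finite_induct) (auto intro: Ck_on_const Ck_on_mult)

lemma dderiv_inverse: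
  fixes f :: "'e \<Rightarrow> 'b::real_normed_field"
  assumes "f differentiable_on D" "y \<in> D" "v \<in> V" "f y \<noteq> 0"
  shows "dderiv (\<lambda>z. inverse (f z)) y v = - (inverse (f y) * dderiv f y v * inverse (f y))"
proof -
  have "((\<lambda>t. inverse (f (y + t *\<^sub>R v))) has_derivative
      (\<lambda>h. - (inverse (f (y + 0 *\<^sub>R v)) * (h *\<^sub>R dderiv f y v) * inverse (f (y + 0 *\<^sub>R v))))) (at 0)"
    using dderiv_line[OF assms(1-3)] assms(4)
    by (intro Deriv.has_derivative_inverse) (auto simp: has_vector_derivative_def)
  then have "((\<lambda>t. inverse (f (y + t *\<^sub>R v))) has_vector_derivative
      - (inverse (f y) * dderiv f y v * inverse (f y))) (at 0)"
    by (simp add: has_vector_derivative_def)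
  then show ?thesis unfolding dderiv_def[of "\<lambda>z. inverse (f z)"] by (rule vector_derivative_at)
qed

lemma Ck_on_inverse:
  fixes f :: "'e \<Rightarrow> 'b::real_normed_field"
  assumes "Ck_on k V D f" "\<And>y. y \<in> D \<Longrightarrow> f y \<noteq> 0"
  shows "Ck_on k V D (\<lambda>y. inverse (f y))"
  using assms
proof (induction k)
  case 0
  then show ?case by (auto intro: continuous_on_inverse)
next
  case (Suc k)
  \<comment> \<open>The derivative of \<open>1/f\<close> contains \<open>1/f\<close> again, so the
    induction hypothesis is used for the same \<open>f\<close>, whose regularity is first lowered by
    one.\<close>
  have C: "Ck_on k V D (\<lambda>y. inverse (f y))"
    using Suc Ck_on_Suc_imp by blast
  note Df = Ck_on_SucD[OF Suc.prems(1)]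
  have "(\<lambda>y. inverse (f y)) differentiable_on D"
    using Df(1) Suc.prems(2)
    unfolding differentiable_on_def by (auto intro!: differentiable_inverse)
  then show ?case
    by (intro Ck_on_SucI[where h = "\<lambda>v y. - (inverse (f y) * dderiv f y v * inverse (f y))"]
        Ck_on_bounded_linear[OF bounded_linear_minus[OF bounded_linear_ident]] Ck_on_mult C Df
        dderiv_inverse Suc.prems(2))
qed

lemma dderiv_powr:
  fixes f :: "'e \<Rightarrow> real"
  assumes "f differentiable_on D" "y \<in> D" "v \<in> V" "f y > 0"
  shows "dderiv (\<lambda>z. f z powr a) y v = a * f y powr (a - 1) * dderiv f y v"
proof -
  have "((\<lambda>t. f (y + t *\<^sub>R v)) has_real_derivative dderiv f y v) (at 0)"
    using dderiv_line[OF assms(1-3)] by (simp add: has_real_derivative_iff_has_vector_derivative)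
  then have "((\<lambda>t. f (y + t *\<^sub>R v) powr a) has_real_derivative a * f y powr (a - 1) * dderiv f y v) (at 0)"
    using assms(4) by (auto intro!: derivative_eq_intros simp: field_simps powr_diff)
  then show ?thesis
    unfolding dderiv_def[of "\<lambda>z. f z powr a"]
    by (auto intro: vector_derivative_at simp: has_real_derivative_iff_has_vector_derivative)
qed

text \<open>Serves the factor that normalizes determinants to 1 in the explicit parametrizations.
  The induction generalizes over the exponent because differentiation lowers it by 1.\<close>

lemma Ck_on_powr:
  fixes f :: "'e \<Rightarrow> real"
  assumes "Ck_on k V D f" "\<And>y. y \<in> D \<Longrightarrow> f y > 0"
  shows "Ck_on k V D (\<lambda>y. f y powr a)"
  using assms
proof (induction k arbitrary: a)
  case 0
  then show ?case by (force intro: continuous_on_powr)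
next
  case (Suc k)
  have C: "Ck_on k V D (\<lambda>y. f y powr b)" for b
    using Suc Ck_on_Suc_imp by blast
  note Df = Ck_on_SucD[OF Suc.prems(1)]
  have "(\<lambda>y. f y powr a) differentiable_on D"
    unfolding differentiable_on_def
  proof
    fix y assume y: "y \<in> D"
    obtain f' where "(f has_derivative f') (at y within D)"
      using Df(1) y by (auto simp: differentiable_on_def differentiable_def)
    from has_derivative_powr[OF this has_derivative_const Suc.prems(2)[OF y] y]
    show "(\<lambda>y. f y powr a) differentiable (at y within D)"
      unfolding differentiable_def by blast
  qed
  then show ?case
    by (intro Ck_on_SucI[where h = "\<lambda>v y. a * f y powr (a - 1) * dderiv f y v"]
        Ck_on_mult Ck_on_const C Df dderiv_powr Suc.prems(2))
qed

lemma bounded_linear_axis: "bounded_linear (axis i :: 'b::real_normed_vector \<Rightarrow> 'b ^ 'm::finite)"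
proof
  show "axis i (x + y) = (axis i x + axis i y :: 'b ^ 'm)" for x y
    by (simp add: axis_def vec_eq_iff)
  show "axis i (r *\<^sub>R x) = (r *\<^sub>R axis i x :: 'b ^ 'm)" for r x
    by (simp add: axis_def vec_eq_iff)
  show "\<exists>K. \<forall>x. norm (axis i x :: 'b ^ 'm) \<le> norm x * K"
    by (rule exI[of _ 1])
      (simp add: norm_vec_def L2_set_def axis_def if_distrib[of norm] if_distrib[of "\<lambda>x. x\<^sup>2"] cong: if_cong)
qed

lemma Ck_on_vec_lambda:
  fixes f :: "'m::finite \<Rightarrow> 'e \<Rightarrow> 'b::real_normed_vector"
  assumes "\<And>i. Ck_on k V D (f i)"
  shows "Ck_on k V D (\<lambda>y. \<chi> i. f i y)"
proof -
  have "(\<lambda>y. \<chi> i. f i y) = (\<lambda>y. \<Sum>i\<in>UNIV. axis i (f i y))"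
    by (auto simp: vec_eq_iff axis_def fun_eq_iff if_distrib sum.delta cong: if_cong)
  then show ?thesis
    using assms by (auto intro!: Ck_on_sum Ck_on_bounded_linear[OF bounded_linear_axis])
qed

lemma Ck_on_det:
  fixes A :: "'e \<Rightarrow> complex ^ 'm::finite ^ 'm"
  assumes "\<And>i j. Ck_on k V D (\<lambda>y. A y $ i $ j)"
  shows "Ck_on k V D (\<lambda>y. det (A y))"
  unfolding det_def using assms by (intro Ck_on_sum Ck_on_mult Ck_on_const Ck_on_prod)

end

section \<open>Symmetry of second directional derivatives\<close>

context chart_domain
begin

lemma dderiv_line_real:
  fixes f :: "'e \<Rightarrow> real"
  assumes "f differentiable_on D" "z + a *\<^sub>R v \<in> D" "v \<in> V"
  shows "((\<lambda>t. f (z + t *\<^sub>R v)) has_real_derivative dderiv f (z + a *\<^sub>R v) v) (at a)"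
proof -
  have "((\<lambda>t. f (z + a *\<^sub>R v + t *\<^sub>R v)) has_real_derivative dderiv f (z + a *\<^sub>R v) v) (at 0)"
    using dderiv_line[OF assms] by (simp add: has_real_derivative_iff_has_vector_derivative)
  then show ?thesis
    using DERIV_shift[of "\<lambda>t. f (z + t *\<^sub>R v)" _ 0 a] by (simp add: algebra_simps)
qed

text \<open>The mean value theorem is applied twice, along \<open>v\<close> to the difference of
  \<open>f\<close> on two parallel sides and then along \<open>w\<close> to the derivative. The
  second difference is symmetric in \<open>v\<close> and \<open>w\<close> while the order of
  differentiation is not, which is what the symmetry proof exploits.\<close>

lemma second_difference:
  fixes f :: "'e \<Rightarrow> real"
  assumes f: "Ck_on 2 V D f" and v: "v \<in> V" and w: "w \<in> V" and h: "0 < h"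
    and in_D: "\<And>a b. \<lbrakk>0 \<le> a; a \<le> h; 0 \<le> b; b \<le> h\<rbrakk> \<Longrightarrow> y + a *\<^sub>R v + b *\<^sub>R w \<in> D"
  obtains a b where "0 < a" "a < h" "0 < b" "b < h"
    "f (y + h *\<^sub>R v + h *\<^sub>R w) - f (y + h *\<^sub>R v) - f (y + h *\<^sub>R w) + f y
      = h * h * dderiv (\<lambda>z. dderiv f z v) (y + a *\<^sub>R v + b *\<^sub>R w) w"
proof -
  have f1: "f differentiable_on D" and f2: "(\<lambda>z. dderiv f z v) differentiable_on D"
    using f v by (auto simp: numeral_2_eq_2)
  have "\<exists>a>0. a < h \<and> (f (y + h *\<^sub>R w + h *\<^sub>R v) - f (y + h *\<^sub>R v)) - (f (y + h *\<^sub>R w + 0 *\<^sub>R v) - f (y + 0 *\<^sub>R v))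
      = (h - 0) * (dderiv f (y + h *\<^sub>R w + a *\<^sub>R v) v - dderiv f (y + a *\<^sub>R v) v)"
  proof (rule MVT2[OF h])
    fix a assume a: "0 \<le> a" "a \<le> h"
    have "y + h *\<^sub>R w + a *\<^sub>R v \<in> D" "y + a *\<^sub>R v \<in> D"
      using in_D[of a h] in_D[of a 0] a h by (auto simp: algebra_simps)
    then show "((\<lambda>a. f (y + h *\<^sub>R w + a *\<^sub>R v) - f (y + a *\<^sub>R v)) has_real_derivative
        dderiv f (y + h *\<^sub>R w + a *\<^sub>R v) v - dderiv f (y + a *\<^sub>R v) v) (at a)"
      by (intro DERIV_diff dderiv_line_real f1 v)
  qed
  then obtain a where a: "0 < a" "a < h"
    and A: "f (y + h *\<^sub>R w + h *\<^sub>R v) - f (y + h *\<^sub>R v) - (f (y + h *\<^sub>R w) - f y)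
      = h * (dderiv f (y + h *\<^sub>R w + a *\<^sub>R v) v - dderiv f (y + a *\<^sub>R v) v)"
    by auto
  have "\<exists>b>0. b < h \<and> dderiv f (y + a *\<^sub>R v + h *\<^sub>R w) v - dderiv f (y + a *\<^sub>R v + 0 *\<^sub>R w) v
      = (h - 0) * dderiv (\<lambda>z. dderiv f z v) (y + a *\<^sub>R v + b *\<^sub>R w) w"
  proof (rule MVT2[OF h])
    fix b assume "0 \<le> b" "b \<le> h"
    then show "((\<lambda>b. dderiv f (y + a *\<^sub>R v + b *\<^sub>R w) v) has_real_derivative
        dderiv (\<lambda>z. dderiv f z v) (y + a *\<^sub>R v + b *\<^sub>R w) w) (at b)"
      using a by (intro dderiv_line_real f2 w in_D) auto
  qed
  then obtain b where b: "0 < b" "b < h"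
    and B: "dderiv f (y + a *\<^sub>R v + h *\<^sub>R w) v - dderiv f (y + a *\<^sub>R v) v
      = h * dderiv (\<lambda>z. dderiv f z v) (y + a *\<^sub>R v + b *\<^sub>R w) w"
    by auto
  have "f (y + h *\<^sub>R v + h *\<^sub>R w) - f (y + h *\<^sub>R v) - f (y + h *\<^sub>R w) + f y
      = h * (dderiv f (y + a *\<^sub>R v + h *\<^sub>R w) v - dderiv f (y + a *\<^sub>R v) v)"
    using A by (simp add: algebra_simps)
  with B show thesis by (intro that[OF a b]) simp
qed

text \<open>The two orders of the second difference produce points arbitrarily close to
  \<open>y\<close> at which the two mixed derivatives have equal values. By continuity their values
  at \<open>y\<close> cannot differ by \<open>2 e\<close>.\<close>

lemma dderiv_commute_real:
  fixes f :: "'e \<Rightarrow> real"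
  assumes f: "Ck_on 2 V D f" and y: "y \<in> D" and v: "v \<in> V" and w: "w \<in> V"
  shows "dderiv (\<lambda>z. dderiv f z v) y w = dderiv (\<lambda>z. dderiv f z w) y v"
proof (rule ccontr)
  let ?F = "\<lambda>z. dderiv (\<lambda>z. dderiv f z v) z w" and ?G = "\<lambda>z. dderiv (\<lambda>z. dderiv f z w) z v"
  assume "?F y \<noteq> ?G y"
  define e where "e = \<bar>?F y - ?G y\<bar> / 2"
  have e: "e > 0" using \<open>?F y \<noteq> ?G y\<close> by (simp add: e_def)
  have cF: "continuous_on D ?F" and cG: "continuous_on D ?G"
    using f v w by (auto simp: numeral_2_eq_2)
  obtain d1 where d1: "d1 > 0" "\<And>z. z \<in> D \<Longrightarrow> dist z y < d1 \<Longrightarrow> dist (?F z) (?F y) < e"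
    using cF y e unfolding continuous_on_iff by blast
  obtain d2 where d2: "d2 > 0" "\<And>z. z \<in> D \<Longrightarrow> dist z y < d2 \<Longrightarrow> dist (?G z) (?G y) < e"
    using cG y e unfolding continuous_on_iff by blast
  obtain T where T: "open T" "D = V \<inter> T"
    using openin_D by (auto simp: openin_open)
  obtain d3 where d3: "d3 > 0" "\<And>z. dist z y < d3 \<Longrightarrow> z \<in> T"
    using T y unfolding open_dist by blast
  define d where "d = min d1 (min d2 d3)"
  \<comment> \<open>With this side length the whole parallelogram spanned by \<open>h v\<close> and
    \<open>h w\<close> stays within distance \<open>d\<close> of \<open>y\<close>; the summand 1
    keeps the denominator positive.\<close>
  define h where "h = d / (1 + norm v + norm w)"
  have d: "d > 0" "d \<le> d1" "d \<le> d2" "d \<le> d3"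
    using d1 d2 d3 by (auto simp: d_def)
  have pos: "1 + norm v + norm w > 0"
    using norm_ge_zero[of v] norm_ge_zero[of w] by linarith
  have h: "h > 0" using d pos by (simp add: h_def)
  have near: "dist (y + a *\<^sub>R v + b *\<^sub>R w) y < d" if "0 \<le> a" "a \<le> h" "0 \<le> b" "b \<le> h" for a b
  proof -
    have "dist (y + a *\<^sub>R v + b *\<^sub>R w) y = norm (a *\<^sub>R v + b *\<^sub>R w)"
      by (simp add: dist_norm algebra_simps)
    also have "\<dots> \<le> a * norm v + b * norm w"
      using norm_triangle_ineq[of "a *\<^sub>R v" "b *\<^sub>R w"] that by simp
    also have "\<dots> \<le> h * norm v + h * norm w"
      using that by (intro add_mono mult_right_mono) auto
    also have "\<dots> < h * (1 + norm v + norm w)"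
      using h by (simp add: algebra_simps)
    also have "\<dots> = d" using pos by (simp add: h_def)
    finally show ?thesis .
  qed
  have in_D: "y + a *\<^sub>R v + b *\<^sub>R w \<in> D" if "0 \<le> a" "a \<le> h" "0 \<le> b" "b \<le> h" for a b
  proof -
    have "y + a *\<^sub>R v + b *\<^sub>R w \<in> V"
      using y v w D_subset_V subspace_V by (auto intro: subspace_add subspace_scale)
    moreover have "y + a *\<^sub>R v + b *\<^sub>R w \<in> T"
      using near[OF that] d by (intro d3) auto
    ultimately show ?thesis using T by auto
  qed
  obtain a b where ab: "0 < a" "a < h" "0 < b" "b < h"
    "f (y + h *\<^sub>R v + h *\<^sub>R w) - f (y + h *\<^sub>R v) - f (y + h *\<^sub>R w) + f y
      = h * h * ?F (y + a *\<^sub>R v + b *\<^sub>R w)"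
    by (rule second_difference[OF f v w h in_D])
  have in_D': "y + a *\<^sub>R w + b *\<^sub>R v \<in> D" if "0 \<le> a" "a \<le> h" "0 \<le> b" "b \<le> h" for a b
    using in_D[of b a] that by (simp add: add_ac)
  obtain a' b' where ab': "0 < a'" "a' < h" "0 < b'" "b' < h"
    "f (y + h *\<^sub>R w + h *\<^sub>R v) - f (y + h *\<^sub>R w) - f (y + h *\<^sub>R v) + f y
      = h * h * ?G (y + a' *\<^sub>R w + b' *\<^sub>R v)"
    by (rule second_difference[OF f w v h in_D'])
  have "h * h * ?F (y + a *\<^sub>R v + b *\<^sub>R w) = h * h * ?G (y + a' *\<^sub>R w + b' *\<^sub>R v)"
    using ab(5) ab'(5)[unfolded add.assoc add.commute[of "h *\<^sub>R w"], folded add.assoc] by linarith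
  then have eq: "?F (y + a *\<^sub>R v + b *\<^sub>R w) = ?G (y + b' *\<^sub>R v + a' *\<^sub>R w)"
    using h by (simp add: add_ac)
  have "dist (?F (y + a *\<^sub>R v + b *\<^sub>R w)) (?F y) < e"
    using ab near[of a b] d by (intro d1 in_D) auto
  moreover have "dist (?G (y + b' *\<^sub>R v + a' *\<^sub>R w)) (?G y) < e"
    using ab' near[of b' a'] d by (intro d2 in_D) auto
  ultimately have "\<bar>?F y - ?G y\<bar> < 2 * e"
    unfolding eq dist_real_def by linarith
  then show False by (simp add: e_def)
qed

lemma dderiv_commute:
  fixes f :: "'e \<Rightarrow> 'b::euclidean_space"
  assumes f: "Ck_on 2 V D f" and y: "y \<in> D" and v: "v \<in> V" and w: "w \<in> V"
  shows "dderiv (\<lambda>z. dderiv f z v) y w = dderiv (\<lambda>z. dderiv f z w) y v"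
proof (rule euclidean_eqI)
  fix b :: 'b assume "b \<in> Basis"
  have f1: "f differentiable_on D" and f2: "(\<lambda>z. dderiv f z u) differentiable_on D" if "u \<in> V" for u
    using f that by (auto simp: numeral_2_eq_2)
  have L: "bounded_linear (\<lambda>x::'b. x \<bullet> b)" by (rule bounded_linear_inner_left)
  have *: "dderiv (\<lambda>z. dderiv f z u) y x \<bullet> b = dderiv (\<lambda>z. dderiv (\<lambda>z. f z \<bullet> b) z u) y x"
    if ux: "u \<in> V" "x \<in> V" for u x
  proof -
    have "dderiv (\<lambda>z. dderiv (\<lambda>z. f z \<bullet> b) z u) y x = dderiv (\<lambda>z. dderiv f z u \<bullet> b) y x"
      by (rule dderiv_cong[OF _ y ux(2)]) (rule dderiv_bounded_linear[OF L f1 _ ux(1)], rule ux(1))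
    also have "\<dots> = dderiv (\<lambda>z. dderiv f z u) y x \<bullet> b"
      by (rule dderiv_bounded_linear[OF L f2 y ux(2)]) (rule ux(1))
    finally show ?thesis ..
  qed
  show "dderiv (\<lambda>z. dderiv f z v) y w \<bullet> b = dderiv (\<lambda>z. dderiv f z w) y v \<bullet> b"
    using dderiv_commute_real[OF Ck_on_bounded_linear[OF L f] y v w] * v w by simp
qed

end

section \<open>The Laplacian in a frame\<close>

text \<open>Since \<open>h\<close> vanishes at 0, the difference quotient of the product is
  \<open>x t * (h t / t)\<close>, so continuity of \<open>x\<close> suffices. This avoids
  circularity when the differentiability of \<open>x\<close> is what is to be shown.\<close>

lemma DERIV_mult_zero:
  fixes x h :: "real \<Rightarrow> real"
  assumes "isCont x 0" "(h has_real_derivative d) (at 0)" "h 0 = 0"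
  shows "((\<lambda>t. x t * h t) has_real_derivative x 0 * d) (at 0)"
proof -
  have "((\<lambda>t. h t / t) \<longlongrightarrow> d) (at 0)"
    using assms(2,3) by (simp add: DERIV_def)
  then have "((\<lambda>t. x t * (h t / t)) \<longlongrightarrow> x 0 * d) (at 0)"
    using assms(1) by (intro tendsto_mult) (auto simp: isCont_def)
  then show ?thesis using assms(3) by (simp add: DERIV_def)
qed

text \<open>
  The gradient is only given implicitly. Along a line through \<open>y\<close>, its coefficients with respect
  to a frame at \<open>y\<close> solve a system of the following kind, which is why they are differentiable.
\<close>

lemma perturbed_system_differentiable:
  fixes x f :: "'i \<Rightarrow> real \<Rightarrow> real" and h :: "'i \<Rightarrow> 'i \<Rightarrow> real \<Rightarrow> real"
  assumes fin: "finite B"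
    and sys: "eventually (\<lambda>t. \<forall>i\<in>B. x i t = f i t - (\<Sum>j\<in>B. x j t * h j i t)) (nhds 0)"
    and f: "\<And>i. i \<in> B \<Longrightarrow> (f i has_real_derivative f' i) (at 0)"
    and h: "\<And>i j. i \<in> B \<Longrightarrow> j \<in> B \<Longrightarrow> (h j i has_real_derivative h' j i) (at 0)"
    and h0: "\<And>i j. i \<in> B \<Longrightarrow> j \<in> B \<Longrightarrow> h j i 0 = 0"
    and i: "i \<in> B"
  shows "(x i has_real_derivative f' i - (\<Sum>j\<in>B. x j 0 * h' j i)) (at 0)"
proof -
  define M where "M t = (\<Sum>i\<in>B. \<bar>x i t\<bar>)" for t
  define \<eta> where "\<eta> t = (\<Sum>i\<in>B. \<Sum>j\<in>B. \<bar>h j i t\<bar>)" for t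
  define N where "N t = (\<Sum>i\<in>B. \<bar>f i t\<bar>)" for t
  have cont_f: "isCont (f i) 0" if "i \<in> B" for i
    using f[OF that] DERIV_isCont by blast
  have cont_h: "isCont (h j i) 0" if "i \<in> B" "j \<in> B" for i j
    using h[OF that] DERIV_isCont by blast
  have "isCont \<eta> 0" "\<eta> 0 = 0"
    unfolding \<eta>_def by (auto intro!: continuous_intros cont_h simp: h0)
  then have "(\<eta> \<longlongrightarrow> 0) (nhds 0)"
    by (simp add: tendsto_nhds_iff isCont_def)
  then have ev1: "eventually (\<lambda>t. \<eta> t < 1 / 2) (nhds 0)"
    by (rule order_tendstoD) simp
  have "isCont N 0"
    unfolding N_def by (auto intro!: continuous_intros cont_f)
  then have "(N \<longlongrightarrow> N 0) (nhds 0)"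
    by (simp add: tendsto_nhds_iff isCont_def)
  then have ev2: "eventually (\<lambda>t. N t < N 0 + 1) (nhds 0)"
    by (rule order_tendstoD) simp
  \<comment> \<open>The system gives \<open>M \<le> N + M * \<eta>\<close>; for
    \<open>\<eta> < 1/2\<close> the last term can be absorbed, so \<open>M \<le> 2 * N\<close>. The
    solution is thus bounded near 0 before anything is known about its continuity.\<close>
  have bound: "eventually (\<lambda>t. M t \<le> 2 * (N 0 + 1)) (nhds 0)"
    using sys ev1 ev2
  proof eventually_elim
    case (elim t)
    have xM: "\<bar>x j t\<bar> \<le> M t" if "j \<in> B" for j
      unfolding M_def using that fin by (intro member_le_sum) auto
    have "M t \<le> (\<Sum>i\<in>B. \<bar>f i t\<bar> + (\<Sum>j\<in>B. M t * \<bar>h j i t\<bar>))"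
      unfolding M_def[of t]
    proof (rule sum_mono)
      fix i assume i: "i \<in> B"
      have "\<bar>\<Sum>j\<in>B. x j t * h j i t\<bar> \<le> (\<Sum>j\<in>B. M t * \<bar>h j i t\<bar>)"
        by (rule order_trans[OF sum_abs]) (auto intro!: sum_mono mult_right_mono xM simp: abs_mult)
      moreover have "x i t = f i t - (\<Sum>j\<in>B. x j t * h j i t)" using elim i by blast
      ultimately show "\<bar>x i t\<bar> \<le> \<bar>f i t\<bar> + (\<Sum>j\<in>B. (\<Sum>i\<in>B. \<bar>x i t\<bar>) * \<bar>h j i t\<bar>)"
        unfolding M_def by linarith
    qed
    also have "\<dots> = N t + M t * \<eta> t"
      by (simp add: N_def \<eta>_def sum.distrib sum_distrib_left)
    also have "M t * \<eta> t \<le> M t * (1 / 2)"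
      using elim by (intro mult_left_mono) (auto simp: M_def intro: sum_nonneg)
    finally have "M t \<le> 2 * N t" by simp
    then show ?case using elim by simp
  qed
  \<comment> \<open>A bounded factor times one that tends to 0. This yields continuity of the
    \<open>x i\<close> at 0, and only then can \<open>DERIV_mult_zero\<close> be applied to the
    products.\<close>
  have prod0: "((\<lambda>t. x j t * h j i t) \<longlongrightarrow> 0) (nhds 0)" if "i \<in> B" "j \<in> B" for i j
  proof (rule tendsto_rabs_zero_cancel, rule tendsto_sandwich)
    show "eventually (\<lambda>t. 0 \<le> \<bar>x j t * h j i t\<bar>) (nhds 0)" by simp
    show "eventually (\<lambda>t. \<bar>x j t * h j i t\<bar> \<le> 2 * (N 0 + 1) * \<bar>h j i t\<bar>) (nhds 0)"
      using bound
    proof eventually_elim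
      case (elim t)
      have "\<bar>x j t\<bar> \<le> M t"
        unfolding M_def using that fin by (intro member_le_sum) auto
      with elim show ?case by (auto simp: abs_mult intro!: mult_right_mono)
    qed
    have "(h j i \<longlongrightarrow> 0) (nhds 0)"
      using cont_h[OF that] h0[OF that] by (simp add: tendsto_nhds_iff isCont_def)
    then show "((\<lambda>t. 2 * (N 0 + 1) * \<bar>h j i t\<bar>) \<longlongrightarrow> 0) (nhds 0)"
      by (auto intro!: tendsto_eq_intros)
  qed simp
  have x0: "x i 0 = f i 0" if "i \<in> B" for i
    using eventually_nhds_x_imp_x[OF sys] that h0 by simp
  have cont_x: "isCont (x i) 0" if i: "i \<in> B" for i
  proof -
    have "((\<lambda>t. f i t - (\<Sum>j\<in>B. x j t * h j i t)) \<longlongrightarrow> f i 0 - (\<Sum>j\<in>B. 0)) (nhds 0)"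
      using cont_f[OF i] prod0[OF i]
      by (intro tendsto_diff tendsto_sum) (auto simp: tendsto_nhds_iff isCont_def)
    moreover have "eventually (\<lambda>t. f i t - (\<Sum>j\<in>B. x j t * h j i t) = x i t) (nhds 0)"
      using sys i by (auto elim: eventually_mono)
    ultimately have "(x i \<longlongrightarrow> x i 0) (nhds 0)"
      using x0[OF i] by (simp add: tendsto_cong)
    then show ?thesis by (simp add: tendsto_nhds_iff isCont_def)
  qed
  have "((\<lambda>t. f i t - (\<Sum>j\<in>B. x j t * h j i t)) has_real_derivative
      f' i - (\<Sum>j\<in>B. x j 0 * h' j i)) (at 0)"
    using i by (intro DERIV_diff f DERIV_sum DERIV_mult_zero cont_x h h0)
  moreover have "eventually (\<lambda>t. f i t - (\<Sum>j\<in>B. x j t * h j i t) = x i t) (nhds 0)"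
    using sys i by (auto elim: eventually_mono)
  ultimately show ?thesis
    by (rule DERIV_cong_ev[THEN iffD1, OF refl _ refl, rotated])
qed

definition linear_within :: "'e::real_vector set \<Rightarrow> ('e \<Rightarrow> 'b::real_vector) \<Rightarrow> bool" where
  "linear_within V \<phi> \<longleftrightarrow>
    (\<forall>u\<in>V. \<forall>w\<in>V. \<phi> (u + w) = \<phi> u + \<phi> w) \<and> (\<forall>c. \<forall>u\<in>V. \<phi> (c *\<^sub>R u) = c *\<^sub>R \<phi> u)"

lemma linear_within_sum:
  assumes \<phi>: "linear_within V \<phi>" and V: "subspace V" and v: "\<And>i. i \<in> I \<Longrightarrow> v i \<in> V"
  shows "\<phi> (\<Sum>i\<in>I. c i *\<^sub>R v i) = (\<Sum>i\<in>I. c i *\<^sub>R \<phi> (v i))"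
proof -
  have 0: "\<phi> 0 = 0"
    using \<phi> subspace_0[OF V] unfolding linear_within_def by (metis scaleR_zero_left)
  have scale: "\<phi> (c *\<^sub>R u) = c *\<^sub>R \<phi> u" and add: "u' \<in> V \<Longrightarrow> \<phi> (u + u') = \<phi> u + \<phi> u'"
    if "u \<in> V" for c u u'
    using \<phi> that by (auto simp: linear_within_def)
  show ?thesis
    using v
  proof (induction I rule: infinite_finite_induct)
    case (insert i I)
    then show ?case
      using V by (simp add: scale add subspace_sum subspace_scale)
  qed (simp_all add: 0)
qed

text \<open>The frame condition is a completeness relation. It contains nondegeneracy, and
  gradients, traces and scalar products expand directly by it. The index set is separate from the
  vectors because one fixed basis of a Lie algebra or tangent space is carried to each point by
  \<open>e\<close>.\<close>

locale metric_chart = chart_domain V D for V D :: "'e::euclidean_space set" +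
  fixes g :: "'e \<Rightarrow> 'e \<Rightarrow> 'e \<Rightarrow> real"
  assumes g_linear: "y \<in> D \<Longrightarrow> w \<in> V \<Longrightarrow> linear_within V (\<lambda>u. g y u w)"
    and g_sym: "y \<in> D \<Longrightarrow> u \<in> V \<Longrightarrow> w \<in> V \<Longrightarrow> g y u w = g y w u"
    and g_diff: "u \<in> V \<Longrightarrow> w \<in> V \<Longrightarrow> (\<lambda>y. g y u w) differentiable_on D"
    and frame_exists: "y \<in> D \<Longrightarrow> \<exists>(B::'e set) e \<epsilon>. finite B \<and> (\<forall>E\<in>B. e E \<in> V) \<and>
      (\<forall>u\<in>V. (\<Sum>E\<in>B. (\<epsilon> E * g y u (e E)) *\<^sub>R e E) = u)"
begin

definition is_frame :: "'e \<Rightarrow> 'e set \<Rightarrow> ('e \<Rightarrow> 'e) \<Rightarrow> ('e \<Rightarrow> real) \<Rightarrow> bool" where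
  "is_frame y B e \<epsilon> \<longleftrightarrow> finite B \<and> (\<forall>E\<in>B. e E \<in> V) \<and>
      (\<forall>u\<in>V. (\<Sum>E\<in>B. (\<epsilon> E * g y u (e E)) *\<^sub>R e E) = u)"

abbreviation Dg :: "'e \<Rightarrow> 'e \<Rightarrow> 'e \<Rightarrow> 'e \<Rightarrow> real" where
  "Dg y z u w \<equiv> dderiv (\<lambda>y. g y u w) y z"

lemma frameE:
  assumes "y \<in> D" obtains B e \<epsilon> where "is_frame y B e \<epsilon>"
  using frame_exists[OF assms] unfolding is_frame_def by blast

lemma frameD:
  assumes "is_frame y B e \<epsilon>"
  shows "finite B" "E \<in> B \<Longrightarrow> e E \<in> V" "u \<in> V \<Longrightarrow> (\<Sum>E\<in>B. (\<epsilon> E * g y u (e E)) *\<^sub>R e E) = u"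
  using assms by (auto simp: is_frame_def)

lemma g_sum:
  assumes "y \<in> D" "w \<in> V" "\<And>i. i \<in> I \<Longrightarrow> v i \<in> V"
  shows "g y (\<Sum>i\<in>I. c i *\<^sub>R v i) w = (\<Sum>i\<in>I. c i * g y (v i) w)"
  using linear_within_sum[OF g_linear[OF assms(1,2)] subspace_V assms(3)] by simp

text \<open>The frame belongs to \<open>y\<close>, the form on the left to another point
  \<open>z\<close>. Expanding a vector in the fixed frame while the form varies turns the implicit
  equation for the gradient into a linear system for its coefficients.\<close>

lemma g_expand:
  assumes "is_frame y B e \<epsilon>" "z \<in> D" "u \<in> V" "w \<in> V"
  shows "g z u w = (\<Sum>E\<in>B. \<epsilon> E * g y u (e E) * g z (e E) w)"
  using g_sum[OF assms(2,4), of B e "\<lambda>E. \<epsilon> E * g y u (e E)"] frameD[OF assms(1)] assms(3) by simp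

lemma g_eqD:
  assumes y: "y \<in> D" and "u \<in> V" "u' \<in> V" "\<And>w. w \<in> V \<Longrightarrow> g y u w = g y u' w"
  shows "u = u'"
proof -
  obtain B e \<epsilon> where fr: "is_frame y B e \<epsilon>" using frameE[OF y] .
  have "u = (\<Sum>E\<in>B. (\<epsilon> E * g y u (e E)) *\<^sub>R e E)"
    using frameD(3)[OF fr assms(2)] by simp
  also have "\<dots> = (\<Sum>E\<in>B. (\<epsilon> E * g y u' (e E)) *\<^sub>R e E)"
    using frameD(2)[OF fr] assms(4) by simp
  also have "\<dots> = u'" by (rule frameD(3)[OF fr assms(3)])
  finally show ?thesis .
qed

text \<open>Justifies the descriptions in \<open>grad_in\<close> and \<open>christoffel\<close>. The
  representing vector is the frame expansion with coefficients
  \<open>\<epsilon> E * \<phi> (e E)\<close>.\<close>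

lemma riesz:
  assumes y: "y \<in> D" and \<phi>: "linear_within V \<phi>"
  shows "\<exists>!u. u \<in> V \<and> (\<forall>w\<in>V. g y u w = \<phi> w)"
proof -
  obtain B e \<epsilon> where fr: "is_frame y B e \<epsilon>" using frameE[OF y] .
  let ?u = "\<Sum>E\<in>B. (\<epsilon> E * \<phi> (e E)) *\<^sub>R e E"
  have "?u \<in> V"
    using frameD(2)[OF fr] subspace_V by (intro subspace_sum subspace_scale)
  moreover have "g y ?u w = \<phi> w" if w: "w \<in> V" for w
  proof -
    have "g y ?u w = (\<Sum>E\<in>B. \<epsilon> E * \<phi> (e E) * g y (e E) w)"
      by (rule g_sum[OF y w frameD(2)[OF fr]])
    also have "\<dots> = (\<Sum>E\<in>B. (\<epsilon> E * g y w (e E)) *\<^sub>R \<phi> (e E))"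
      using frameD(2)[OF fr] g_sym[OF y w] by (intro sum.cong) auto
    also have "\<dots> = \<phi> (\<Sum>E\<in>B. (\<epsilon> E * g y w (e E)) *\<^sub>R e E)"
      by (rule linear_within_sum[OF \<phi> subspace_V frameD(2)[OF fr], symmetric])
    also have "\<dots> = \<phi> w" using frameD(3)[OF fr w] by simp
    finally show ?thesis .
  qed
  ultimately show ?thesis
    using g_eqD[OF y] by (intro ex1I[of _ ?u]) auto
qed

lemma linear_within_dderiv: "f differentiable_on D \<Longrightarrow> y \<in> D \<Longrightarrow> linear_within V (dderiv f y)"
  unfolding linear_within_def by (simp add: dderiv_add_dir dderiv_scale_dir)

lemma linear_within_Dg1:
  assumes "y \<in> D" "u \<in> V" "w \<in> V"
  shows "linear_within V (\<lambda>z. Dg y z u w)"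
  using linear_within_dderiv[OF g_diff assms(1)] assms by simp

lemma linear_within_Dg2:
  assumes y: "y \<in> D" and z: "z \<in> V" and w: "w \<in> V"
  shows "linear_within V (\<lambda>u. Dg y z u w)"
  unfolding linear_within_def
proof (intro conjI ballI allI)
  fix u u' assume u: "u \<in> V" and u': "u' \<in> V"
  have "Dg y z (u + u') w = dderiv (\<lambda>y. g y u w + g y u' w) y z"
    using g_linear[OF _ w] u u' by (intro dderiv_cong y z) (auto simp: linear_within_def)
  then show "Dg y z (u + u') w = Dg y z u w + Dg y z u' w"
    using dderiv_add[OF g_diff g_diff y z] u u' w by simp
next
  fix c u assume u: "u \<in> V"
  have "Dg y z (c *\<^sub>R u) w = dderiv (\<lambda>y. c *\<^sub>R g y u w) y z"
    using g_linear[OF _ w] u by (intro dderiv_cong y z) (auto simp: linear_within_def)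
  then show "Dg y z (c *\<^sub>R u) w = c *\<^sub>R Dg y z u w"
    using dderiv_bounded_linear[OF bounded_linear_scaleR_right g_diff y z] u w by simp
qed

lemma Dg_sym:
  assumes "y \<in> D" "z \<in> V" "u \<in> V" "w \<in> V"
  shows "Dg y z u w = Dg y z w u"
  using assms g_sym by (intro dderiv_cong) auto

lemma linear_within_Dg3:
  assumes "y \<in> D" "z \<in> V" "u \<in> V"
  shows "linear_within V (\<lambda>w. Dg y z u w)"
  using linear_within_Dg2[OF assms] Dg_sym[OF assms(1,2) assms(3)] subspace_V
  unfolding linear_within_def by (simp add: subspace_add subspace_scale)

lemma grad_in_props:
  assumes "f differentiable_on D" "y \<in> D"
  shows "grad_in V g f y \<in> V" "w \<in> V \<Longrightarrow> g y (grad_in V g f y) w = dderiv f y w"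
  using theI'[OF riesz[OF assms(2) linear_within_dderiv[OF assms]]]
  unfolding grad_in_def by blast+

lemma christoffel_props:
  assumes y: "y \<in> D" and u: "u \<in> V" and w: "w \<in> V"
  shows "christoffel V g y u w \<in> V"
    "x \<in> V \<Longrightarrow> 2 * g y (christoffel V g y u w) x = Dg y u w x + Dg y w u x - Dg y x u w"
proof -
  let ?\<phi> = "\<lambda>x. (Dg y u w x + Dg y w u x - Dg y x u w) / 2"
  have "linear_within V ?\<phi>"
    using linear_within_Dg3[OF y u w] linear_within_Dg3[OF y w u] linear_within_Dg1[OF y u w]
    unfolding linear_within_def by (auto simp: field_simps)
  from riesz[OF y this]
  have "\<exists>!z. z \<in> V \<and> (\<forall>x\<in>V. 2 * g y z x = Dg y u w x + Dg y w u x - Dg y x u w)"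
    by (simp add: field_simps)
  from theI'[OF this] show "christoffel V g y u w \<in> V"
    "x \<in> V \<Longrightarrow> 2 * g y (christoffel V g y u w) x = Dg y u w x + Dg y w u x - Dg y x u w"
    unfolding christoffel_def by blast+
qed

text \<open>Formally this differentiates \<open>g (X, w) = df (w)\<close> along \<open>v\<close>;
  the substance is that \<open>X\<close> has a derivative at all. Its coefficients \<open>x\<close>
  in the frame at \<open>y\<close> solve a system whose perturbation \<open>h\<close> is the
  difference of the metrics at \<open>c t\<close> and at \<open>y\<close>, which vanishes at
  \<open>t = 0\<close>.\<close>

lemma dderiv_grad:
  assumes f: "f differentiable_on D" and f2: "\<And>w. w \<in> V \<Longrightarrow> (\<lambda>z. dderiv f z w) differentiable_on D"
    and y: "y \<in> D" and v: "v \<in> V"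
  defines "X \<equiv> grad_in V g f"
  shows "dderiv X y v \<in> V"
    "w \<in> V \<Longrightarrow> g y (dderiv X y v) w = dderiv (\<lambda>z. dderiv f z w) y v - Dg y v (X y) w"
proof -
  obtain B e \<epsilon> where fr: "is_frame y B e \<epsilon>" using frameE[OF y] .
  note fin = frameD(1)[OF fr] and eV = frameD(2)[OF fr]
  define c where "c t = y + t *\<^sub>R v" for t :: real
  have c0: "c 0 = y" by (simp add: c_def)
  have ev: "eventually (\<lambda>t. c t \<in> D) (nhds 0)"
    unfolding c_def by (rule eventually_line[OF y v])
  have XV: "X z \<in> V" and Xg: "w \<in> V \<Longrightarrow> g z (X z) w = dderiv f z w" if "z \<in> D" for z w
    unfolding X_def using grad_in_props[OF f that] by auto
  define x where "x E t = g y (X (c t)) (e E)" for E t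
  define h where "h E' E t = \<epsilon> E' * (g (c t) (e E') (e E) - g y (e E') (e E))" for E' E t
  have der_g: "((\<lambda>t. g (c t) u w) has_real_derivative Dg y v u w) (at 0)" if "u \<in> V" "w \<in> V" for u w
    using dderiv_line[OF g_diff y v] that unfolding c_def
    by (simp add: has_real_derivative_iff_has_vector_derivative)
  have der_f: "((\<lambda>t. dderiv f (c t) w) has_real_derivative dderiv (\<lambda>z. dderiv f z w) y v) (at 0)"
    if "w \<in> V" for w
    using dderiv_line[OF f2 y v] that unfolding c_def
    by (simp add: has_real_derivative_iff_has_vector_derivative)
  have sys: "eventually (\<lambda>t. \<forall>E\<in>B. x E t = dderiv f (c t) (e E) - (\<Sum>E'\<in>B. x E' t * h E' E t)) (nhds 0)"
    using ev
  proof (eventually_elim, intro ballI)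
    fix t E assume t: "c t \<in> D" and E: "E \<in> B"
    have "dderiv f (c t) (e E) = g (c t) (X (c t)) (e E)"
      using Xg[OF t] eV[OF E] by simp
    also have "\<dots> = (\<Sum>E'\<in>B. \<epsilon> E' * x E' t * g (c t) (e E') (e E))"
      unfolding x_def by (rule g_expand[OF fr t XV[OF t] eV[OF E]])
    finally have 1: "dderiv f (c t) (e E) = (\<Sum>E'\<in>B. \<epsilon> E' * x E' t * g (c t) (e E') (e E))" .
    have 2: "x E t = (\<Sum>E'\<in>B. \<epsilon> E' * x E' t * g y (e E') (e E))"
      unfolding x_def by (rule g_expand[OF fr y XV[OF t] eV[OF E]])
    show "x E t = dderiv f (c t) (e E) - (\<Sum>E'\<in>B. x E' t * h E' E t)"
      unfolding 1 h_def by (subst 2) (simp add: sum_subtractf[symmetric] algebra_simps)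
  qed
  define d where "d E = dderiv (\<lambda>z. dderiv f z (e E)) y v - (\<Sum>E'\<in>B. x E' 0 * (\<epsilon> E' * Dg y v (e E') (e E)))" for E
  have der_x: "(x E has_real_derivative d E) (at 0)" if E: "E \<in> B" for E
    unfolding d_def
  proof (rule perturbed_system_differentiable[OF fin sys _ _ _ E])
    show "((\<lambda>t. dderiv f (c t) (e E)) has_real_derivative dderiv (\<lambda>z. dderiv f z (e E)) y v) (at 0)"
      if "E \<in> B" for E by (rule der_f[OF eV[OF that]])
    show "(h E' E has_real_derivative \<epsilon> E' * Dg y v (e E') (e E)) (at 0)" if "E \<in> B" "E' \<in> B" for E E'
      unfolding h_def[abs_def]
      using DERIV_cmult[OF DERIV_diff[OF der_g[OF eV[OF that(2)] eV[OF that(1)]] DERIV_const]] by simp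
    show "h E' E 0 = 0" for E E' by (simp add: h_def c0)
  qed
  define dX where "dX = (\<Sum>E\<in>B. (\<epsilon> E * d E) *\<^sub>R e E)"
  have dXV: "dX \<in> V"
    unfolding dX_def using eV subspace_V by (intro subspace_sum subspace_scale)
  have "((\<lambda>t. \<Sum>E\<in>B. (\<epsilon> E * x E t) *\<^sub>R e E) has_vector_derivative dX) (at 0)"
    unfolding dX_def
    by (intro has_vector_derivative_sum has_vector_derivative_scaleR[where g' = 0, simplified]
        DERIV_cmult der_x) auto
  moreover have ev_X: "eventually (\<lambda>t. (\<Sum>E\<in>B. (\<epsilon> E * x E t) *\<^sub>R e E) = X (c t)) (nhds 0)"
    using ev frameD(3)[OF fr XV] by (auto elim!: eventually_mono simp: x_def)
  moreover have "((\<lambda>t. \<Sum>E\<in>B. (\<epsilon> E * x E t) *\<^sub>R e E) has_vector_derivative dX) (at 0)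
      \<longleftrightarrow> ((\<lambda>t. X (c t)) has_vector_derivative dX) (at 0)"
    by (rule has_vector_derivative_cong_ev)
      (use ev_X eventually_nhds_x_imp_x[OF ev_X] in \<open>auto elim: eventually_mono\<close>)
  ultimately have "((\<lambda>t. X (c t)) has_vector_derivative dX) (at 0)"
    by blast
  then have dX: "dderiv X y v = dX"
    unfolding dderiv_def c_def by (rule vector_derivative_at)
  then show "dderiv X y v \<in> V" using dXV by simp
  show "g y (dderiv X y v) w = dderiv (\<lambda>z. dderiv f z w) y v - Dg y v (X y) w" if w: "w \<in> V"
  proof -
    \<comment> \<open>The same function of \<open>t\<close> is differentiated in two ways, as an
      expansion in the frame and as \<open>df (w)\<close> along the line; uniqueness of derivatives
      gives the formula.\<close>
    have "((\<lambda>t. \<Sum>E\<in>B. \<epsilon> E * x E t * g (c t) (e E) w) has_real_derivative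
        (\<Sum>E\<in>B. \<epsilon> E * d E * g (c 0) (e E) w + Dg y v (e E) w * (\<epsilon> E * x E 0))) (at 0)"
      by (intro DERIV_sum DERIV_mult DERIV_cmult der_x der_g eV w)
    moreover have "eventually (\<lambda>t. (\<Sum>E\<in>B. \<epsilon> E * x E t * g (c t) (e E) w) = dderiv f (c t) w) (nhds 0)"
      using ev
    proof eventually_elim
      case (elim t)
      show ?case
        using g_expand[OF fr elim XV[OF elim] w] Xg[OF elim w] by (simp add: x_def)
    qed
    ultimately have "((\<lambda>t. dderiv f (c t) w) has_real_derivative
        (\<Sum>E\<in>B. \<epsilon> E * d E * g y (e E) w + Dg y v (e E) w * (\<epsilon> E * x E 0))) (at 0)"
      unfolding c0 by (rule DERIV_cong_ev[THEN iffD1, OF refl _ refl, rotated])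
    then have "dderiv (\<lambda>z. dderiv f z w) y v
        = (\<Sum>E\<in>B. \<epsilon> E * d E * g y (e E) w + Dg y v (e E) w * (\<epsilon> E * x E 0))"
      using DERIV_unique der_f[OF w] by blast
    also have "\<dots> = g y dX w + Dg y v (\<Sum>E\<in>B. (\<epsilon> E * x E 0) *\<^sub>R e E) w"
      using g_sum[OF y w eV, of B "\<lambda>E. E" "\<lambda>E. \<epsilon> E * d E"]
        linear_within_sum[OF linear_within_Dg2[OF y v w] subspace_V eV, of B "\<lambda>E. E" "\<lambda>E. \<epsilon> E * x E 0"]
      by (simp add: dX_def sum.distrib mult.commute)
    also have "(\<Sum>E\<in>B. (\<epsilon> E * x E 0) *\<^sub>R e E) = X y"
      using eventually_nhds_x_imp_x[OF ev_X] c0 by simp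
    finally show ?thesis using dX by simp
  qed
qed

text \<open>Each Euclidean basis vector is expanded in the frame; after interchanging the sums, the
  Euclidean expansion of \<open>A (e E)\<close> closes up again. The auxiliary inner product in
  \<open>trace_on\<close> disappears in this way.\<close>

lemma trace_on_frame:
  assumes y: "y \<in> D" and A: "linear_within V A" and AV: "\<And>v. v \<in> V \<Longrightarrow> A v \<in> V"
    and fr: "is_frame y B e \<epsilon>"
  shows "trace_on V A = (\<Sum>E\<in>B. \<epsilon> E * g y (A (e E)) (e E))"
proof -
  define C where "C = (SOME C. pairwise orthogonal C \<and> (\<forall>b\<in>C. norm b = 1) \<and> span C = V)"
  obtain C' where "C' \<subseteq> V" "pairwise orthogonal C'" "\<And>x. x \<in> C' \<Longrightarrow> norm x = 1" "span C' = V"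
    by (rule orthonormal_basis_subspace[OF subspace_V]) (assumption | rule that)+
  then have "\<exists>C. pairwise orthogonal C \<and> (\<forall>b\<in>C. norm b = 1) \<and> span C = V"
    by blast
  from someI_ex[OF this, folded C_def]
  have C: "pairwise orthogonal C" "\<And>b. b \<in> C \<Longrightarrow> norm b = 1" "span C = V"
    by (simp_all only: simp_thms)
  have C_V: "b \<in> V" if "b \<in> C" for b using span_base[OF that] C(3) by simp
  have finC: "finite C" by (rule pairwise_orthogonal_imp_finite[OF C(1)])
  have expand: "(\<Sum>b\<in>C. (v \<bullet> b) *\<^sub>R b) = v" if "v \<in> V" for v
    by (rule orthonormal_basis_expand[OF C(1) C(2) _ finC]) (simp_all add: C(3) that)
  have eV: "\<And>E. E \<in> B \<Longrightarrow> e E \<in> V" by (rule frameD(2)[OF fr])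
  have "trace_on V A = (\<Sum>b\<in>C. A b \<bullet> b)"
    by (simp add: trace_on_def C_def)
  also have "\<dots> = (\<Sum>b\<in>C. \<Sum>E\<in>B. \<epsilon> E * g y b (e E) * (A (e E) \<bullet> b))"
  proof (rule sum.cong[OF refl])
    fix b assume b: "b \<in> C"
    have "A b = A (\<Sum>E\<in>B. (\<epsilon> E * g y b (e E)) *\<^sub>R e E)"
      using frameD(3)[OF fr C_V[OF b]] by simp
    also have "\<dots> = (\<Sum>E\<in>B. (\<epsilon> E * g y b (e E)) *\<^sub>R A (e E))"
      by (rule linear_within_sum[OF A subspace_V eV])
    finally show "A b \<bullet> b = (\<Sum>E\<in>B. \<epsilon> E * g y b (e E) * (A (e E) \<bullet> b))"
      by (simp add: inner_sum_left)
  qed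
  also have "\<dots> = (\<Sum>E\<in>B. \<epsilon> E * (\<Sum>b\<in>C. (A (e E) \<bullet> b) * g y b (e E)))"
    by (subst sum.swap) (simp add: sum_distrib_left mult_ac)
  also have "\<dots> = (\<Sum>E\<in>B. \<epsilon> E * g y (A (e E)) (e E))"
  proof (rule sum.cong[OF refl])
    fix E assume E: "E \<in> B"
    have "(\<Sum>b\<in>C. (A (e E) \<bullet> b) * g y b (e E)) = g y (\<Sum>b\<in>C. (A (e E) \<bullet> b) *\<^sub>R b) (e E)"
      by (rule g_sum[OF y eV[OF E] C_V, symmetric])
    then show "\<epsilon> E * (\<Sum>b\<in>C. (A (e E) \<bullet> b) * g y b (e E)) = \<epsilon> E * g y (A (e E)) (e E)"
      using expand[OF AV[OF eV[OF E]]] by simp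
  qed
  finally show ?thesis .
qed

text \<open>In \<open>g (A e) e\<close> the metric derivatives combine to
  \<open>- Dg e (e, X) + Dg X (e, e) / 2\<close>, which is \<open>- g (Z, X) = - df (Z)\<close>. So
  \<open>Z E\<close> is the Christoffel vector of \<open>e E\<close> with itself; characterizing it
  by its products leaves room for an explicit formula.\<close>

lemma laplacian_in_frame:
  assumes f: "f differentiable_on D" and f2: "\<And>w. w \<in> V \<Longrightarrow> (\<lambda>z. dderiv f z w) differentiable_on D"
    and y: "y \<in> D" and fr: "is_frame y B e \<epsilon>"
    and ZV: "\<And>E. E \<in> B \<Longrightarrow> Z E \<in> V"
    and Z: "\<And>E x. E \<in> B \<Longrightarrow> x \<in> V \<Longrightarrow> g y (Z E) x = Dg y (e E) (e E) x - Dg y x (e E) (e E) / 2"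
  shows "laplacian_in V g f y
    = (\<Sum>E\<in>B. \<epsilon> E * (dderiv (\<lambda>z. dderiv f z (e E)) y (e E) - dderiv f y (Z E)))"
proof -
  define X where "X = grad_in V g f"
  define A where "A = cov_deriv V g X y"
  have XV: "X y \<in> V" and Xg: "w \<in> V \<Longrightarrow> g y (X y) w = dderiv f y w" for w
    unfolding X_def using grad_in_props[OF f y] by auto
  have eV: "\<And>E. E \<in> B \<Longrightarrow> e E \<in> V" by (rule frameD(2)[OF fr])
  have AV: "A v \<in> V" if "v \<in> V" for v
    unfolding A_def cov_deriv_def X_def
    using dderiv_grad(1)[OF f f2 y that] christoffel_props(1)[OF y that XV] subspace_V
    by (auto intro: subspace_add simp: X_def)
  have Ag: "g y (A v) w = dderiv (\<lambda>z. dderiv f z w) y v - Dg y v (X y) w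
      + (Dg y v (X y) w + Dg y (X y) v w - Dg y w v (X y)) / 2" if v: "v \<in> V" and w: "w \<in> V" for v w
  proof -
    have "g y (A v) w = g y (dderiv X y v) w + g y (christoffel V g y v (X y)) w"
      unfolding A_def cov_deriv_def
      using g_linear[OF y w] dderiv_grad(1)[OF f f2 y v] christoffel_props(1)[OF y v XV]
      by (simp add: linear_within_def X_def)
    then show ?thesis
      using dderiv_grad(2)[OF f f2 y v w] christoffel_props(2)[OF y v XV w] by (simp add: X_def)
  qed
  have lin: "linear_within V (\<lambda>v. dderiv (\<lambda>z. dderiv f z w) y v - Dg y v (X y) w
      + (Dg y v (X y) w + Dg y (X y) v w - Dg y w v (X y)) / 2)" if w: "w \<in> V" for w
    using linear_within_dderiv[OF f2[OF w] y] linear_within_Dg1[OF y XV w]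
      linear_within_Dg2[OF y XV w] linear_within_Dg2[OF y w XV]
    unfolding linear_within_def by (auto simp: field_simps)
  \<comment> \<open>The field \<open>X\<close> is known to be differentiable only along lines, so
    linearity in the direction is not automatic. It is recovered from the linearity of every
    \<open>g y (A v) w\<close> in \<open>v\<close> and nondegeneracy.\<close>
  have A: "linear_within V A"
    unfolding linear_within_def
  proof (intro conjI ballI allI)
    fix u w assume u: "u \<in> V" and w: "w \<in> V"
    then have uw: "u + w \<in> V" using subspace_V by (simp add: subspace_add)
    show "A (u + w) = A u + A w"
    proof (rule g_eqD[OF y AV[OF uw]])
      show "A u + A w \<in> V" using AV u w subspace_V by (simp add: subspace_add)
      fix x assume x: "x \<in> V"
      have "g y (A u + A w) x = g y (A u) x + g y (A w) x"
        using g_linear[OF y x] AV u w by (simp add: linear_within_def)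
      moreover have "g y (A (u + w)) x = g y (A u) x + g y (A w) x"
        unfolding Ag[OF uw x] Ag[OF u x] Ag[OF w x]
        using lin[OF x] u w unfolding linear_within_def by blast
      ultimately show "g y (A (u + w)) x = g y (A u + A w) x" by simp
    qed
  next
    fix c u assume u: "u \<in> V"
    then have cu: "c *\<^sub>R u \<in> V" using subspace_V by (simp add: subspace_scale)
    show "A (c *\<^sub>R u) = c *\<^sub>R A u"
    proof (rule g_eqD[OF y AV[OF cu]])
      show "c *\<^sub>R A u \<in> V" using AV u subspace_V by (simp add: subspace_scale)
      fix x assume x: "x \<in> V"
      have "g y (c *\<^sub>R A u) x = c *\<^sub>R g y (A u) x"
        using g_linear[OF y x] AV u unfolding linear_within_def by blast
      moreover have "g y (A (c *\<^sub>R u)) x = c *\<^sub>R g y (A u) x"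
        unfolding Ag[OF cu x] Ag[OF u x]
        using lin[OF x] u unfolding linear_within_def by blast
      ultimately show "g y (A (c *\<^sub>R u)) x = g y (c *\<^sub>R A u) x" by simp
    qed
  qed
  have "laplacian_in V g f y = trace_on V A"
    by (simp add: laplacian_in_def div_in_def A_def X_def)
  also have "\<dots> = (\<Sum>E\<in>B. \<epsilon> E * g y (A (e E)) (e E))"
    by (rule trace_on_frame[OF y A AV fr])
  also have "\<dots> = (\<Sum>E\<in>B. \<epsilon> E * (dderiv (\<lambda>z. dderiv f z (e E)) y (e E) - dderiv f y (Z E)))"
  proof (rule sum.cong[OF refl])
    fix E assume E: "E \<in> B"
    note eE = eV[OF E]
    have "dderiv f y (Z E) = g y (Z E) (X y)"
      using Xg[OF ZV[OF E]] g_sym[OF y XV ZV[OF E]] by simp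
    then show "\<epsilon> E * g y (A (e E)) (e E)
        = \<epsilon> E * (dderiv (\<lambda>z. dderiv f z (e E)) y (e E) - dderiv f y (Z E))"
      using Z[OF E XV] Ag[OF eE eE] Dg_sym[OF y eE eE XV] by simp
  qed
  finally show ?thesis .
qed

lemma grad_in_product:
  assumes "f differentiable_on D" "h differentiable_on D" and y: "y \<in> D" and fr: "is_frame y B e \<epsilon>"
  shows "g y (grad_in V g f y) (grad_in V g h y) = (\<Sum>E\<in>B. \<epsilon> E * (dderiv f y (e E) * dderiv h y (e E)))"
proof -
  let ?X = "grad_in V g f y" and ?Y = "grad_in V g h y"
  have "g y ?X ?Y = (\<Sum>E\<in>B. \<epsilon> E * g y ?X (e E) * g y (e E) ?Y)"
    by (rule g_expand[OF fr y grad_in_props(1)[OF assms(1) y] grad_in_props(1)[OF assms(2) y]])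
  also have "\<dots> = (\<Sum>E\<in>B. \<epsilon> E * (dderiv f y (e E) * dderiv h y (e E)))"
  proof (rule sum.cong[OF refl])
    fix E assume "E \<in> B"
    then have eE: "e E \<in> V" by (rule frameD(2)[OF fr])
    show "\<epsilon> E * g y ?X (e E) * g y (e E) ?Y = \<epsilon> E * (dderiv f y (e E) * dderiv h y (e E))"
      using grad_in_props(2)[OF assms(1) y eE] grad_in_props(2)[OF assms(2) y eE]
        g_sym[OF y eE grad_in_props(1)[OF assms(2) y]] by simp
  qed
  finally show ?thesis .
qed

end

section \<open>Quotients of eigenfunctions\<close>

context chart_domain
begin

lemma dderiv_divide:
  fixes a b :: "'e \<Rightarrow> complex"
  assumes "a differentiable_on D" "b differentiable_on D" "y \<in> D" "v \<in> V" "b y \<noteq> 0"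
  shows "dderiv (\<lambda>z. a z / b z) y v = (dderiv a y v * b y - a y * dderiv b y v) / (b y)\<^sup>2"
proof -
  have a: "((\<lambda>t. a (y + t *\<^sub>R v)) has_vector_derivative dderiv a y v) (at 0)"
    and b: "((\<lambda>t. b (y + t *\<^sub>R v)) has_vector_derivative dderiv b y v) (at 0)"
    using dderiv_line assms by blast+
  have "((\<lambda>t. a (y + t *\<^sub>R v) / b (y + t *\<^sub>R v)) has_vector_derivative
      (dderiv a y v * b (y + 0 *\<^sub>R v) - a (y + 0 *\<^sub>R v) * dderiv b y v) / (b (y + 0 *\<^sub>R v) * b (y + 0 *\<^sub>R v))) (at 0)"
    unfolding has_vector_derivative_def
    by (rule has_derivative_eq_rhs, rule Deriv.has_derivative_divide)
      (use a b assms(5) in \<open>auto simp: has_vector_derivative_def fun_eq_iff field_simps scaleR_conv_of_real\<close>)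
  then show ?thesis
    unfolding dderiv_def[of "\<lambda>z. a z / b z"] by (intro vector_derivative_at) (simp add: power2_eq_square)
qed

lemma Ck_on_divide:
  fixes a b :: "'e \<Rightarrow> complex"
  assumes "Ck_on k V D a" "Ck_on k V D b" "\<And>y. y \<in> D \<Longrightarrow> b y \<noteq> 0"
  shows "Ck_on k V D (\<lambda>z. a z / b z)"
  unfolding divide_inverse by (intro Ck_on_mult Ck_on_inverse assms)

lemma Ck_on_2D:
  assumes "Ck_on 2 V D f"
  shows "f differentiable_on D" "v \<in> V \<Longrightarrow> (\<lambda>z. dderiv f z v) differentiable_on D"
  using assms by (auto simp: numeral_2_eq_2)

lemma dderiv2_divide:
  fixes a b :: "'e \<Rightarrow> complex"
  assumes a: "Ck_on 2 V D a" and b: "Ck_on 2 V D b" and nz: "\<And>y. y \<in> D \<Longrightarrow> b y \<noteq> 0"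
    and y: "y \<in> D" and v: "v \<in> V"
  shows "dderiv (\<lambda>z. dderiv (\<lambda>z. a z / b z) z v) y v
    = (dderiv (\<lambda>z. dderiv a z v) y v * b y - a y * dderiv (\<lambda>z. dderiv b z v) y v) / (b y)\<^sup>2
      - 2 * dderiv b y v * (dderiv a y v * b y - a y * dderiv b y v) / (b y)^3"
proof -
  note a' = Ck_on_2D[OF a] and b' = Ck_on_2D[OF b]
  define N where "N z = dderiv a z v * b z - a z * dderiv b z v" for z
  define N2 where "N2 z = b z * b z" for z
  have bm: "bounded_bilinear ((*) :: complex \<Rightarrow> complex \<Rightarrow> complex)" by (rule bounded_bilinear_mult)
  have diff: "(\<lambda>z. dderiv a z v * b z) differentiable_on D" "(\<lambda>z. - (a z * dderiv b z v)) differentiable_on D"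
    "(\<lambda>z. a z * dderiv b z v) differentiable_on D"
    using differentiable_on_bilinear[OF bm a'(2)[OF v] b'(1)]
      differentiable_on_bilinear[OF bm a'(1) b'(2)[OF v]]
    by (auto intro: differentiable_on_minus)
  have N: "N differentiable_on D" and N2: "N2 differentiable_on D"
    unfolding N_def N2_def
    using differentiable_on_bilinear[OF bm b'(1) b'(1)] differentiable_on_diff diff by auto
  have "dderiv N y v = dderiv (\<lambda>z. dderiv a z v * b z + - (a z * dderiv b z v)) y v"
    by (simp add: N_def[abs_def])
  also have "\<dots> = dderiv (\<lambda>z. dderiv a z v * b z) y v + dderiv (\<lambda>z. - (a z * dderiv b z v)) y v"
    by (rule dderiv_add[OF diff(1,2) y v])
  also have "\<dots> = dderiv (\<lambda>z. dderiv a z v) y v * b y - a y * dderiv (\<lambda>z. dderiv b z v) y v"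
    using dderiv_bilinear[OF bm a'(2)[OF v] b'(1) y v] dderiv_bilinear[OF bm a'(1) b'(2)[OF v] y v]
      dderiv_bounded_linear[OF bounded_linear_minus[OF bounded_linear_ident] diff(3) y v]
    by simp
  finally have dN: "dderiv N y v = dderiv (\<lambda>z. dderiv a z v) y v * b y - a y * dderiv (\<lambda>z. dderiv b z v) y v" .
  have dN2: "dderiv N2 y v = 2 * b y * dderiv b y v"
    unfolding N2_def using dderiv_bilinear[OF bm b'(1) b'(1) y v] by simp
  have "dderiv (\<lambda>z. dderiv (\<lambda>z. a z / b z) z v) y v = dderiv (\<lambda>z. N z / N2 z) y v"
  proof (rule dderiv_cong[OF _ y v])
    show "dderiv (\<lambda>z. a z / b z) z v = N z / N2 z" if "z \<in> D" for z
      using dderiv_divide[OF a'(1) b'(1) that v nz[OF that]] by (simp add: N_def N2_def power2_eq_square)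
  qed
  also have "\<dots> = (dderiv N y v * N2 y - N y * dderiv N2 y v) / (N2 y)\<^sup>2"
    by (rule dderiv_divide[OF N N2 y v]) (simp add: N2_def nz[OF y])
  also have "\<dots> = (dderiv (\<lambda>z. dderiv a z v) y v * b y - a y * dderiv (\<lambda>z. dderiv b z v) y v) / (b y)\<^sup>2
      - 2 * dderiv b y v * (dderiv a y v * b y - a y * dderiv b y v) / (b y)^3"
    unfolding dN dN2 N_def N2_def using nz[OF y]
    by (simp add: field_simps power2_eq_square power3_eq_cube)
  finally show ?thesis .
qed

end

abbreviation kappa_sum ::
  "'i set \<Rightarrow> ('i \<Rightarrow> 'e::real_vector) \<Rightarrow> ('i \<Rightarrow> real) \<Rightarrow> ('e \<Rightarrow> complex) \<Rightarrow> ('e \<Rightarrow> complex) \<Rightarrow> 'e \<Rightarrow> complex"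
where
  "kappa_sum B e \<epsilon> f h y \<equiv> (\<Sum>E\<in>B. of_real (\<epsilon> E) * (dderiv f y (e E) * dderiv h y (e E)))"

abbreviation laplace_sum ::
  "'i set \<Rightarrow> ('i \<Rightarrow> 'e::real_vector) \<Rightarrow> ('i \<Rightarrow> real) \<Rightarrow> ('i \<Rightarrow> 'e) \<Rightarrow> ('e \<Rightarrow> complex) \<Rightarrow> 'e \<Rightarrow> complex"
where
  "laplace_sum B e \<epsilon> Z f y \<equiv>
    (\<Sum>E\<in>B. of_real (\<epsilon> E) * (dderiv (\<lambda>z. dderiv f z (e E)) y (e E) - dderiv f y (Z E)))"

text \<open>One frame direction of the Laplacian of \<open>a / b\<close>: \<open>A\<close>,
  \<open>B\<close> are second derivatives, \<open>p\<close>, \<open>q\<close> first derivatives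
  along the frame vector, \<open>p'\<close>, \<open>q'\<close> those along \<open>Z\<close>, and
  \<open>r\<close> is the sign. The right side is sorted into the contributions to \<tau>(a),
  \<tau>(b), \<kappa>(a, b) and \<kappa>(b, b).\<close>

lemma quotient_identity:
  fixes b :: complex
  assumes "b \<noteq> 0"
  shows "r * ((A * b - a * B) / b\<^sup>2 - 2 * q * (p * b - a * q) / b^3 - (p' * b - a * q') / b\<^sup>2)
    = b / b\<^sup>2 * (r * (A - p')) - a / b\<^sup>2 * (r * (B - q')) - 2 / b\<^sup>2 * (r * (p * q)) + 2 * a / b^3 * (r * (q * q))"
  using assms by (simp add: field_simps power2_eq_square power3_eq_cube)

context metric_chart
begin

lemma laplacian_in_frame_complex:
  fixes F :: "'e \<Rightarrow> complex"
  assumes F: "Ck_on 2 V D F" and y: "y \<in> D" and fr: "is_frame y B e \<epsilon>"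
    and ZV: "\<And>E. E \<in> B \<Longrightarrow> Z E \<in> V"
    and Z: "\<And>E x. E \<in> B \<Longrightarrow> x \<in> V \<Longrightarrow> g y (Z E) x = Dg y (e E) (e E) x - Dg y x (e E) (e E) / 2"
  shows "Complex (laplacian_in V g (Re \<circ> F) y) (laplacian_in V g (Im \<circ> F) y)
    = laplace_sum B e \<epsilon> Z F y"
proof -
  note F' = Ck_on_2D[OF F]
  have *: "laplacian_in V g (L \<circ> F) y
      = (\<Sum>E\<in>B. \<epsilon> E * L (dderiv (\<lambda>z. dderiv F z (e E)) y (e E) - dderiv F y (Z E)))"
    if L: "bounded_linear L" for L
  proof -
    note LF = Ck_on_2D[OF Ck_on_bounded_linear[OF L F]]
    have "laplacian_in V g (\<lambda>z. L (F z)) y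
      = (\<Sum>E\<in>B. \<epsilon> E * (dderiv (\<lambda>z. dderiv (\<lambda>z. L (F z)) z (e E)) y (e E) - dderiv (\<lambda>z. L (F z)) y (Z E)))"
      by (rule laplacian_in_frame[OF LF y fr ZV Z])
    also have "\<dots> = (\<Sum>E\<in>B. \<epsilon> E * L (dderiv (\<lambda>z. dderiv F z (e E)) y (e E) - dderiv F y (Z E)))"
    proof (rule sum.cong[OF refl])
      fix E assume E: "E \<in> B"
      note eE = frameD(2)[OF fr E]
      have "dderiv (\<lambda>z. dderiv (\<lambda>z. L (F z)) z (e E)) y (e E) = dderiv (\<lambda>z. L (dderiv F z (e E))) y (e E)"
        by (rule dderiv_cong[OF _ y eE]) (rule dderiv_bounded_linear[OF L F'(1) _ eE])
      also have "\<dots> = L (dderiv (\<lambda>z. dderiv F z (e E)) y (e E))"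
        by (rule dderiv_bounded_linear[OF L F'(2)[OF eE] y eE])
      finally show "\<epsilon> E * (dderiv (\<lambda>z. dderiv (\<lambda>z. L (F z)) z (e E)) y (e E) - dderiv (\<lambda>z. L (F z)) y (Z E))
          = \<epsilon> E * L (dderiv (\<lambda>z. dderiv F z (e E)) y (e E) - dderiv F y (Z E))"
        using dderiv_bounded_linear[OF L F'(1) y ZV[OF E]] L by (simp add: linear_simps)
    qed
    finally show ?thesis by (simp add: o_def)
  qed
  show ?thesis
    unfolding *[OF bounded_linear_Re] *[OF bounded_linear_Im]
    by (simp add: complex_eq_iff)
qed

lemma grad_in_product_complex:
  fixes F H :: "'e \<Rightarrow> complex"
  assumes F: "F differentiable_on D" and H: "H differentiable_on D" and y: "y \<in> D"
    and fr: "is_frame y B e \<epsilon>"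
  shows "(let G = g y; a = grad_in V g (Re \<circ> F) y; b = grad_in V g (Im \<circ> F) y;
         c = grad_in V g (Re \<circ> H) y; d = grad_in V g (Im \<circ> H) y
     in Complex (G a c - G b d) (G a d + G b c))
    = kappa_sum B e \<epsilon> F H y"
proof -
  have diff: "(L \<circ> F) differentiable_on D" if "bounded_linear L" "F differentiable_on D"
    for L :: "complex \<Rightarrow> real" and F :: "'e \<Rightarrow> complex"
    using that bounded_linear.has_derivative[OF that(1)]
    unfolding differentiable_on_def differentiable_def o_def by blast
  have *: "g y (grad_in V g (L \<circ> F) y) (grad_in V g (L' \<circ> H) y)
      = (\<Sum>E\<in>B. \<epsilon> E * (L (dderiv F y (e E)) * L' (dderiv H y (e E))))"
    if L: "bounded_linear L" "bounded_linear L'" for L L'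
    unfolding grad_in_product[OF diff[OF L(1) F] diff[OF L(2) H] y fr]
    using dderiv_bounded_linear[OF L(1) F y frameD(2)[OF fr]]
      dderiv_bounded_linear[OF L(2) H y frameD(2)[OF fr]]
    by (intro sum.cong) (auto simp: o_def)
  note R = bounded_linear_Re and I = bounded_linear_Im
  show ?thesis
    unfolding Let_def *[OF R R] *[OF R I] *[OF I R] *[OF I I]
    by (simp add: complex_eq_iff sum_subtractf[symmetric] sum.distrib[symmetric] algebra_simps)
qed

text \<open>\<open>F\<close> is prescribed only on \<open>D\<close>, since a function on the
  quotient composed with a parametrization is a quotient of matrix entries only there.\<close>

lemma quotient_harmonic:
  fixes a b F :: "'e \<Rightarrow> complex"
  assumes F: "\<And>z. z \<in> D \<Longrightarrow> F z = a z / b z" and a: "Ck_on 2 V D a" and b: "Ck_on 2 V D b" and nz: "\<And>y. y \<in> D \<Longrightarrow> b y \<noteq> 0"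
    and y: "y \<in> D" and fr: "is_frame y B e \<epsilon>"
    and ZV: "\<And>E. E \<in> B \<Longrightarrow> Z E \<in> V"
    and Z: "\<And>E x. E \<in> B \<Longrightarrow> x \<in> V \<Longrightarrow> g y (Z E) x = Dg y (e E) (e E) x - Dg y x (e E) (e E) / 2"
    and la: "laplace_sum B e \<epsilon> Z a y = \<nu> * a y"
    and lb: "laplace_sum B e \<epsilon> Z b y = \<nu> * b y"
    and kab: "kappa_sum B e \<epsilon> a b y = \<mu> * a y * b y"
    and kbb: "kappa_sum B e \<epsilon> b b y = \<mu> * b y * b y"
  shows "Complex (laplacian_in V g (Re \<circ> F) y) (laplacian_in V g (Im \<circ> F) y) = 0"
proof -
  let ?F = "\<lambda>z. a z / b z"
  note a' = Ck_on_2D[OF a] and b' = Ck_on_2D[OF b]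
  define LA where "LA E = of_real (\<epsilon> E) * (dderiv (\<lambda>z. dderiv a z (e E)) y (e E) - dderiv a y (Z E))" for E
  define LB where "LB E = of_real (\<epsilon> E) * (dderiv (\<lambda>z. dderiv b z (e E)) y (e E) - dderiv b y (Z E))" for E
  define KA where "KA E = of_real (\<epsilon> E) * (dderiv a y (e E) * dderiv b y (e E))" for E
  define KB where "KB E = of_real (\<epsilon> E) * (dderiv b y (e E) * dderiv b y (e E))" for E
  have "Ck_on 2 V D F"
    by (subst Ck_on_cong[of F ?F]) (simp_all only: F Ck_on_divide[OF a b nz])
  then have "Complex (laplacian_in V g (Re \<circ> F) y) (laplacian_in V g (Im \<circ> F) y)
    = laplace_sum B e \<epsilon> Z F y"
    by (rule laplacian_in_frame_complex[OF _ y fr ZV Z])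
  also have "\<dots> = laplace_sum B e \<epsilon> Z ?F y"
  proof (rule sum.cong[OF refl])
    fix E assume E: "E \<in> B"
    note eE = frameD(2)[OF fr E]
    have "dderiv (\<lambda>z. dderiv F z (e E)) y (e E) = dderiv (\<lambda>z. dderiv ?F z (e E)) y (e E)"
      by (rule dderiv_cong[OF _ y eE]) (rule dderiv_cong[OF F _ eE])
    moreover have "dderiv F y (Z E) = dderiv ?F y (Z E)"
      by (rule dderiv_cong[OF F y ZV[OF E]])
    ultimately show "of_real (\<epsilon> E) * (dderiv (\<lambda>z. dderiv F z (e E)) y (e E) - dderiv F y (Z E))
        = of_real (\<epsilon> E) * (dderiv (\<lambda>z. dderiv ?F z (e E)) y (e E) - dderiv ?F y (Z E))" by simp
  qed
  also have "\<dots> = (\<Sum>E\<in>B. (b y / (b y)\<^sup>2) * LA E - (a y / (b y)\<^sup>2) * LB E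
      - (2 / (b y)\<^sup>2) * KA E + (2 * a y / (b y)^3) * KB E)"
  proof (rule sum.cong[OF refl])
    fix E assume E: "E \<in> B"
    note eE = frameD(2)[OF fr E]
    show "of_real (\<epsilon> E) * (dderiv (\<lambda>z. dderiv ?F z (e E)) y (e E) - dderiv ?F y (Z E))
      = (b y / (b y)\<^sup>2) * LA E - (a y / (b y)\<^sup>2) * LB E
      - (2 / (b y)\<^sup>2) * KA E + (2 * a y / (b y)^3) * KB E"
    proof -
      have "dderiv (\<lambda>z. dderiv ?F z (e E)) y (e E) =
          (dderiv (\<lambda>z. dderiv a z (e E)) y (e E) * b y - a y * dderiv (\<lambda>z. dderiv b z (e E)) y (e E)) / (b y)\<^sup>2
          - 2 * dderiv b y (e E) * (dderiv a y (e E) * b y - a y * dderiv b y (e E)) / (b y)^3"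
        by (rule dderiv2_divide[OF a b nz y eE])
      then show ?thesis
        unfolding dderiv_divide[OF a'(1) b'(1) y ZV[OF E] nz[OF y]] LA_def LB_def KA_def KB_def
        by (simp only:) (rule quotient_identity[OF nz[OF y]])
    qed
  qed
  also have "\<dots> = (b y / (b y)\<^sup>2) * sum LA B - (a y / (b y)\<^sup>2) * sum LB B
      - (2 / (b y)\<^sup>2) * sum KA B + (2 * a y / (b y)^3) * sum KB B"
    by (simp add: sum.distrib sum_subtractf sum_distrib_left)
  \<comment> \<open>The two terms with \<nu> cancel because \<open>a\<close> and \<open>b\<close>
    share the eigenvalue; the two terms with \<mu> are \<open>-2 \<mu> a / b\<close> and
    \<open>2 \<mu> a / b\<close>.\<close>
  also have "\<dots> = 0"
    unfolding LA_def LB_def KA_def KB_def la lb kab kbb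
    using nz[OF y] by (simp add: field_simps power2_eq_square power3_eq_cube)
  finally show ?thesis .
qed

lemma quotient_kappa:
  fixes a a' b F F' :: "'e \<Rightarrow> complex"
  assumes F: "\<And>z. z \<in> D \<Longrightarrow> F z = a z / b z" and F': "\<And>z. z \<in> D \<Longrightarrow> F' z = a' z / b z"
    and a: "a differentiable_on D" and a': "a' differentiable_on D"
    and b: "b differentiable_on D" and nz: "\<And>y. y \<in> D \<Longrightarrow> b y \<noteq> 0"
    and y: "y \<in> D" and fr: "is_frame y B e \<epsilon>"
    and kaa: "kappa_sum B e \<epsilon> a a' y = \<mu> * a y * a' y"
    and kab: "kappa_sum B e \<epsilon> a b y = \<mu> * a y * b y"
    and kab': "kappa_sum B e \<epsilon> a' b y = \<mu> * a' y * b y"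
    and kbb: "kappa_sum B e \<epsilon> b b y = \<mu> * b y * b y"
  shows "kappa_sum B e \<epsilon> F F' y = 0"
proof -
  let ?K = "\<lambda>f h E. of_real (\<epsilon> E) * (dderiv f y (e E) * dderiv h y (e E))"
  have "(\<Sum>E\<in>B. ?K F F' E) = (\<Sum>E\<in>B. ?K (\<lambda>z. a z / b z) (\<lambda>z. a' z / b z) E)"
    using dderiv_cong[OF F y frameD(2)[OF fr]] dderiv_cong[OF F' y frameD(2)[OF fr]]
    by (intro sum.cong refl) simp
  also have "(\<Sum>E\<in>B. ?K (\<lambda>z. a z / b z) (\<lambda>z. a' z / b z) E) =
      (\<Sum>E\<in>B. (1 / (b y)\<^sup>2) * ?K a a' E - (a' y / (b y)^3) * ?K a b E - (a y / (b y)^3) * ?K a' b E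
        + (a y * a' y / (b y)^4) * ?K b b E)"
  proof (rule sum.cong[OF refl])
    fix E assume E: "E \<in> B"
    note eE = frameD(2)[OF fr E]
    show "?K (\<lambda>z. a z / b z) (\<lambda>z. a' z / b z) E = (1 / (b y)\<^sup>2) * ?K a a' E - (a' y / (b y)^3) * ?K a b E
        - (a y / (b y)^3) * ?K a' b E + (a y * a' y / (b y)^4) * ?K b b E"
      unfolding dderiv_divide[OF a b y eE nz[OF y]] dderiv_divide[OF a' b y eE nz[OF y]]
      using nz[OF y] by (simp add: field_simps power2_eq_square power3_eq_cube power4_eq_xxxx)
  qed
  also have "\<dots> = (1 / (b y)\<^sup>2) * sum (?K a a') B - (a' y / (b y)^3) * sum (?K a b) B
      - (a y / (b y)^3) * sum (?K a' b) B + (a y * a' y / (b y)^4) * sum (?K b b) B"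
    by (simp add: sum.distrib sum_subtractf sum_distrib_left)
  \<comment> \<open>All four sums are multiples of
    \<open>\<mu> * a y * a' y / (b y)\<^sup>2\<close>, with coefficients 1, -1, -1 and 1.\<close>
  also have "\<dots> = 0"
    unfolding kaa kab kab' kbb
    using nz[OF y] by (simp add: field_simps power2_eq_square power3_eq_cube power4_eq_xxxx)
  finally show ?thesis .
qed

end

section \<open>Metrics of the form \<open>Re tr (P\<inverse> dP P\<inverse> dP)\<close>\<close>

lemma bounded_bilinear_matrix_mult:
  "bounded_bilinear ((**) :: complex ^ 'm::finite ^ 'k::finite \<Rightarrow> complex ^ 'j::finite ^ 'm \<Rightarrow> complex ^ 'j ^ 'k)"
proof -
  have "bilinear ((**) :: complex ^ 'm::finite ^ 'k::finite \<Rightarrow> complex ^ 'j::finite ^ 'm \<Rightarrow> complex ^ 'j ^ 'k)"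
    unfolding bilinear_def
    by (auto intro!: linearI simp: matrix_matrix_mult_def vec_eq_iff distrib_left distrib_right
        sum.distrib scaleR_sum_right)
  then show ?thesis by (simp add: bilinear_conv_bounded_bilinear)
qed

interpretation mm: bounded_bilinear "(**) :: complex ^ 'm::finite ^ 'm \<Rightarrow> complex ^ 'm ^ 'm \<Rightarrow> complex ^ 'm ^ 'm"
  by (rule bounded_bilinear_matrix_mult)

lemma bounded_linear_Re_trace: "bounded_linear (\<lambda>A :: complex ^ 'm::finite ^ 'm. Re (trace A))"
  unfolding linear_conv_bounded_linear[symmetric]
  by (intro linearI) (auto simp: trace_def sum.distrib scaleR_sum_right sum_distrib_left)

lemma matrix_inv_left_right:
  fixes A :: "complex ^ 'm::finite ^ 'm"
  assumes "invertible A"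
  shows "matrix_inv A ** A = mat 1" "A ** matrix_inv A = mat 1"
  using someI_ex[OF assms[unfolded invertible_def], folded matrix_inv_def] by simp_all

text \<open>Writes inversion as a rational function of the entries, from which its regularity to
  every order follows by the closure properties of \<open>Ck_on\<close>.\<close>

lemma matrix_inv_cramer:
  fixes A :: "complex ^ 'm::finite ^ 'm"
  assumes "invertible A"
  shows "matrix_inv A = (\<chi> k l. det (\<chi> i j. if j = k then axis l 1 $ i else A $ i $ j) / det A)"
proof -
  have d: "det A \<noteq> 0" using assms by (simp add: invertible_det_nz)
  have "matrix_inv A $ k $ l = det (\<chi> i j. if j = k then axis l 1 $ i else A $ i $ j) / det A" for k l
  proof -
    have "A *v column l (matrix_inv A) = axis l 1"
    proof (rule vec_eq_iff[THEN iffD2], rule allI)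
      fix i
      have "(A *v column l (matrix_inv A)) $ i = (A ** matrix_inv A) $ i $ l"
        by (simp add: matrix_vector_mult_def matrix_matrix_mult_def column_def)
      then show "(A *v column l (matrix_inv A)) $ i = axis l 1 $ i"
        by (simp add: matrix_inv_left_right(2)[OF assms] mat_def axis_def)
    qed
    then have "column l (matrix_inv A) = (\<chi> k. det (\<chi> i j. if j = k then axis l 1 $ i else A $ i $ j) / det A)"
      by (simp add: cramer[OF d])
    then show ?thesis by (simp add: column_def vec_eq_iff)
  qed
  then show ?thesis by (simp add: vec_eq_iff)
qed

context chart_domain
begin

lemmas Ck_on_matrix_mult = Ck_on_bilinear[OF bounded_bilinear_matrix_mult]
  and dderiv_matrix_mult = dderiv_bilinear[OF bounded_bilinear_matrix_mult]
  and differentiable_on_matrix_mult = differentiable_on_bilinear[OF bounded_bilinear_matrix_mult]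

lemma Ck_on_component:
  fixes A :: "'e \<Rightarrow> complex ^ 'm::finite ^ 'k::finite"
  assumes "Ck_on k V D A"
  shows "Ck_on k V D (\<lambda>y. A y $ i $ j)"
  using Ck_on_bounded_linear[OF bounded_linear_compose[OF bounded_linear_vec_nth bounded_linear_vec_nth] assms] .

lemma Ck_on_matrix_inv:
  fixes P :: "'e \<Rightarrow> complex ^ 'm::finite ^ 'm"
  assumes P: "Ck_on k V D P" and inv: "\<And>y. y \<in> D \<Longrightarrow> invertible (P y)"
  shows "Ck_on k V D (\<lambda>y. matrix_inv (P y))"
proof -
  have det_ij: "Ck_on k V D (\<lambda>y. det (\<chi> i j. if j = k' then axis l 1 $ i else P y $ i $ j))" for k' l
  proof (rule Ck_on_det)
    fix i j
    show "Ck_on k V D (\<lambda>y. (\<chi> i j. if j = k' then axis l 1 $ i else P y $ i $ j) $ i $ j)"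
      by (cases "j = k'") (simp_all add: Ck_on_const Ck_on_component[OF P])
  qed
  have "Ck_on k V D (\<lambda>y. \<chi> k' l. det (\<chi> i j. if j = k' then axis l 1 $ i else P y $ i $ j) / det (P y))"
    using inv by (intro Ck_on_vec_lambda Ck_on_divide det_ij Ck_on_det Ck_on_component[OF P])
      (simp add: invertible_det_nz)
  then show ?thesis
    by (subst Ck_on_cong[OF matrix_inv_cramer[OF inv]]) auto
qed

lemma dderiv_matrix_inv:
  fixes P :: "'e \<Rightarrow> complex ^ 'm::finite ^ 'm"
  assumes P: "Ck_on 1 V D P" and inv: "\<And>y. y \<in> D \<Longrightarrow> invertible (P y)"
    and y: "y \<in> D" and v: "v \<in> V"
  shows "dderiv (\<lambda>y. matrix_inv (P y)) y v = - (matrix_inv (P y) ** dderiv P y v ** matrix_inv (P y))"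
proof -
  let ?Q = "\<lambda>y. matrix_inv (P y)"
  have dP: "P differentiable_on D" and dQ: "?Q differentiable_on D"
    using P Ck_on_matrix_inv[OF P inv] by auto
  have "dderiv (\<lambda>z. ?Q z ** P z) y v = dderiv (\<lambda>z. mat 1 :: complex ^ 'm ^ 'm) y v"
    by (rule dderiv_cong[OF _ y v]) (rule matrix_inv_left_right(1)[OF inv])
  then have "?Q y ** dderiv P y v + dderiv ?Q y v ** P y = 0"
    using dderiv_matrix_mult[OF dQ dP y v] by simp
  then have "(?Q y ** dderiv P y v + dderiv ?Q y v ** P y) ** ?Q y = 0"
    by simp
  then have "?Q y ** dderiv P y v ** ?Q y + dderiv ?Q y v = 0"
    by (simp add: mm.add_left matrix_mul_assoc[symmetric] matrix_inv_left_right(2)[OF inv[OF y]])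
  then show ?thesis by (simp add: eq_neg_iff_add_eq_0 add.commute)
qed

end

text \<open>The trace formula provides linearity, symmetry and differentiability of the form.
  Nondegeneracy depends on which matrices the derivative of \<open>P\<close> attains, so the
  completeness relation is supplied by each instance.\<close>

locale trace_chart = chart_domain V D for V D :: "'e::euclidean_space set" +
  fixes P :: "'e \<Rightarrow> complex ^ 'm::finite ^ 'm" and c :: real and g :: "'e \<Rightarrow> 'e \<Rightarrow> 'e \<Rightarrow> real"
  assumes P_C2: "Ck_on 2 V D P" and P_inv: "y \<in> D \<Longrightarrow> invertible (P y)"
    and g_eq: "y \<in> D \<Longrightarrow> u \<in> V \<Longrightarrow> w \<in> V \<Longrightarrow> g y u w =
      c * Re (trace (matrix_inv (P y) ** dderiv P y u ** (matrix_inv (P y) ** dderiv P y w)))"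
    and frame: "y \<in> D \<Longrightarrow> \<exists>(B::'e set) e \<epsilon>. finite B \<and> (\<forall>E\<in>B. e E \<in> V) \<and>
      (\<forall>u\<in>V. (\<Sum>E\<in>B. (\<epsilon> E * g y u (e E)) *\<^sub>R e E) = u)"
begin

abbreviation "Q y \<equiv> matrix_inv (P y)"

lemma P_diff: "P differentiable_on D" and P2_diff: "v \<in> V \<Longrightarrow> (\<lambda>y. dderiv P y v) differentiable_on D"
  using Ck_on_2D[OF P_C2] by auto

lemma P_C1: "Ck_on 1 V D P"
  using Ck_on_Suc_imp[of 1 P] P_C2 by (simp only: Suc_1)

lemma Q_diff: "Q differentiable_on D"
  using Ck_on_matrix_inv[OF P_C1 P_inv] by simp

lemma dderiv_Q: "y \<in> D \<Longrightarrow> v \<in> V \<Longrightarrow> dderiv Q y v = - (Q y ** dderiv P y v ** Q y)"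
  by (rule dderiv_matrix_inv[OF P_C1 P_inv])

lemma QP_diff: "v \<in> V \<Longrightarrow> (\<lambda>y. Q y ** dderiv P y v) differentiable_on D"
  by (rule differentiable_on_matrix_mult[OF Q_diff P2_diff])

lemma dderiv_QP:
  assumes y: "y \<in> D" and u: "u \<in> V" and z: "z \<in> V"
  shows "dderiv (\<lambda>y. Q y ** dderiv P y u) y z =
    Q y ** dderiv (\<lambda>y. dderiv P y u) y z - Q y ** dderiv P y z ** (Q y ** dderiv P y u)"
  using dderiv_matrix_mult[OF Q_diff P2_diff[OF u] y z] dderiv_Q[OF y z]
  by (simp add: mm.minus_left matrix_mul_assoc)

lemma Re_trace_simps:
  "Re (trace (A + B)) = Re (trace A) + Re (trace B)"
  "Re (trace (A - B)) = Re (trace A) - Re (trace B)"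
  "Re (trace (r *\<^sub>R A)) = r * Re (trace A)"
  for A B :: "complex ^ 'k::finite ^ 'k"
  by (simp_all add: linear_simps[OF bounded_linear_Re_trace])

sublocale metric_chart V D g
proof
  have g_sym': "g y u w = g y w u" if "y \<in> D" "u \<in> V" "w \<in> V" for y u w
    using g_eq that trace_mul_sym[of "Q y ** dderiv P y u" "Q y ** dderiv P y w"] by simp
  then show "g y u w = g y w u" if "y \<in> D" "u \<in> V" "w \<in> V" for y u w
    using that by blast
  show "linear_within V (\<lambda>u. g y u w)" if "y \<in> D" "w \<in> V" for y w
    unfolding linear_within_def
  proof (intro conjI ballI allI)
    fix u u' assume u: "u \<in> V" and u': "u' \<in> V"
    have "u + u' \<in> V" using u u' subspace_V by (simp add: subspace_add)
    then show "g y (u + u') w = g y u w + g y u' w"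
      using that u u' by (simp add: g_eq dderiv_add_dir[OF P_diff] mm.add_left mm.add_right
          Re_trace_simps algebra_simps)
  next
    fix r u assume u: "u \<in> V"
    have "r *\<^sub>R u \<in> V" using u subspace_V by (simp add: subspace_scale)
    then show "g y (r *\<^sub>R u) w = r *\<^sub>R g y u w"
      using that u by (simp add: g_eq dderiv_scale_dir[OF P_diff] mm.scaleR_left mm.scaleR_right
          Re_trace_simps)
  qed
  show "(\<lambda>y. g y u w) differentiable_on D" if u: "u \<in> V" and w: "w \<in> V" for u w
  proof -
    have "(\<lambda>y. Q y ** dderiv P y u ** (Q y ** dderiv P y w)) differentiable_on D"
      by (rule differentiable_on_matrix_mult[OF QP_diff[OF u] QP_diff[OF w]])
    then have "(\<lambda>y. c * Re (trace (Q y ** dderiv P y u ** (Q y ** dderiv P y w)))) differentiable_on D"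
      using bounded_linear.has_derivative[OF bounded_linear_const_mult[OF bounded_linear_Re_trace, of c]]
      unfolding differentiable_on_def differentiable_def by blast
    then show ?thesis
      by (subst differentiable_on_cong[OF g_eq]) (use u w in auto)
  qed
qed (rule frame)

lemma Dg_eq:
  assumes y: "y \<in> D" and z: "z \<in> V" and u: "u \<in> V" and w: "w \<in> V"
  shows "Dg y z u w = c * (
      Re (trace (Q y ** dderiv P y u ** (Q y ** dderiv (\<lambda>y. dderiv P y w) y z)))
    - Re (trace (Q y ** dderiv P y u ** (Q y ** dderiv P y z ** (Q y ** dderiv P y w))))
    + Re (trace (Q y ** dderiv (\<lambda>y. dderiv P y u) y z ** (Q y ** dderiv P y w)))
    - Re (trace (Q y ** dderiv P y z ** (Q y ** dderiv P y u) ** (Q y ** dderiv P y w))))"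
proof -
  let ?T = "\<lambda>y. Q y ** dderiv P y u ** (Q y ** dderiv P y w)"
  have T: "?T differentiable_on D"
    by (rule differentiable_on_matrix_mult[OF QP_diff[OF u] QP_diff[OF w]])
  have "Dg y z u w = dderiv (\<lambda>y. c * Re (trace (?T y))) y z"
    using g_eq[OF _ u w] by (rule dderiv_cong[OF _ y z])
  also have "\<dots> = c * Re (trace (dderiv ?T y z))"
    by (rule dderiv_bounded_linear[OF bounded_linear_const_mult[OF bounded_linear_Re_trace] T y z])
  finally show ?thesis
    unfolding dderiv_matrix_mult[OF QP_diff[OF u] QP_diff[OF w] y z]
      dderiv_QP[OF y u z] dderiv_QP[OF y w z]
    by (simp add: mm.diff_left mm.diff_right Re_trace_simps)
qed

text \<open>Symmetry of the second derivatives of \<open>P\<close> cancels the mixed terms. By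
  cyclicity every cubic trace equals the one of \<open>e e x\<close>, which occurs with coefficient
  -2 in the first term and, after halving, -1 in the second; one copy with sign -1 is left.\<close>

lemma koszul_eq:
  assumes y: "y \<in> D" and e: "e \<in> V" and x: "x \<in> V"
  shows "Dg y e e x - Dg y x e e / 2 = c *
    Re (trace (Q y ** (dderiv (\<lambda>y. dderiv P y e) y e - dderiv P y e ** Q y ** dderiv P y e)
      ** (Q y ** dderiv P y x)))"
proof -
  let ?e = "Q y ** dderiv P y e" and ?x = "Q y ** dderiv P y x"
  let ?ee = "Q y ** dderiv (\<lambda>y. dderiv P y e) y e" and ?ex = "Q y ** dderiv (\<lambda>y. dderiv P y e) y x"
  have xe: "dderiv (\<lambda>y. dderiv P y x) y e = dderiv (\<lambda>y. dderiv P y e) y x"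
    by (rule dderiv_commute[OF P_C2 y x e])
  have c1: "trace (?e ** (?x ** ?e)) = trace (?e ** (?e ** ?x))"
    "trace (?x ** ?e ** ?e) = trace (?e ** (?e ** ?x))"
    "trace (?e ** ?e ** ?x) = trace (?e ** (?e ** ?x))"
    using trace_mul_sym[of "?e ** ?x" ?e] trace_mul_sym[of ?x "?e ** ?e"]
    by (simp_all add: matrix_mul_assoc)
  have c2: "trace (?ex ** ?e) = trace (?e ** ?ex)" by (rule trace_mul_sym)
  have eq: "Q y ** (dderiv (\<lambda>y. dderiv P y e) y e - dderiv P y e ** Q y ** dderiv P y e) ** ?x
      = ?ee ** ?x - ?e ** (?e ** ?x)"
    by (simp add: mm.diff_left mm.diff_right matrix_mul_assoc)
  show ?thesis
    unfolding Dg_eq[OF y e e x] Dg_eq[OF y x e e] eq xe c1 c2 Re_trace_simps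
    by (simp add: field_simps)
qed

end

section \<open>Matrix algebra of \<open>u\<^sup>*(2n)\<close>\<close>

type_synonym 'n ix = "'n + 'n"

lemma scaleR_complex: "r *\<^sub>R z = of_real r * z" for z :: complex
  by (rule scaleR_conv_of_real)

lemma cnj_mat_nth [simp]: "cnj_mat z $ i $ j = cnj (z $ i $ j)"
  by (simp add: cnj_mat_def)

lemma adj_mat_nth [simp]: "adj_mat z $ i $ j = cnj (z $ j $ i)"
  by (simp add: adj_mat_def transpose_def)

lemma cnj_mat_mult: "cnj_mat (A ** B) = cnj_mat A ** cnj_mat B"
  by (simp add: vec_eq_iff matrix_matrix_mult_def)

lemma adj_mat_mult: "adj_mat (A ** B) = adj_mat B ** adj_mat A"
  by (simp add: vec_eq_iff matrix_matrix_mult_def mult.commute)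

lemma cnj_mat_simps [simp]:
  "cnj_mat (cnj_mat A) = A" "cnj_mat (mat 1) = mat 1" "cnj_mat (A + B) = cnj_mat A + cnj_mat B"
  "cnj_mat (A - B) = cnj_mat A - cnj_mat B" "cnj_mat (- A) = - cnj_mat A"
  "cnj_mat (r *\<^sub>R A) = r *\<^sub>R cnj_mat A" "cnj_mat 0 = 0"
  by (simp_all add: vec_eq_iff mat_def)

lemma adj_mat_simps [simp]:
  "adj_mat (adj_mat A) = A" "adj_mat (mat 1) = mat 1" "adj_mat (A + B) = adj_mat A + adj_mat B"
  "adj_mat (A - B) = adj_mat A - adj_mat B" "adj_mat (- A) = - adj_mat A"
  "adj_mat (r *\<^sub>R A) = r *\<^sub>R adj_mat A" "adj_mat 0 = 0"
  by (auto simp: vec_eq_iff mat_def)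

lemma bounded_linear_adj_mat: "bounded_linear (adj_mat :: 'n::finite cmat \<Rightarrow> 'n cmat)"
  unfolding linear_conv_bounded_linear[symmetric] by (intro linearI) auto

lemma bounded_linear_entry: "bounded_linear (\<lambda>A::'n::finite cmat. A $ i $ j)"
  by (rule bounded_linear_compose[OF bounded_linear_vec_nth bounded_linear_vec_nth])

lemma trace_adj_mat: "trace (adj_mat A) = cnj (trace A)"
  by (simp add: trace_def)

lemma trace_minus: "trace (- A) = - trace (A :: 'n::finite cmat)"
  by (simp add: trace_def sum_negf)

lemma trace_scaleR: "trace (r *\<^sub>R A) = r *\<^sub>R trace (A :: 'n::finite cmat)"
  by (simp add: trace_def scaleR_sum_right)

lemma det_cnj_mat: "det (cnj_mat A) = cnj (det A)"
  by (simp add: det_def)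

lemma det_adj_mat: "det (adj_mat A) = cnj (det A)"
  by (simp add: adj_mat_def det_cnj_mat)

lemma inner_cmat: "A \<bullet> B = Re (trace (A ** adj_mat B))" for A B :: "'n::finite cmat"
  by (simp add: inner_vec_def trace_def matrix_matrix_mult_def inner_complex_def)

lemma Jmat_nth: "Jmat $ i $ j = (case i of Inl a \<Rightarrow> if j = Inr a then 1 else 0
    | Inr a \<Rightarrow> if j = Inl a then - 1 else 0)"
  by (simp add: Jmat_def)

lemma Jmat_antisym: "Jmat $ i $ j = - Jmat $ j $ i"
  by (auto simp: Jmat_nth split: sum.splits)

lemma Jmat_square: "Jmat ** Jmat = - (mat 1 :: 'n::finite cmat)"
proof -
  have "(\<Sum>k\<in>UNIV. Jmat $ i $ k * Jmat $ k $ j) = - (mat 1 :: 'n cmat) $ i $ j" for i j :: "'n ix"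
  proof (cases i)
    case (Inl a)
    have "Jmat $ i $ k * Jmat $ k $ j = (if k = Inr a then (if j = i then - 1 else 0) else 0)" for k
      using Inl by (auto simp: Jmat_nth split: sum.splits)
    then show ?thesis by (simp add: mat_def)
  next
    case (Inr a)
    have "Jmat $ i $ k * Jmat $ k $ j = (if k = Inl a then (if j = i then - 1 else 0) else 0)" for k
      using Inr by (auto simp: Jmat_nth split: sum.splits)
    then show ?thesis by (simp add: mat_def)
  qed
  then show ?thesis by (simp add: vec_eq_iff matrix_matrix_mult_def)
qed

lemma cnj_mat_Jmat: "cnj_mat Jmat = Jmat"
  by (auto simp: vec_eq_iff Jmat_nth split: sum.splits)

lemma adj_mat_Jmat: "adj_mat Jmat = - Jmat"
  by (auto simp: vec_eq_iff Jmat_nth split: sum.splits)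

lemma Jmat_Jmat_mult: "Jmat ** (Jmat ** A) = - A" "A ** Jmat ** Jmat = - A" for A :: "'n::finite cmat"
  by (simp_all add: matrix_mul_assoc Jmat_square mm.minus_left mm.minus_right
      matrix_mul_assoc[symmetric, of A])

lemma u_star_alg_iff: "X \<in> u_star_alg \<longleftrightarrow> X ** Jmat = Jmat ** cnj_mat X"
  by (simp add: u_star_alg_def)

text \<open>Exhibits \<open>u_star_alg\<close> as the fixed space of the involution sending
  \<open>X\<close> to \<open>- J cnj(X) J\<close>; the projection \<open>proj_u\<close> is the
  average over it.\<close>

lemma u_star_alg_iff': "X \<in> u_star_alg \<longleftrightarrow> X = - (Jmat ** cnj_mat X ** Jmat)"
proof
  assume "X \<in> u_star_alg"
  then have "X ** Jmat ** Jmat = Jmat ** cnj_mat X ** Jmat" by (simp add: u_star_alg_iff)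
  then have "Jmat ** cnj_mat X ** Jmat = - X" by (simp add: Jmat_Jmat_mult)
  then show "X = - (Jmat ** cnj_mat X ** Jmat)" by simp
next
  assume *: "X = - (Jmat ** cnj_mat X ** Jmat)"
  have "X ** Jmat = - (Jmat ** cnj_mat X ** Jmat ** Jmat)"
    by (subst *) (simp add: mm.minus_left)
  then show "X \<in> u_star_alg" by (simp add: u_star_alg_iff Jmat_Jmat_mult)
qed

lemma subspace_u_star_alg: "subspace (u_star_alg :: 'n::finite cmat set)"
  unfolding subspace_def
  by (auto simp: u_star_alg_iff mm.zero_left mm.zero_right mm.add_left mm.add_right mm.scaleR_left mm.scaleR_right)

lemma u_star_alg_one: "mat 1 \<in> (u_star_alg :: 'n::finite cmat set)"
  by (simp add: u_star_alg_iff)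

lemma u_star_alg_mult: "X \<in> u_star_alg \<Longrightarrow> Y \<in> u_star_alg \<Longrightarrow> X ** Y \<in> u_star_alg"
  unfolding u_star_alg_iff cnj_mat_mult by (metis matrix_mul_assoc)

lemma u_star_alg_adj: assumes "X \<in> u_star_alg" shows "adj_mat X \<in> u_star_alg"
proof -
  have *: "cnj_mat (adj_mat X) = adj_mat (cnj_mat X)" by (simp add: vec_eq_iff)
  have "X = - (Jmat ** cnj_mat X ** Jmat)" using assms u_star_alg_iff' by blast
  then have "adj_mat X = adj_mat (- (Jmat ** cnj_mat X ** Jmat))" by simp
  also have "\<dots> = - (Jmat ** cnj_mat (adj_mat X) ** Jmat)"
    unfolding * by (simp add: adj_mat_mult adj_mat_Jmat mm.minus_left mm.minus_right matrix_mul_assoc)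
  finally show ?thesis unfolding u_star_alg_iff' .
qed

lemma invertible_matrix_inv: "invertible A \<Longrightarrow> invertible (matrix_inv A)" for A :: "'n::finite cmat"
  using matrix_inv_left_right[of A] unfolding invertible_def by blast

lemma matrix_inv_unique:
  fixes A B :: "complex ^ 'm::finite ^ 'm"
  assumes "A ** B = mat 1"
  shows "matrix_inv A = B"
proof -
  have "B ** A = mat 1" using assms by (simp add: matrix_left_right_inverse)
  then have "invertible A" using assms unfolding invertible_def by blast
  then have "matrix_inv A = matrix_inv A ** (A ** B)" by (simp add: assms)
  also have "\<dots> = B" by (simp add: matrix_mul_assoc matrix_inv_left_right[OF \<open>invertible A\<close>])
  finally show ?thesis .
qed

lemma u_star_alg_inv:
  assumes "X \<in> u_star_alg" "invertible X" shows "matrix_inv X \<in> u_star_alg"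
proof -
  let ?Y = "matrix_inv X"
  note inv = matrix_inv_left_right[OF assms(2)]
  have "cnj_mat X ** cnj_mat ?Y = mat 1" by (simp add: cnj_mat_mult[symmetric] inv)
  then have "Jmat = Jmat ** cnj_mat X ** cnj_mat ?Y" by (simp add: matrix_mul_assoc[symmetric])
  also have "\<dots> = X ** Jmat ** cnj_mat ?Y" using assms(1) by (simp add: u_star_alg_iff)
  finally have "?Y ** Jmat = ?Y ** (X ** Jmat ** cnj_mat ?Y)" by (rule arg_cong)
  then have "?Y ** Jmat = ?Y ** X ** Jmat ** cnj_mat ?Y" by (simp add: matrix_mul_assoc)
  then show ?thesis by (simp add: u_star_alg_iff inv)
qed

lemma U_star_iff: "x \<in> U_star \<longleftrightarrow> invertible x \<and> x \<in> u_star_alg"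
  by (simp add: U_star_def u_star_alg_iff)

lemma adj_mat_inverse:
  assumes "invertible x" shows "invertible (adj_mat x)" "matrix_inv (adj_mat x) = adj_mat (matrix_inv x)"
proof -
  have *: "adj_mat x ** adj_mat (matrix_inv x) = mat 1"
    by (simp add: adj_mat_mult[symmetric] matrix_inv_left_right[OF assms])
  then show "invertible (adj_mat x)"
    using assms by (simp add: invertible_det_nz det_adj_mat)
  show "matrix_inv (adj_mat x) = adj_mat (matrix_inv x)" by (rule matrix_inv_unique[OF *])
qed

lemma U_star_closed:
  assumes "x \<in> U_star" shows "adj_mat x \<in> U_star" "matrix_inv x \<in> U_star"
  using assms adj_mat_inverse invertible_matrix_inv u_star_alg_adj u_star_alg_inv
  by (auto simp: U_star_iff)

lemma p_space_iff: "X \<in> p_space \<longleftrightarrow> X \<in> u_star_alg \<and> adj_mat X = X"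
  by (simp add: p_space_def)

lemma p0_space_iff: "X \<in> p0_space \<longleftrightarrow> X \<in> u_star_alg \<and> adj_mat X = X \<and> trace X = 0"
  by (simp add: p0_space_def p_space_def)

lemma subspace_p_space: "subspace (p_space :: 'n::finite cmat set)"
  using subspace_u_star_alg unfolding subspace_def by (auto simp: p_space_iff)

lemma subspace_p0_space: "subspace (p0_space :: 'n::finite cmat set)"
  using subspace_u_star_alg unfolding subspace_def
  by (auto simp: p0_space_iff trace_add trace_0[unfolded mat_0] trace_scaleR)

text \<open>The Lie algebra of \<open>Sp(n)\<close>. On it \<open>trace_form\<close> is minus the
  Euclidean inner product, on \<open>p_space\<close> it is the inner product itself, so Euclidean
  orthonormal bases of both together give a frame with signs -1 and 1.\<close>

definition sp_alg :: "'n::finite cmat set" where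
  "sp_alg = {X \<in> u_star_alg. adj_mat X = - X}"

lemma subspace_sp_alg: "subspace (sp_alg :: 'n::finite cmat set)"
  using subspace_u_star_alg unfolding subspace_def by (auto simp: sp_alg_def)

lemma trace_form_p: "adj_mat Y = Y \<Longrightarrow> trace_form X Y = X \<bullet> Y"
  by (simp add: trace_form_def inner_cmat)

lemma trace_form_sp: "adj_mat Y = - Y \<Longrightarrow> trace_form X Y = - (X \<bullet> Y)"
  by (simp add: trace_form_def inner_cmat mm.minus_right trace_minus)

lemma inner_p_sp: "adj_mat X = X \<Longrightarrow> adj_mat Y = - Y \<Longrightarrow> X \<bullet> Y = 0"
proof -
  assume "adj_mat X = X" "adj_mat Y = - Y"
  then have "X \<bullet> Y = - Re (trace (X ** Y))" "Y \<bullet> X = Re (trace (Y ** X))"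
    by (simp_all add: inner_cmat mm.minus_right trace_minus)
  then show ?thesis using inner_commute[of X Y] trace_mul_sym[of X Y] by simp
qed

lemma p_part_p_space: "X \<in> u_star_alg \<Longrightarrow> p_part X \<in> p_space"
  unfolding p_part_def p_space_iff using subspace_u_star_alg u_star_alg_adj
  by (auto simp: add.commute intro: subspace_add subspace_scale)

section \<open>Sums over orthonormal bases\<close>

definition onb :: "'e::euclidean_space set \<Rightarrow> 'e set \<Rightarrow> bool" where
  "onb W C \<longleftrightarrow> finite C \<and> pairwise orthogonal C \<and> (\<forall>x\<in>C. norm x = 1) \<and> span C = W"

lemma onb_exists: assumes "subspace W" obtains C where "onb W C"
proof -
  obtain C where "C \<subseteq> W" "pairwise orthogonal C" "\<And>x. x \<in> C \<Longrightarrow> norm x = 1" "span C = W"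
    by (rule orthonormal_basis_subspace[OF assms]) (assumption | rule that)+
  then show thesis
    using that[of C] pairwise_orthogonal_imp_finite[of C] by (simp add: onb_def)
qed

lemma onbD: assumes "onb W C" shows "finite C" "E \<in> C \<Longrightarrow> E \<in> W" "E \<in> C \<Longrightarrow> E \<noteq> 0"
  using assms span_base[of E C] by (auto simp: onb_def)

text \<open>A closed formula for an orthogonal projection thus determines sums over any orthonormal
  basis of its image, without a basis being written down.\<close>

lemma onb_project:
  assumes C: "onb W C" and w: "w \<in> W" and orth: "\<And>Y. Y \<in> W \<Longrightarrow> (X - w) \<bullet> Y = 0"
  shows "(\<Sum>E\<in>C. (X \<bullet> E) *\<^sub>R E) = w"
proof -
  have "(\<Sum>E\<in>C. (X \<bullet> E) *\<^sub>R E) = (\<Sum>E\<in>C. (w \<bullet> E) *\<^sub>R E)"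
    using orth[OF onbD(2)[OF C]] by (intro sum.cong) (auto simp: inner_diff_left)
  also have "\<dots> = w"
    using C w by (intro orthonormal_basis_expand) (auto simp: onb_def)
  finally show ?thesis .
qed

section \<open>Kernels of the orthogonal projections onto the Hermitian parts\<close>

definition mat_unit :: "'n::finite ix \<Rightarrow> 'n ix \<Rightarrow> 'n cmat" where
  "mat_unit d c = (\<chi> i j. if i = d \<and> j = c then 1 else 0)"

text \<open>Multiplication by the imaginary unit, spelled out because matrices are treated as a real
  vector space. Together with \<open>mat_unit\<close> it recovers the real and imaginary parts of
  single entries as inner products.\<close>

definition i_mat :: "'n::finite cmat \<Rightarrow> 'n cmat" where
  "i_mat A = (\<chi> i j. \<i> * A $ i $ j)"

lemma i_mat_nth [simp]: "i_mat A $ i $ j = \<i> * A $ i $ j"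
  by (simp add: i_mat_def)

lemma inner_mat_unit: "mat_unit d c \<bullet> E = Re (E $ d $ c)" "i_mat (mat_unit d c) \<bullet> E = Im (E $ d $ c)"
proof -
  have *: "A \<bullet> E = (\<Sum>i\<in>UNIV. \<Sum>j\<in>UNIV. Re (A $ i $ j) * Re (E $ i $ j) + Im (A $ i $ j) * Im (E $ i $ j))"
    for A by (simp add: inner_vec_def inner_complex_def)
  have s: "(\<Sum>i\<in>UNIV. \<Sum>j\<in>UNIV. if i = d \<and> j = c then f i j else 0) = f d c" for f :: "'a ix \<Rightarrow> 'a ix \<Rightarrow> real"
  proof -
    have "(\<Sum>j\<in>UNIV. if i = d \<and> j = c then f i j else 0) = (if i = d then f d c else 0)" for i
      by (cases "i = d") (simp_all)
    then show ?thesis by simp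
  qed
  show "mat_unit d c \<bullet> E = Re (E $ d $ c)"
    unfolding * using s[of "\<lambda>i j. Re (E $ i $ j)"]
    by (simp add: mat_unit_def if_distrib[of Re] if_distrib[of Im] if_distrib[of "\<lambda>x. x * _"] cong: if_cong)
  show "i_mat (mat_unit d c) \<bullet> E = Im (E $ d $ c)"
    unfolding * using s[of "\<lambda>i j. Im (E $ i $ j)"]
    by (simp add: mat_unit_def if_distrib[of Re] if_distrib[of Im] if_distrib[of "\<lambda>x. x * _"] cong: if_cong)
qed

text \<open>
  The combination \<open>\<pi> X + \<i> \<pi> (\<i> X)\<close> kills the complex linear part of a real linear map \<open>\<pi>\<close> and
  doubles the antilinear part. This is why only the terms \<open>X\<^sup>*\<close> and \<open>J (cnj X) J\<close> of the projection
  onto \<open>p_space\<close> survive in \<open>p_kernel\<close>.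
\<close>

lemma onb_kernel:
  assumes C: "onb W C" and \<pi>: "\<And>X. \<pi> X \<in> W" "\<And>X Y. Y \<in> W \<Longrightarrow> (X - \<pi> X) \<bullet> Y = 0"
  shows "(\<Sum>E\<in>C. E $ a $ b * E $ d $ c) = \<pi> (mat_unit d c) $ a $ b + \<i> * \<pi> (i_mat (mat_unit d c)) $ a $ b"
proof -
  have p: "\<pi> X $ a $ b = (\<Sum>E\<in>C. of_real (X \<bullet> E) * E $ a $ b)" for X
  proof -
    have "\<pi> X = (\<Sum>E\<in>C. (X \<bullet> E) *\<^sub>R E)"
      by (rule onb_project[OF C \<pi>(1) \<pi>(2), symmetric])
    then have "\<pi> X $ a $ b = (\<Sum>E\<in>C. (X \<bullet> E) *\<^sub>R E) $ a $ b"
      by simp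
    then show ?thesis by (simp add: scaleR_complex)
  qed
  have "E $ d $ c = of_real (mat_unit d c \<bullet> E) + \<i> * of_real (i_mat (mat_unit d c) \<bullet> E)" for E
    by (simp add: inner_mat_unit complex_eq_iff)
  then show ?thesis
    unfolding p by (simp add: sum_distrib_left sum.distrib[symmetric] algebra_simps)
qed

definition proj_u :: "'n::finite cmat \<Rightarrow> 'n cmat" where
  "proj_u X = (1/2) *\<^sub>R (X - Jmat ** cnj_mat X ** Jmat)"

definition proj_p :: "'n::finite cmat \<Rightarrow> 'n cmat" where
  "proj_p X = p_part (proj_u X)"

lemma proj_u: "proj_u X \<in> u_star_alg"
proof -
  have "Jmat ** (Jmat ** X ** Jmat) ** Jmat = X"
    by (simp add: matrix_mul_assoc Jmat_square mm.minus_left)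
       (simp add: matrix_mul_assoc[symmetric] Jmat_square mm.minus_left mm.minus_right)
  then show ?thesis
    unfolding u_star_alg_iff' proj_u_def
    by (simp add: cnj_mat_mult cnj_mat_Jmat mm.scaleR_left mm.scaleR_right mm.diff_left mm.diff_right
        scaleR_diff_right)
qed

text \<open>For \<open>Y\<close> in \<open>u_star_alg\<close> the adjoint lies there too, so
  \<open>J adj(Y) J = - cnj (adj Y)\<close>. Moving \<open>J\<close> cyclically through the trace
  therefore turns the inner product of \<open>J cnj(X) J\<close> with \<open>Y\<close> into minus
  that of \<open>X\<close> with \<open>Y\<close>.\<close>

lemma proj_u_inner: assumes "Y \<in> u_star_alg" shows "(X - proj_u X) \<bullet> Y = 0"
proof -
  have "(Jmat ** cnj_mat X ** Jmat) \<bullet> Y = Re (trace (Jmat ** cnj_mat X ** Jmat ** adj_mat Y))"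
    by (simp add: inner_cmat)
  also have "Jmat ** cnj_mat X ** Jmat ** adj_mat Y = Jmat ** (cnj_mat X ** (Jmat ** adj_mat Y))"
    by (simp add: matrix_mul_assoc)
  also have "trace \<dots> = trace (cnj_mat X ** (Jmat ** adj_mat Y ** Jmat))"
    by (subst trace_mul_sym) (simp add: matrix_mul_assoc)
  also have "Jmat ** adj_mat Y ** Jmat = - cnj_mat (adj_mat Y)"
  proof -
    have "cnj_mat (adj_mat Y) = cnj_mat (- (Jmat ** cnj_mat (adj_mat Y) ** Jmat))"
      using u_star_alg_adj[OF assms] u_star_alg_iff' by metis
    also have "\<dots> = - (Jmat ** adj_mat Y ** Jmat)" by (simp add: cnj_mat_mult cnj_mat_Jmat)
    finally show ?thesis by simp
  qed
  also have "trace (cnj_mat X ** - cnj_mat (adj_mat Y)) = - cnj (trace (X ** adj_mat Y))"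
    by (simp add: trace_def matrix_matrix_mult_def sum_negf)
  finally have "(Jmat ** cnj_mat X ** Jmat) \<bullet> Y = - (X \<bullet> Y)"
    by (simp add: inner_cmat)
  then show ?thesis by (simp add: proj_u_def inner_diff_left)
qed

lemma proj_p: "proj_p X \<in> p_space"
  unfolding proj_p_def by (rule p_part_p_space[OF proj_u])

lemma p_part_inner: "adj_mat Y = Y \<Longrightarrow> (X - p_part X) \<bullet> Y = 0"
proof -
  assume Y: "adj_mat Y = Y"
  have eq: "X - p_part X = (1/2) *\<^sub>R (X - adj_mat X)"
    by (simp add: p_part_def vec_eq_iff scaleR_complex algebra_simps)
  have "Y \<bullet> (X - p_part X) = 0"
    unfolding eq by (rule inner_p_sp[OF Y]) (simp add: vec_eq_iff scaleR_complex field_simps)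
  then show ?thesis by (simp add: inner_commute)
qed

lemma proj_p_inner: "Y \<in> p_space \<Longrightarrow> (X - proj_p X) \<bullet> Y = 0"
  using proj_u_inner[of Y X] p_part_inner[of Y "proj_u X"]
  by (auto simp: proj_p_def p_space_iff inner_diff_left)

lemma mat_unit_sandwich: "(A ** mat_unit d c ** B) $ x $ y = A $ x $ d * B $ c $ y"
proof -
  have "(A ** mat_unit d c) $ x $ k = (if k = c then A $ x $ d else 0)" for k
  proof -
    have "(A ** mat_unit d c) $ x $ k = (\<Sum>i\<in>UNIV. A $ x $ i * (if i = d \<and> k = c then 1 else 0))"
      by (simp add: matrix_matrix_mult_def mat_unit_def)
    also have "\<dots> = (\<Sum>i\<in>UNIV. if i = d then (if k = c then A $ x $ d else 0) else 0)"
      by (intro sum.cong) auto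
    finally show ?thesis by simp
  qed
  then have "(A ** mat_unit d c ** B) $ x $ y = (\<Sum>k\<in>UNIV. (if k = c then A $ x $ d else 0) * B $ k $ y)"
    by (simp add: matrix_matrix_mult_def[of "A ** mat_unit d c"])
  also have "\<dots> = (\<Sum>k\<in>UNIV. if k = c then A $ x $ d * B $ k $ y else 0)"
    by (intro sum.cong) auto
  finally show ?thesis by simp
qed

lemma i_mat_sandwich: "A ** i_mat X ** B = i_mat (A ** X ** B)"
  by (simp add: vec_eq_iff matrix_matrix_mult_def sum_distrib_left sum_distrib_right mult_ac)

lemma cnj_mat_unit: "cnj_mat (mat_unit d c) = mat_unit d c"
  by (simp add: vec_eq_iff mat_unit_def)

lemma cnj_i_mat: "cnj_mat (i_mat X) = - i_mat (cnj_mat X)"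
  by (simp add: vec_eq_iff)

lemma cnj_Jmat: "cnj (Jmat $ i $ j) = Jmat $ i $ j"
  by (simp only: cnj_mat_nth[symmetric] cnj_mat_Jmat)

text \<open>With \<open>X'\<close> the transpose, the projection is
  \<open>(X + adj X - J cnj(X) J - J X' J) / 4\<close>. Doubling its two antilinear terms leaves
  \<open>(adj X - J cnj(X) J) / 2\<close>, whose entries at a matrix unit are the two products on
  the right.\<close>

lemma proj_p_complex_linear_part:
  "proj_p (mat_unit d c) $ a $ b + \<i> * proj_p (i_mat (mat_unit d c)) $ a $ b
    = ((if a = c \<and> b = d then 1 else 0) - Jmat $ a $ d * Jmat $ c $ b) / 2"
proof -
  let ?J = "Jmat ** mat_unit d c ** Jmat"
  have 1: "proj_u (mat_unit d c) = (1/2) *\<^sub>R (mat_unit d c - ?J)"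
    by (simp add: proj_u_def cnj_mat_unit)
  have 2: "proj_u (i_mat (mat_unit d c)) = (1/2) *\<^sub>R (i_mat (mat_unit d c) + i_mat ?J)"
    by (simp add: proj_u_def cnj_i_mat cnj_mat_unit mm.minus_left mm.minus_right i_mat_sandwich)
  have u: "mat_unit d c $ x $ y = (if x = d \<and> y = c then 1 else 0)" for x y
    by (simp add: mat_unit_def)
  show ?thesis
    unfolding proj_p_def p_part_def 1 2
    by (simp add: mat_unit_sandwich cnj_Jmat scaleR_complex)
      (simp add: u field_simps)
qed

lemma p_kernel:
  assumes "onb p_space C"
  shows "(\<Sum>E\<in>C. E $ a $ b * E $ d $ c) = ((if a = c \<and> b = d then 1 else 0) - Jmat $ a $ d * Jmat $ c $ b) / 2"
  by (simp only: onb_kernel[OF assms proj_p proj_p_inner] proj_p_complex_linear_part)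

lemma trace_hermitian: "adj_mat X = X \<Longrightarrow> trace X = of_real (Re (trace X))"
  using trace_adj_mat[of X] by (simp add: complex_eq_iff)

lemma inner_one: "X \<bullet> mat 1 = Re (trace X)" for X :: "'n::finite cmat"
  by (simp add: inner_cmat)

lemma trace_one: "trace (mat 1 :: 'n::finite cmat) = 2 * of_nat CARD('n)"
  by (simp add: trace_I)

definition traceless :: "'n::finite cmat \<Rightarrow> 'n cmat" where
  "traceless X = X - (Re (trace X) / (2 * real CARD('n))) *\<^sub>R mat 1"

lemma traceless_p0: "X \<in> p_space \<Longrightarrow> traceless X \<in> p0_space" for X :: "'n::finite cmat"
  using subspace_u_star_alg u_star_alg_one trace_hermitian[of X]
  by (auto simp: traceless_def p0_space_iff p_space_iff trace_sub trace_scaleR trace_one scaleR_complex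
      intro: subspace_diff subspace_scale)

text \<open>The traceless part of \<open>X\<close> is itself an admissible test vector and is
  orthogonal to \<open>mat 1\<close>, so the hypothesis makes its norm vanish.\<close>

lemma p0_onb_eqD:
  fixes X :: "'n::finite cmat"
  assumes "X \<in> p_space" "\<And>Y. Y \<in> p0_space \<Longrightarrow> X \<bullet> Y = 0"
  obtains r where "X = r *\<^sub>R mat 1"
proof -
  let ?Y = "traceless X"
  have Y: "?Y \<in> p0_space" by (rule traceless_p0[OF assms(1)])
  have "mat 1 \<bullet> ?Y = 0"
    using Y inner_one[of ?Y] by (simp add: inner_commute[of "mat 1"] p0_space_iff)
  then have "?Y \<bullet> ?Y = 0"
    using assms(2)[OF Y] by (subst (1) traceless_def) (simp add: inner_diff_left)
  then have "X = (Re (trace X) / (2 * real CARD('n))) *\<^sub>R mat 1"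
    by (simp add: traceless_def)
  then show thesis by (rule that)
qed

text \<open>Removing the line of \<open>mat 1\<close> from \<open>p_space\<close> removes its
  contribution to the kernel. As \<open>mat 1\<close> has squared norm \<open>2n\<close>, that
  contribution is the product of two Kronecker symbols over \<open>2n\<close>.\<close>

lemma p0_kernel:
  fixes a b c d :: "'n::finite ix"
  assumes "onb p0_space C"
  shows "(\<Sum>E\<in>C. E $ a $ b * E $ d $ c) = ((if a = c \<and> b = d then 1 else 0) - Jmat $ a $ d * Jmat $ c $ b) / 2
    - (1 / (2 * of_nat CARD('n))) * (if a = b \<and> d = c then 1 else 0)"
proof -
  let ?\<pi> = "\<lambda>X :: 'n cmat. proj_p X - (Re (trace X) / (2 * real CARD('n))) *\<^sub>R mat 1"
  have eq: "?\<pi> X = traceless (proj_p X)" for X :: "'n cmat"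
  proof -
    have "mat 1 \<in> (p_space :: 'n cmat set)" by (simp add: p_space_iff u_star_alg_one)
    from proj_p_inner[OF this, of X] have "Re (trace X) = Re (trace (proj_p X))"
      by (simp add: inner_diff_left inner_one trace_sub)
    then show ?thesis by (simp add: traceless_def)
  qed
  have "?\<pi> X \<in> p0_space" for X unfolding eq by (rule traceless_p0[OF proj_p])
  moreover have "(X - ?\<pi> X) \<bullet> Y = 0" if "Y \<in> p0_space" for X Y :: "'n cmat"
  proof -
    have "Y \<in> p_space" "mat 1 \<bullet> Y = 0"
      using that inner_one[of Y] by (auto simp: inner_commute[of "mat 1"] p0_space_iff p_space_iff)
    then show ?thesis
      using proj_p_inner[of Y X] by (simp add: inner_diff_left)
  qed
  ultimately have "(\<Sum>E\<in>C. E $ a $ b * E $ d $ c)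
      = ?\<pi> (mat_unit d c) $ a $ b + \<i> * ?\<pi> (i_mat (mat_unit d c)) $ a $ b"
    by (rule onb_kernel[OF assms])
  also have "\<dots> = (proj_p (mat_unit d c) $ a $ b + \<i> * proj_p (i_mat (mat_unit d c)) $ a $ b)
      - (of_real (Re (trace (mat_unit d c :: 'n cmat))) + \<i> * of_real (Re (trace (i_mat (mat_unit d c) :: 'n cmat))))
        / (2 * of_nat CARD('n)) * (if a = b then 1 else 0)"
    by (simp add: scaleR_complex mat_def algebra_simps add_divide_distrib)
  also have "trace (mat_unit d c :: 'n cmat) = (if d = c then 1 else 0)"
    unfolding trace_def mat_unit_def by (cases "d = c") (auto intro!: sum.neutral)
  also have "trace (i_mat (mat_unit d c) :: 'n cmat) = \<i> * (if d = c then 1 else 0)"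
    unfolding trace_def mat_unit_def by (cases "d = c") (auto intro!: sum.neutral simp: if_distrib cong: if_cong)
  finally show ?thesis unfolding proj_p_complex_linear_part by simp
qed

text \<open>Treats both spaces at once: \<gamma> is 0 for \<open>p_space\<close> and
  \<open>1 / (2n)\<close> for \<open>p0_space\<close>.\<close>

locale kernel_sum =
  fixes C :: "'n::finite cmat set" and \<gamma> :: complex
  assumes kernel: "(\<Sum>E\<in>C. E $ a $ b * E $ d $ c) =
    ((if a = c \<and> b = d then 1 else 0) - Jmat $ a $ d * Jmat $ c $ b) / 2 - \<gamma> * (if a = b \<and> d = c then 1 else 0)"
begin

lemma sum_vec: "(\<Sum>E\<in>C. (E *v v) $ a * (E *v v) $ d) = (1/2 - \<gamma>) * v $ a * v $ d"
proof -
  have J0: "(\<Sum>b\<in>UNIV. \<Sum>c\<in>UNIV. v $ b * v $ c * Jmat $ c $ b) = 0" (is "?S = 0")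
  proof -
    have "?S = (\<Sum>c\<in>UNIV. \<Sum>b\<in>UNIV. v $ b * v $ c * Jmat $ c $ b)" by (rule sum.swap)
    also have "\<dots> = (\<Sum>c\<in>UNIV. \<Sum>b\<in>UNIV. - (v $ c * v $ b * Jmat $ b $ c))"
      by (intro sum.cong refl, subst Jmat_antisym) (simp add: mult_ac)
    also have "\<dots> = - ?S" by (simp add: sum_negf)
    finally show ?thesis by simp
  qed
  have "(\<Sum>E\<in>C. (E *v v) $ a * (E *v v) $ d) =
      (\<Sum>E\<in>C. \<Sum>b\<in>UNIV. \<Sum>c\<in>UNIV. v $ b * v $ c * (E $ a $ b * E $ d $ c))"
    by (simp add: matrix_vector_mult_def sum_product mult_ac)
  also have "\<dots> = (\<Sum>b\<in>UNIV. \<Sum>c\<in>UNIV. v $ b * v $ c * (\<Sum>E\<in>C. E $ a $ b * E $ d $ c))"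
    by (subst sum.swap, intro sum.cong refl, subst sum.swap) (simp add: sum_distrib_left)
  also have "\<dots> = (\<Sum>b\<in>UNIV. \<Sum>c\<in>UNIV.
      (if b = d then (if c = a then v $ a * v $ d / 2 else 0) else 0)
      - (if b = a then (if c = d then \<gamma> * v $ a * v $ d else 0) else 0)
      - Jmat $ a $ d / 2 * (v $ b * v $ c * Jmat $ c $ b))"
    unfolding kernel by (intro sum.cong refl) (simp add: field_simps)
  also have "\<dots> = v $ a * v $ d / 2 - \<gamma> * v $ a * v $ d - Jmat $ a $ d / 2 * ?S"
  proof -
    have *: "(\<Sum>b\<in>UNIV. \<Sum>c\<in>UNIV. if b = x then (if c = y then z else 0) else 0) = z"
      for x y :: "'n ix" and z :: complex
    proof -
      have "(\<Sum>c\<in>UNIV. if b = x then (if c = y then z else 0) else 0) = (if b = x then z else 0)" for b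
        by (cases "b = x") auto
      then show ?thesis by simp
    qed
    show ?thesis by (simp only: sum_subtractf * sum_distrib_left[symmetric])
  qed
  finally show ?thesis unfolding J0 by (simp add: algebra_simps)
qed

lemma sandwich_entry: "(S ** E ** adj_mat S) $ k $ l = (\<Sum>a\<in>UNIV. S $ k $ a * (E *v (\<chi> b. cnj (S $ l $ b))) $ a)"
proof -
  have "(S ** E ** adj_mat S) $ k $ l = (S ** (E ** adj_mat S)) $ k $ l"
    by (simp add: matrix_mul_assoc)
  then show ?thesis by (simp add: matrix_matrix_mult_def matrix_vector_mult_def)
qed

text \<open>Both entries end in the index \<open>l\<close>, so both factors apply \<open>E\<close>
  to the same vector, the conjugate of row \<open>l\<close> of \<open>S\<close>. This is where the
  restriction to a single column enters, since \<open>sum_vec\<close> needs a symmetric tensor to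
  eliminate \<open>J\<close>.\<close>

lemma sum_sandwich:
  "(\<Sum>E\<in>C. (S ** E ** adj_mat S) $ k $ l * (S ** E ** adj_mat S) $ m $ l)
    = (1/2 - \<gamma>) * (S ** adj_mat S) $ k $ l * (S ** adj_mat S) $ m $ l"
proof -
  let ?v = "\<chi> b. cnj (S $ l $ b)"
  have \<Phi>: "(S ** adj_mat S) $ k $ l = (\<Sum>a\<in>UNIV. S $ k $ a * ?v $ a)" for k
    by (simp add: matrix_matrix_mult_def)
  have "(\<Sum>E\<in>C. (S ** E ** adj_mat S) $ k $ l * (S ** E ** adj_mat S) $ m $ l)
     = (\<Sum>E\<in>C. \<Sum>a\<in>UNIV. \<Sum>d\<in>UNIV. S $ k $ a * S $ m $ d * ((E *v ?v) $ a * (E *v ?v) $ d))"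
    unfolding sandwich_entry sum_product by (simp add: mult_ac)
  also have "\<dots> = (\<Sum>a\<in>UNIV. \<Sum>d\<in>UNIV. S $ k $ a * S $ m $ d * (\<Sum>E\<in>C. (E *v ?v) $ a * (E *v ?v) $ d))"
    by (subst sum.swap, intro sum.cong refl, subst sum.swap) (simp add: sum_distrib_left)
  also have "\<dots> = (\<Sum>a\<in>UNIV. \<Sum>d\<in>UNIV. (1/2 - \<gamma>) * ((S $ k $ a * ?v $ a) * (S $ m $ d * ?v $ d)))"
    unfolding sum_vec by (intro sum.cong refl) (simp add: mult_ac)
  also have "\<dots> = (1/2 - \<gamma>) * ((S ** adj_mat S) $ k $ l * (S ** adj_mat S) $ m $ l)"
    unfolding \<Phi> sum_product by (simp only: sum_distrib_left)
  finally show ?thesis by (simp only: mult.assoc)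
qed

text \<open>Contracting the inner indices of the kernel makes the sum of squares a scalar matrix:
  the Kronecker term contributes \<open>2n / 2 = n\<close>, the \<open>J\<close> term -1/2 because
  the rows of \<open>J\<close> are orthonormal, and the trace correction
  \<open>- \<gamma>\<close>.\<close>

lemma sum_square: "(\<Sum>E\<in>C. (E ** E) $ a $ d) = (of_nat CARD('n) - 1/2 - \<gamma>) * (mat 1 :: 'n cmat) $ a $ d"
proof -
  have J: "(\<Sum>b\<in>UNIV. Jmat $ a $ b * Jmat $ d $ b) = (mat 1 :: 'n cmat) $ a $ d"
  proof -
    have "(\<Sum>b\<in>UNIV. Jmat $ a $ b * Jmat $ d $ b) = - (\<Sum>b\<in>UNIV. Jmat $ a $ b * Jmat $ b $ d)"
      by (subst Jmat_antisym[of d]) (simp add: sum_negf)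
    also have "\<dots> = - (Jmat ** Jmat :: 'n cmat) $ a $ d"
      by (simp add: matrix_matrix_mult_def)
    finally show ?thesis by (simp add: Jmat_square)
  qed
  have "(\<Sum>E\<in>C. (E ** E) $ a $ d) = (\<Sum>b\<in>UNIV. \<Sum>E\<in>C. E $ a $ b * E $ b $ d)"
    by (simp add: matrix_matrix_mult_def) (rule sum.swap)
  also have "\<dots> = (\<Sum>b\<in>UNIV. (if a = d then 1/2 else 0) - Jmat $ a $ b * Jmat $ d $ b / 2
      - (if b = a then (if a = d then \<gamma> else 0) else 0))"
    unfolding kernel by (intro sum.cong refl) (auto simp: field_simps)
  also have "\<dots> = (if a = d then of_nat CARD('n) else 0) - (mat 1 :: 'n cmat) $ a $ d / 2 - (if a = d then \<gamma> else 0)"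
    unfolding sum_subtractf J[symmetric] sum_divide_distrib[symmetric] by simp
  finally show ?thesis by (cases "a = d") (simp_all add: mat_def algebra_simps)
qed

lemma sum_sandwich_square:
  "(\<Sum>E\<in>C. (S ** (E ** E) ** adj_mat S) $ k $ l)
    = (of_nat CARD('n) - 1/2 - \<gamma>) * (S ** adj_mat S) $ k $ l"
proof -
  let ?r = "of_nat CARD('n) - 1/2 - \<gamma>"
  have entry: "(S ** M ** adj_mat S) $ k $ l = (\<Sum>d\<in>UNIV. \<Sum>a\<in>UNIV. S $ k $ a * M $ a $ d * cnj (S $ l $ d))" for M
    by (simp add: matrix_matrix_mult_def sum_distrib_right)
  have "(\<Sum>E\<in>C. (S ** (E ** E) ** adj_mat S) $ k $ l)
      = (\<Sum>d\<in>UNIV. \<Sum>a\<in>UNIV. S $ k $ a * (\<Sum>E\<in>C. (E ** E) $ a $ d) * cnj (S $ l $ d))"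
    unfolding entry
    by (subst sum.swap, intro sum.cong refl, subst sum.swap) (simp add: sum_distrib_left sum_distrib_right)
  also have "\<dots> = ?r * (S ** mat 1 ** adj_mat S) $ k $ l"
    unfolding sum_square entry by (simp add: sum_distrib_left mult_ac)
  finally show ?thesis by simp
qed

end

section \<open>The group \<open>U\<^sup>*(2n)\<close>\<close>

lemma openin_U_star: "openin (top_of_set u_star_alg) (U_star :: 'n::finite cmat set)"
proof -
  have "continuous_on UNIV (\<lambda>x :: 'n cmat. det x)"
    unfolding det_def by (intro continuous_intros)
  then have "open ((\<lambda>x :: 'n cmat. det x) -` (- {0}))"
    by (intro open_vimage) auto
  moreover have "U_star = u_star_alg \<inter> (\<lambda>x :: 'n cmat. det x) -` (- {0})"
    by (auto simp: U_star_iff invertible_det_nz)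
  ultimately show ?thesis by (metis openin_open_Int)
qed

interpretation U_chart: chart_domain u_star_alg "U_star :: 'n::finite cmat set"
  by standard (rule subspace_u_star_alg, rule openin_U_star)

text \<open>Membership in \<open>C\<close> is what selects the sign of a frame vector, so the two
  bases must not overlap.\<close>

lemma p_sp_disjoint: assumes "onb p_space C" "onb sp_alg C'" shows "C \<inter> C' = {}"
proof -
  have False if "E \<in> C" "E \<in> C'" for E
  proof -
    have "adj_mat E = E" "adj_mat E = - E"
      using onbD(2)[OF assms(1) that(1)] onbD(2)[OF assms(2) that(2)]
      by (auto simp: p_space_iff sp_alg_def)
    then have "E = - E" by simp
    then have "E $ i $ j = - (E $ i $ j)" for i j by (metis vector_uminus_component)
    then have "E = 0" by (simp add: vec_eq_iff)
    then show False using onbD(3)[OF assms(1) that(1)] by simp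
  qed
  then show ?thesis by blast
qed

lemma u_star_frame:
  fixes X :: "'n::finite cmat"
  assumes C: "onb p_space C" and C': "onb sp_alg C'" and X: "X \<in> u_star_alg"
  shows "(\<Sum>E\<in>C \<union> C'. ((if E \<in> C then 1 else - 1) * trace_form X E) *\<^sub>R E) = X"
proof -
  let ?W = "X - p_part X"
  have sp: "?W \<in> sp_alg"
    using p_part_p_space[OF X] X subspace_u_star_alg
    by (auto simp: sp_alg_def p_space_iff p_part_def vec_eq_iff scaleR_complex field_simps intro: subspace_diff)
  have 1: "(\<Sum>E\<in>C. (X \<bullet> E) *\<^sub>R E) = p_part X"
    by (rule onb_project[OF C p_part_p_space[OF X] p_part_inner]) (simp add: p_space_iff)
  have 2: "(\<Sum>E\<in>C'. (X \<bullet> E) *\<^sub>R E) = ?W"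
  proof (rule onb_project[OF C' sp])
    fix Y assume "Y \<in> (sp_alg :: 'n cmat set)"
    then show "(X - ?W) \<bullet> Y = 0"
      using p_part_p_space[OF X] by (auto simp: sp_alg_def p_space_iff intro: inner_p_sp)
  qed
  have "(\<Sum>E\<in>C \<union> C'. ((if E \<in> C then 1 else - 1) * trace_form X E) *\<^sub>R E)
      = (\<Sum>E\<in>C. ((if E \<in> C then 1 else - 1) * trace_form X E) *\<^sub>R E)
        + (\<Sum>E\<in>C'. ((if E \<in> C then 1 else - 1) * trace_form X E) *\<^sub>R E)"
    by (rule sum.union_disjoint[OF onbD(1)[OF C] onbD(1)[OF C'] p_sp_disjoint[OF C C']])
  also have "(\<Sum>E\<in>C. ((if E \<in> C then 1 else - 1) * trace_form X E) *\<^sub>R E) = (\<Sum>E\<in>C. (X \<bullet> E) *\<^sub>R E)"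
    using onbD(2)[OF C] by (intro sum.cong refl) (simp add: trace_form_p p_space_iff)
  also have "(\<Sum>E\<in>C'. ((if E \<in> C then 1 else - 1) * trace_form X E) *\<^sub>R E) = (\<Sum>E\<in>C'. (X \<bullet> E) *\<^sub>R E)"
    using onbD(2)[OF C'] p_sp_disjoint[OF C C']
    by (intro sum.cong refl) (auto simp: trace_form_sp sp_alg_def)
  finally show ?thesis unfolding 1 2 by simp
qed

abbreviation g_U :: "'n::finite cmat \<Rightarrow> 'n cmat \<Rightarrow> 'n cmat \<Rightarrow> real" where
  "g_U x v w \<equiv> trace_form (matrix_inv x ** v) (matrix_inv x ** w)"

lemma U_star_frame_expand:
  fixes x :: "'n::finite cmat"
  assumes C: "onb p_space C" and C': "onb sp_alg C'" and x: "x \<in> U_star" and u: "u \<in> u_star_alg"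
  shows "(\<Sum>E\<in>C \<union> C'. ((if E \<in> C then 1 else - 1) * g_U x u (x ** E)) *\<^sub>R (x ** E)) = u"
proof -
  note inv = matrix_inv_left_right[of x]
  have x': "invertible x" "x \<in> u_star_alg" using x by (auto simp: U_star_iff)
  let ?X = "matrix_inv x ** u"
  have "?X \<in> u_star_alg" using x' u by (intro u_star_alg_mult u_star_alg_inv)
  from u_star_frame[OF C C' this]
  have "x ** (\<Sum>E\<in>C \<union> C'. ((if E \<in> C then 1 else - 1) * trace_form ?X E) *\<^sub>R E) = x ** ?X" by simp
  then show ?thesis
    using x' by (simp add: mm.sum_right mm.scaleR_right matrix_mul_assoc inv)
qed

lemma u_star_alg_left_translate: "x \<in> U_star \<Longrightarrow> C \<subseteq> u_star_alg \<Longrightarrow> E \<in> C \<Longrightarrow> x ** E \<in> u_star_alg"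
  by (auto simp: U_star_iff intro: u_star_alg_mult)

interpretation U_metric: trace_chart u_star_alg "U_star :: 'n::finite cmat set" "\<lambda>x. x" 1 g_U
proof unfold_locales
  show "Ck_on 2 u_star_alg U_star (\<lambda>x :: 'n cmat. x)"
    by (rule U_chart.Ck_on_bounded_linear_id[OF bounded_linear_ident])
  show "invertible x" if "x \<in> U_star" for x :: "'n cmat" using that by (simp add: U_star_iff)
  show "g_U x u w = 1 * Re (trace (matrix_inv x ** dderiv (\<lambda>x. x) x u ** (matrix_inv x ** dderiv (\<lambda>x. x) x w)))"
    for x u w :: "'n cmat"
    by (simp add: U_chart.dderiv_bounded_linear_id[OF bounded_linear_ident] trace_form_def)
  show "\<exists>(B :: 'n cmat set) e \<epsilon>. finite B \<and> (\<forall>E\<in>B. e E \<in> u_star_alg) \<and>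
      (\<forall>u\<in>u_star_alg. (\<Sum>E\<in>B. (\<epsilon> E * g_U x u (e E)) *\<^sub>R e E) = u)" if x: "x \<in> U_star" for x :: "'n cmat"
  proof -
    obtain C :: "'n cmat set" where C: "onb p_space C" by (rule onb_exists[OF subspace_p_space])
    obtain C' :: "'n cmat set" where C': "onb sp_alg C'" by (rule onb_exists[OF subspace_sp_alg])
    have "C \<union> C' \<subseteq> u_star_alg"
      using onbD(2)[OF C] onbD(2)[OF C'] by (auto simp: p_space_iff sp_alg_def)
    then have "\<forall>E\<in>C \<union> C'. x ** E \<in> u_star_alg" using u_star_alg_left_translate[OF x] by blast
    moreover have "finite (C \<union> C')" using onbD(1)[OF C] onbD(1)[OF C'] by simp
    moreover have "\<forall>u\<in>u_star_alg. (\<Sum>E\<in>C \<union> C'. ((if E \<in> C then 1 else - 1) * g_U x u (x ** E)) *\<^sub>R (x ** E)) = u"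
      using U_star_frame_expand[OF C C' x] by blast
    ultimately show ?thesis
      by (intro exI[of _ "C \<union> C'"] exI[of _ "\<lambda>E. x ** E"] exI[of _ "\<lambda>E. if E \<in> C then 1 else - 1"] conjI)
  qed
qed

section \<open>Derivatives of \<open>Phi\<close> in the translated frame of the group\<close>

lemma dderiv_Phi: "dderiv Phi x v = x ** adj_mat v + v ** adj_mat x" for x v :: "'n::finite cmat"
proof -
  have adj: "((\<lambda>t::real. adj_mat (x + t *\<^sub>R v)) has_vector_derivative adj_mat v) (at 0)"
    by (auto intro!: derivative_eq_intros)
  have id: "((\<lambda>t::real. x + t *\<^sub>R v) has_vector_derivative v) (at 0)"
    by (auto intro!: derivative_eq_intros)
  show ?thesis
    unfolding dderiv_def Phi_def
    using bounded_bilinear.has_vector_derivative[OF bounded_bilinear_matrix_mult id adj]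
    by (intro vector_derivative_at) simp
qed

lemma dderiv2_Phi: "dderiv (\<lambda>x. dderiv Phi x v) x v = 2 *\<^sub>R (v ** adj_mat v)" for x v :: "'n::finite cmat"
proof -
  have "bounded_linear (\<lambda>x. x ** adj_mat v + v ** adj_mat x)"
    by (intro bounded_linear_add mm.bounded_linear_left
        bounded_linear_compose[OF mm.bounded_linear_right
          bounded_linear_adj_mat])
  then show ?thesis
    unfolding dderiv_Phi scaleR_2 by (rule U_chart.dderiv_bounded_linear_id)
qed

lemma Ck_on_Phi: "Ck_on k u_star_alg U_star (Phi :: 'n::finite cmat \<Rightarrow> 'n cmat)"
  unfolding Phi_def
  by (intro U_chart.Ck_on_matrix_mult U_chart.Ck_on_bounded_linear_id
      bounded_linear_ident bounded_linear_adj_mat)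

lemma Ck_on_Phi_entry: "Ck_on k u_star_alg U_star (\<lambda>x. Phi x $ i $ j :: complex)"
  by (rule U_chart.Ck_on_component[OF Ck_on_Phi])

lemma dderiv_Phi_entry:
  assumes "x \<in> U_star" "v \<in> u_star_alg"
  shows "dderiv (\<lambda>x. Phi x $ i $ j) x v = (x ** adj_mat v + v ** adj_mat x) $ i $ j"
    "dderiv (\<lambda>x. dderiv (\<lambda>x. Phi x $ i $ j) x v) x v = (2 *\<^sub>R (v ** adj_mat v)) $ i $ j"
proof -
  note P = U_chart.Ck_on_2D[OF Ck_on_Phi]
  have *: "dderiv (\<lambda>x. Phi x $ i $ j) x v = dderiv Phi x v $ i $ j" if "x \<in> U_star" for x
    by (rule U_chart.dderiv_bounded_linear[OF bounded_linear_entry P(1) that assms(2)])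
  show "dderiv (\<lambda>x. Phi x $ i $ j) x v = (x ** adj_mat v + v ** adj_mat x) $ i $ j"
    unfolding *[OF assms(1)] dderiv_Phi ..
  have "dderiv (\<lambda>x. dderiv (\<lambda>x. Phi x $ i $ j) x v) x v = dderiv (\<lambda>x. dderiv Phi x v $ i $ j) x v"
    by (rule U_chart.dderiv_cong[OF * assms])
  also have "\<dots> = dderiv (\<lambda>x. dderiv Phi x v) x v $ i $ j"
    by (rule U_chart.dderiv_bounded_linear[OF bounded_linear_entry P(2) assms]) (rule assms(2))
  finally show "dderiv (\<lambda>x. dderiv (\<lambda>x. Phi x $ i $ j) x v) x v = (2 *\<^sub>R (v ** adj_mat v)) $ i $ j"
    unfolding dderiv2_Phi .
qed

text \<open>The diagonal entry is the squared norm of row \<open>l\<close>, and an invertible matrix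
  has no zero row.\<close>

lemma Phi_diag_nonzero: assumes "invertible x" shows "Phi x $ l $ l \<noteq> 0"
proof
  assume "Phi x $ l $ l = 0"
  then have "(\<Sum>k\<in>UNIV. x $ l $ k * cnj (x $ l $ k)) = 0"
    by (simp add: Phi_def matrix_matrix_mult_def)
  then have "complex_of_real (\<Sum>k\<in>UNIV. (cmod (x $ l $ k))\<^sup>2) = 0"
    by (simp only: of_real_sum complex_norm_square)
  then have "(\<Sum>k\<in>UNIV. (cmod (x $ l $ k))\<^sup>2) = 0" by (simp only: of_real_eq_0_iff)
  then have "x $ l $ k = 0" for k by (simp add: sum_nonneg_eq_0_iff)
  then have "(x ** matrix_inv x) $ l $ l = 0" by (simp add: matrix_matrix_mult_def)
  then show False using matrix_inv_left_right(2)[OF assms] by (simp add: mat_def)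
qed

text \<open>With \<open>E' = adj E\<close>, direction \<open>E\<close> contributes
  \<open>E + E'\<close> to first order and \<open>2 E E' + E E + E' E'\<close> to second order,
  between \<open>x\<close> and its adjoint. Both vanish for skew-Hermitian \<open>E\<close>, in
  accordance with right invariance under \<open>Sp(n)\<close>; for Hermitian \<open>E\<close> they
  are \<open>2 E\<close> and \<open>4 E E\<close>. The constants are \<open>4 * (1/2)\<close> and
  \<open>4 * (n - 1/2)\<close>.\<close>

lemma Phi_frame_sums:
  fixes x :: "'n::finite cmat"
  assumes C: "onb p_space C" and C': "onb sp_alg C'" and x: "x \<in> U_star"
  defines "\<epsilon> \<equiv> \<lambda>E. if E \<in> C then 1 else - 1 :: real"
  shows "kappa_sum (C \<union> C') ((**) x) \<epsilon> (\<lambda>x. Phi x $ k $ l) (\<lambda>x. Phi x $ m $ l) x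
      = 2 * Phi x $ k $ l * Phi x $ m $ l" (is ?K)
    and "laplace_sum (C \<union> C') ((**) x) \<epsilon> (\<lambda>E. - (x ** (E ** E))) (\<lambda>x. Phi x $ k $ l) x
      = (4 * of_nat CARD('n) - 2) * Phi x $ k $ l" (is ?L)
proof -
  interpret kernel_sum C 0 using p_kernel[OF C] by unfold_locales simp
  have CU: "C \<subseteq> u_star_alg" "C' \<subseteq> u_star_alg"
    using onbD(2)[OF C] onbD(2)[OF C'] by (auto simp: p_space_iff sp_alg_def)
  have V: "x ** E \<in> u_star_alg" "- (x ** (E ** E)) \<in> u_star_alg" if "E \<in> C \<union> C'" for E
    using that x CU subspace_u_star_alg
    by (auto simp: U_star_iff intro!: u_star_alg_mult subspace_neg)
  have split: "(\<Sum>E\<in>C \<union> C'. f E) = (\<Sum>E\<in>C. f E) + (\<Sum>E\<in>C'. f E)" for f :: "'n cmat \<Rightarrow> complex"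
    by (rule sum.union_disjoint[OF onbD(1)[OF C] onbD(1)[OF C'] p_sp_disjoint[OF C C']])
  have adjC: "adj_mat E = E" "\<epsilon> E = 1" if "E \<in> C" for E
    using that onbD(2)[OF C] by (auto simp: p_space_iff \<epsilon>_def)
  have adjC': "adj_mat E = - E" "\<epsilon> E = - 1" if "E \<in> C'" for E
    using that onbD(2)[OF C'] p_sp_disjoint[OF C C'] by (auto simp: sp_alg_def \<epsilon>_def)
  have d1: "dderiv (\<lambda>x. Phi x $ k $ l) x (x ** E) = (x ** (E + adj_mat E) ** adj_mat x) $ k $ l"
    if "E \<in> C \<union> C'" for E k
    unfolding dderiv_Phi_entry(1)[OF x V(1)[OF that]]
    by (simp add: adj_mat_mult mm.add_left mm.add_right matrix_mul_assoc)
  have d2: "dderiv (\<lambda>z. dderiv (\<lambda>x. Phi x $ k $ l) z (x ** E)) x (x ** E)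
        - dderiv (\<lambda>x. Phi x $ k $ l) x (- (x ** (E ** E)))
      = (x ** (2 *\<^sub>R (E ** adj_mat E) + E ** E + adj_mat E ** adj_mat E) ** adj_mat x) $ k $ l"
    if "E \<in> C \<union> C'" for E k
    unfolding dderiv_Phi_entry(2)[OF x V(1)[OF that]] dderiv_Phi_entry(1)[OF x V(2)[OF that]]
    by (simp add: adj_mat_mult mm.add_left mm.add_right mm.minus_left mm.minus_right
        mm.scaleR_left mm.scaleR_right matrix_mul_assoc)
  have double: "(x ** (E + adj_mat E) ** adj_mat x) $ k $ l = 2 * (x ** E ** adj_mat x) $ k $ l" if "E \<in> C" for E k
    unfolding adjC(1)[OF that] scaleR_2[symmetric] mm.scaleR_left mm.scaleR_right by (simp add: scaleR_complex)
  have K0: "kappa_sum C' ((**) x) \<epsilon> (\<lambda>x. Phi x $ k $ l) (\<lambda>x. Phi x $ m $ l) x = 0"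
    by (intro sum.neutral ballI) (simp add: d1 adjC')
  have "kappa_sum C ((**) x) \<epsilon> (\<lambda>x. Phi x $ k $ l) (\<lambda>x. Phi x $ m $ l) x
      = (\<Sum>E\<in>C. 4 * ((x ** E ** adj_mat x) $ k $ l * (x ** E ** adj_mat x) $ m $ l))"
    using double by (intro sum.cong refl) (simp add: d1 adjC(2))
  also have "\<dots> = 2 * Phi x $ k $ l * Phi x $ m $ l"
    unfolding sum_distrib_left[symmetric] sum_sandwich by (simp add: Phi_def)
  finally show ?K unfolding split K0 by simp
  have L0: "laplace_sum C' ((**) x) \<epsilon> (\<lambda>E. - (x ** (E ** E))) (\<lambda>x. Phi x $ k $ l) x = 0"
    by (intro sum.neutral ballI) (simp add: d2 adjC' mm.minus_left mm.minus_right scaleR_2)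
  have "laplace_sum C ((**) x) \<epsilon> (\<lambda>E. - (x ** (E ** E))) (\<lambda>x. Phi x $ k $ l) x
      = (\<Sum>E\<in>C. 4 * (x ** (E ** E) ** adj_mat x) $ k $ l)"
  proof (rule sum.cong[OF refl])
    fix E assume E: "E \<in> C"
    have "2 *\<^sub>R (E ** adj_mat E) + E ** E + adj_mat E ** adj_mat E = 4 *\<^sub>R (E ** E)"
      unfolding adjC(1)[OF E] by (simp add: vec_eq_iff scaleR_complex)
    then show "of_real (\<epsilon> E) * (dderiv (\<lambda>z. dderiv (\<lambda>x. Phi x $ k $ l) z (x ** E)) x (x ** E)
        - dderiv (\<lambda>x. Phi x $ k $ l) x (- (x ** (E ** E)))) = 4 * (x ** (E ** E) ** adj_mat x) $ k $ l"
      using E by (simp add: d2 adjC(2) mm.scaleR_left mm.scaleR_right scaleR_complex)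
  qed
  also have "\<dots> = (4 * of_nat CARD('n) - 2) * Phi x $ k $ l"
    unfolding sum_distrib_left[symmetric] sum_sandwich_square by (simp add: Phi_def algebra_simps)
  finally show ?L unfolding split L0 by simp
qed

lemma U_star_is_frame:
  fixes x :: "'n::finite cmat"
  assumes C: "onb p_space C" and C': "onb sp_alg C'" and x: "x \<in> U_star"
  shows "U_metric.is_frame x (C \<union> C') ((**) x) (\<lambda>E. if E \<in> C then 1 else - 1)"
proof -
  have "C \<union> C' \<subseteq> u_star_alg"
    using onbD(2)[OF C] onbD(2)[OF C'] by (auto simp: p_space_iff sp_alg_def)
  then show ?thesis
    unfolding U_metric.is_frame_def
    using U_star_frame_expand[OF C C' x] onbD(1)[OF C] onbD(1)[OF C'] u_star_alg_left_translate[OF x] by auto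
qed

text \<open>For the inclusion \<open>P x = x\<close> the second derivative vanishes and
  \<open>P\<^sub>e P\<inverse> P\<^sub>e\<close> with \<open>e = x E\<close> is
  \<open>x E E\<close>.\<close>

lemma U_star_christoffel:
  fixes x :: "'n::finite cmat"
  assumes x: "x \<in> U_star" and E: "E \<in> u_star_alg" and w: "w \<in> u_star_alg"
  shows "g_U x (- (x ** (E ** E))) w
    = U_metric.Dg x (x ** E) (x ** E) w - U_metric.Dg x w (x ** E) (x ** E) / 2"
proof -
  have x': "x \<in> u_star_alg" "invertible x" using x by (auto simp: U_star_iff)
  have xE: "x ** E \<in> u_star_alg" using x' E by (intro u_star_alg_mult)
  have id: "dderiv (\<lambda>x. x) z v = v" for z v :: "'n cmat"
    by (rule U_chart.dderiv_bounded_linear_id[OF bounded_linear_ident])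
  have "- (x ** (E ** E)) = 0 - x ** E ** matrix_inv x ** (x ** E)"
    by (simp add: matrix_mul_assoc[symmetric], simp add: matrix_mul_assoc matrix_inv_left_right[OF x'(2)])
  then show ?thesis
    unfolding U_metric.koszul_eq[OF x xE w] id by (simp add: trace_form_def)
qed

section \<open>Evaluation in the global chart of the group\<close>

lemma param_at_U_star: "x \<in> U_star \<Longrightarrow> param_at U_star_manifold x = (U_star, \<lambda>x. x)"
  unfolding param_at_def U_star_manifold_def by (rule some_equality) auto

lemma coord_U_star: "x \<in> U_star \<Longrightarrow> coord U_star_manifold x = x"
  unfolding coord_def using param_at_U_star[of x] the_inv_into_f_f[of "\<lambda>x. x" U_star x]
  by (simp add: inj_on_def)

lemma U_star_orthogonal_harmonic: "orthogonal_harmonic_family U_star_manifold (family (l :: 'n::finite ix))"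
  unfolding orthogonal_harmonic_family_def
proof (intro conjI ballI)
  fix \<phi> :: "'n cmat \<Rightarrow> complex" assume "\<phi> \<in> family l"
  then obtain k where \<phi>: "\<phi> = (\<lambda>x. Phi x $ k $ l / Phi x $ l $ l)" by (auto simp: family_def)
  have nz: "\<And>x. x \<in> U_star \<Longrightarrow> Phi x $ l $ l \<noteq> 0" by (simp add: U_star_iff Phi_diag_nonzero)
  show "smooth_fun U_star_manifold \<phi>"
    unfolding smooth_fun_def U_star_manifold_def smooth_on_def \<phi>
    using U_chart.Ck_on_divide[OF Ck_on_Phi_entry Ck_on_Phi_entry nz] by (simp add: o_def)
  obtain C :: "'n cmat set" where C: "onb p_space C" by (rule onb_exists[OF subspace_p_space])
  obtain C' :: "'n cmat set" where C': "onb sp_alg C'" by (rule onb_exists[OF subspace_sp_alg])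
  have CU: "C \<union> C' \<subseteq> u_star_alg"
    using onbD(2)[OF C] onbD(2)[OF C'] by (auto simp: p_space_iff sp_alg_def)
  {
    fix x :: "'n cmat" assume "x \<in> points U_star_manifold"
    then have x: "x \<in> U_star" by (simp add: U_star_manifold_def)
    have "Complex (laplacian_in u_star_alg g_U (Re \<circ> \<phi>) x) (laplacian_in u_star_alg g_U (Im \<circ> \<phi>) x) = 0"
      unfolding \<phi>
    proof (rule U_metric.quotient_harmonic[OF refl Ck_on_Phi_entry Ck_on_Phi_entry nz x U_star_is_frame[OF C C' x]])
      show "- (x ** (E ** E)) \<in> u_star_alg" if "E \<in> C \<union> C'" for E
        using x that CU subspace_u_star_alg by (intro u_star_alg_mult subspace_neg) (auto simp: U_star_iff)
      show "g_U x (- (x ** (E ** E))) w = U_metric.Dg x (x ** E) (x ** E) w - U_metric.Dg x w (x ** E) (x ** E) / 2"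
        if "E \<in> C \<union> C'" "w \<in> u_star_alg" for E w
        using CU that by (intro U_star_christoffel x) auto
    qed (rule Phi_frame_sums[OF C C' x] | assumption)+
    then show "laplacian U_star_manifold \<phi> x = 0"
      unfolding laplacian_def real_laplacian_def coord_U_star[OF x] param_at_U_star[OF x]
      by (simp add: U_star_manifold_def o_def)
  }
  fix \<psi> and x :: "'n cmat" assume "\<psi> \<in> family l" "x \<in> points U_star_manifold"
  then obtain m where \<psi>: "\<psi> = (\<lambda>x. Phi x $ m $ l / Phi x $ l $ l)" and x: "x \<in> U_star"
    by (auto simp: family_def U_star_manifold_def)
  note fr = U_star_is_frame[OF C C' x]
  note diff = U_chart.Ck_on_2D(1)[OF U_chart.Ck_on_divide[OF Ck_on_Phi_entry Ck_on_Phi_entry nz]]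
  have "kappa U_star_manifold \<phi> \<psi> x = (let G = g_U x; a = grad_in u_star_alg g_U (Re \<circ> \<phi>) x; b = grad_in u_star_alg g_U (Im \<circ> \<phi>) x;
         c = grad_in u_star_alg g_U (Re \<circ> \<psi>) x; d = grad_in u_star_alg g_U (Im \<circ> \<psi>) x
     in Complex (G a c - G b d) (G a d + G b c))"
    unfolding kappa_def metric_at_def real_grad_def coord_U_star[OF x] param_at_U_star[OF x]
    by (simp add: U_star_manifold_def o_def)
  also have "\<dots> = kappa_sum (C \<union> C') ((**) x) (\<lambda>E. if E \<in> C then 1 else - 1) \<phi> \<psi> x"
    unfolding \<phi> \<psi> by (rule U_metric.grad_in_product_complex[OF diff diff x fr])
  also have "\<dots> = 0"
    unfolding \<phi> \<psi>
    by (rule U_metric.quotient_kappa[OF refl refl _ _ _ _ x fr])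
      (rule U_chart.Ck_on_2D(1)[OF Ck_on_Phi_entry] Phi_frame_sums(1)[OF C C' x] | rule nz, assumption)+
  finally show "kappa U_star_manifold \<phi> \<psi> x = 0" .
qed

section \<open>Jacobi's formula\<close>

lemma det_has_vector_derivative_at_one:
  fixes f :: "real \<Rightarrow> complex ^ 'm::finite ^ 'm"
  assumes f: "(f has_vector_derivative f') (at 0)" and f0: "f 0 = mat 1"
  shows "((\<lambda>t. det (f t)) has_vector_derivative trace f') (at 0)"
proof -
  let ?S = "{p. p permutes (UNIV :: 'm set)}"
  let ?d = "\<lambda>p. \<Sum>i\<in>UNIV. f' $ i $ p i * (\<Prod>j\<in>UNIV - {i}. f 0 $ j $ p j)"
  have entry: "((\<lambda>t. f t $ i $ j) has_derivative (\<lambda>h. h *\<^sub>R (f' $ i $ j))) (at 0)" for i j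
    using bounded_linear.has_derivative[OF bounded_linear_compose[OF bounded_linear_vec_nth bounded_linear_vec_nth]
        f[unfolded has_vector_derivative_def], of i j] by simp
  have "((\<lambda>t. \<Prod>i\<in>UNIV. f t $ i $ p i) has_derivative
      (\<lambda>h. \<Sum>i\<in>UNIV. (h *\<^sub>R (f' $ i $ p i)) * (\<Prod>j\<in>UNIV - {i}. f 0 $ j $ p j))) (at 0)" for p
    by (rule has_derivative_prod) (rule entry)
  moreover have "(\<lambda>h. \<Sum>i\<in>UNIV. (h *\<^sub>R (f' $ i $ p i)) * (\<Prod>j\<in>UNIV - {i}. f 0 $ j $ p j)) = (\<lambda>h. h *\<^sub>R ?d p)" for p
    by (simp add: scaleR_sum_right)
  ultimately have prod: "((\<lambda>t. \<Prod>i\<in>UNIV. f t $ i $ p i) has_vector_derivative ?d p) (at 0)" for p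
    by (simp add: has_vector_derivative_def)
  have "((\<lambda>t. det (f t)) has_vector_derivative (\<Sum>p\<in>?S. of_int (sign p) * ?d p)) (at 0)"
    unfolding det_def by (intro has_vector_derivative_sum has_vector_derivative_mult_right prod)
  also have "(\<Sum>p\<in>?S. of_int (sign p) * ?d p) = (\<Sum>p\<in>?S. if p = id then trace f' else 0)"
  proof (rule sum.cong[OF refl])
    fix p assume "p \<in> ?S"
    then have p: "p permutes UNIV" by simp
    show "of_int (sign p) * ?d p = (if p = id then trace f' else 0)"
    proof (cases "p = id")
      case True
      then show ?thesis by (simp add: f0 mat_def trace_def sign_id)
    next
      case False
      then obtain k where k: "p k \<noteq> k" by (auto simp: fun_eq_iff)
      \<comment> \<open>A nontrivial permutation moves at least the two indices \<open>k\<close> and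
        \<open>p k\<close>. Whichever single factor the product rule differentiates, another
        off-diagonal entry of the identity matrix remains and makes the product zero.\<close>
      then have k2: "p (p k) \<noteq> p k" using permutes_inj[OF p] by (auto dest: injD)
      have z: "(\<Prod>j\<in>UNIV - {i}. f 0 $ j $ p j) = 0" for i
      proof -
        obtain j where "j \<noteq> i" "p j \<noteq> j" using k k2 by metis
        then show ?thesis
          by (intro prod_zero) (auto simp: f0 mat_def intro!: bexI[of _ j])
      qed
      have "?d p = 0" by (intro sum.neutral ballI) (simp only: z mult_zero_right)
      then show ?thesis using False by simp
    qed
  qed
  also have "\<dots> = trace f'"
    by (simp add: permutes_id)
  finally show ?thesis .
qed

context chart_domain
begin

text \<open>Multiplying by the inverse of \<open>A y\<close> moves the base point to the identity
  matrix, where the derivative of the determinant is the trace. It is applied to lifts, which have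
  determinant 1, and makes their logarithmic derivatives traceless.\<close>

lemma trace_log_derivative_zero:
  fixes A :: "'e \<Rightarrow> complex ^ 'm::finite ^ 'm"
  assumes A: "A differentiable_on D" and det: "\<And>z. z \<in> D \<Longrightarrow> det (A z) = c"
    and y: "y \<in> D" and v: "v \<in> V" and inv: "invertible (A y)"
  shows "trace (matrix_inv (A y) ** dderiv A y v) = 0"
proof -
  let ?M = "\<lambda>t. matrix_inv (A y) ** A (y + t *\<^sub>R v)"
  have "(?M has_vector_derivative matrix_inv (A y) ** dderiv A y v) (at 0)"
    by (rule bounded_linear.has_vector_derivative[OF
          mm.bounded_linear_right dderiv_line[OF A y v]])
  then have 1: "((\<lambda>t. det (?M t)) has_vector_derivative trace (matrix_inv (A y) ** dderiv A y v)) (at 0)"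
    by (rule det_has_vector_derivative_at_one) (simp add: matrix_inv_left_right[OF inv])
  have ev: "eventually (\<lambda>t. det (?M t) = det (matrix_inv (A y)) * c) (nhds 0)"
    by (rule eventually_mono[OF eventually_line[OF y v]]) (simp add: det_mul det)
  have "((\<lambda>t. det (?M t)) has_vector_derivative 0) (at 0)
      \<longleftrightarrow> ((\<lambda>t. det (matrix_inv (A y)) * c) has_vector_derivative 0) (at 0)"
    by (rule has_vector_derivative_cong_ev)
      (use ev eventually_nhds_x_imp_x[OF ev] in \<open>auto elim: eventually_mono\<close>)
  then have "((\<lambda>t. det (?M t)) has_vector_derivative 0) (at 0)"
    by simp
  with 1 show ?thesis by (rule vector_derivative_unique_at)
qed

text \<open>The orthogonal projection onto \<open>W\<close> is bounded linear and fixes every value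
  of \<open>f\<close>, hence also its derivative.\<close>

lemma dderiv_in_subspace:
  fixes f :: "'e \<Rightarrow> 'b::euclidean_space"
  assumes W: "subspace W" and f: "f differentiable_on D" "\<And>z. z \<in> D \<Longrightarrow> f z \<in> W"
    and y: "y \<in> D" and v: "v \<in> V"
  shows "dderiv f y v \<in> W"
proof -
  obtain C where C: "onb W C" by (rule onb_exists[OF W])
  let ?\<pi> = "\<lambda>x. \<Sum>E\<in>C. (x \<bullet> E) *\<^sub>R E"
  have "bounded_linear ?\<pi>"
    by (intro bounded_linear_sum bounded_linear_compose[OF bounded_linear_scaleR_left bounded_linear_inner_left])
  note L = dderiv_bounded_linear[OF this f(1) y v]
  have "dderiv f y v = dderiv (\<lambda>z. ?\<pi> (f z)) y v"
    by (rule dderiv_cong[OF _ y v], rule onb_project[OF C f(2), symmetric]) simp_all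
  also have "\<dots> = ?\<pi> (dderiv f y v)" by (rule L)
  also have "\<dots> \<in> W"
    using onbD(2)[OF C] W by (intro subspace_sum subspace_scale)
  finally show ?thesis .
qed

end

section \<open>Lifts of parametrizations of \<open>SU\<^sup>*(2n)/Sp(n)\<close>\<close>

lemma one_in_Sp: "mat 1 \<in> Sp_group"
  by (simp add: Sp_group_def SU_star_def SU_group_def)

lemma self_in_Sp_coset: "x \<in> Sp_coset x"
  unfolding Sp_coset_def by (rule image_eqI[OF _ one_in_Sp]) simp

lemma Phi_Sp: "k \<in> Sp_group \<Longrightarrow> Phi (x ** k) = Phi x"
proof -
  assume "k \<in> Sp_group"
  then have "k ** adj_mat k = mat 1" by (simp add: Sp_group_def SU_group_def)
  moreover have "Phi (x ** k) = x ** (k ** adj_mat k) ** adj_mat x"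
    by (simp add: Phi_def adj_mat_mult matrix_mul_assoc)
  ultimately show ?thesis by (simp add: Phi_def)
qed

lemma Phi_coset: "x \<in> Sp_coset z \<Longrightarrow> Phi x = Phi z"
  by (auto simp: Sp_coset_def Phi_Sp)

lemma SU_star_subset: "x \<in> SU_star \<Longrightarrow> x \<in> U_star"
  by (simp add: SU_star_def U_star_def invertible_det_nz)

lemma Phi_in_p: "x \<in> U_star \<Longrightarrow> Phi x \<in> p_space"
  by (auto simp: Phi_def p_space_iff U_star_iff adj_mat_mult intro: u_star_alg_mult u_star_alg_adj)

lemma Phi_invertible: "x \<in> U_star \<Longrightarrow> invertible (Phi x)"
  by (simp add: Phi_def U_star_iff invertible_mult adj_mat_inverse)

lemma Phi_inv: "x \<in> U_star \<Longrightarrow> matrix_inv (Phi x) = adj_mat (matrix_inv x) ** matrix_inv x"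
proof (rule matrix_inv_unique)
  assume "x \<in> U_star"
  then have inv: "x ** matrix_inv x = mat 1" by (simp add: U_star_iff matrix_inv_left_right)
  have "Phi x ** (adj_mat (matrix_inv x) ** matrix_inv x) = x ** adj_mat (matrix_inv x ** x) ** matrix_inv x"
    by (simp add: Phi_def adj_mat_mult matrix_mul_assoc)
  also have "matrix_inv x ** x = mat 1" using \<open>x \<in> U_star\<close> by (simp add: U_star_iff matrix_inv_left_right)
  finally show "Phi x ** (adj_mat (matrix_inv x) ** matrix_inv x) = mat 1" by (simp add: inv)
qed

lemma induced_eq:
  assumes "f \<in> family l"
  shows "induced f (Sp_coset x) = f x"
  unfolding induced_def
proof (rule the_equality)
  show "\<forall>y\<in>Sp_coset x. f y = f x"
  proof
    fix y assume "y \<in> Sp_coset x"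
    then have "Phi y = Phi x" by (rule Phi_coset)
    then show "f y = f x" using assms by (auto simp: family_def)
  qed
  then show "c = f x" if "\<forall>y\<in>Sp_coset x. f y = c" for c
    using that self_in_Sp_coset by fastforce
qed

text \<open>Kept apart from the immersion condition because that condition has to be transferred
  from one lift to another, and the transfer uses the facts below for both lifts.\<close>

locale smooth_lift_chart = chart_domain p0_space D for D :: "'n::finite cmat set" +
  fixes \<sigma> :: "'n cmat \<Rightarrow> 'n cmat set" and s :: "'n cmat \<Rightarrow> 'n cmat"
  assumes lift: "smooth_lift D \<sigma> s" and range: "\<sigma> ` D \<subseteq> SU_star_mod_Sp"
begin

abbreviation L :: "'n cmat \<Rightarrow> 'n cmat \<Rightarrow> 'n cmat" where "L \<equiv> lift_diff s"

lemma s_Ck: "Ck_on k p0_space D s"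
  using lift by (simp add: smooth_lift_def smooth_on_def)

lemma s_U: "y \<in> D \<Longrightarrow> s y \<in> U_star" and \<sigma>_eq: "y \<in> D \<Longrightarrow> \<sigma> y = Sp_coset (s y)"
  using lift by (auto simp: smooth_lift_def)

lemma s_inv: "y \<in> D \<Longrightarrow> invertible (s y)"
  using s_U by (simp add: U_star_iff)

text \<open>A lift is only asked to take values in \<open>U_star\<close>; determinant 1 is forced
  because its coset has a representative in \<open>SU_star\<close> and elements of
  \<open>Sp_group\<close> have determinant 1.\<close>

lemma s_det: assumes "y \<in> D" shows "det (s y) = 1"
proof -
  obtain z where z: "z \<in> SU_star" "Sp_coset (s y) = Sp_coset z"
    using range \<sigma>_eq[OF assms] assms by (auto simp: SU_star_mod_Sp_def)
  then obtain k where "k \<in> Sp_group" "s y = z ** k"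
    using self_in_Sp_coset[of "s y"] by (auto simp: Sp_coset_def)
  then show ?thesis
    using z(1) by (simp add: det_mul SU_star_def Sp_group_def)
qed

lemma s_diff: "s differentiable_on D"
  using s_Ck[of 1] by simp

lemma L_p0:
  assumes y: "y \<in> D" and v: "v \<in> p0_space"
  shows "L y v \<in> p0_space"
proof -
  have "dderiv s y v \<in> u_star_alg"
    using s_U by (intro dderiv_in_subspace subspace_u_star_alg s_diff y v) (simp add: U_star_iff)
  moreover have "matrix_inv (s y) \<in> u_star_alg"
    using s_U[OF y] U_star_closed(2) by (auto simp: U_star_iff)
  ultimately have p: "L y v \<in> p_space"
    unfolding lift_diff_def by (intro p_part_p_space u_star_alg_mult)
  have "trace (matrix_inv (s y) ** dderiv s y v) = 0"
    by (rule trace_log_derivative_zero[OF s_diff s_det y v s_inv[OF y]])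
  then have "trace (L y v) = 0"
    by (simp add: lift_diff_def p_part_def trace_scaleR trace_add trace_adj_mat)
  with p show ?thesis by (simp add: p0_space_iff p_space_iff)
qed

abbreviation P :: "'n cmat \<Rightarrow> 'n cmat" where "P y \<equiv> Phi (s y)"

lemma P_Ck: "Ck_on k p0_space D P"
  unfolding Phi_def
  by (rule Ck_on_matrix_mult[OF s_Ck Ck_on_bounded_linear[OF bounded_linear_adj_mat s_Ck]])

lemma P_diff: "P differentiable_on D"
  using P_Ck[of 1] by simp

lemma dderiv_P:
  assumes y: "y \<in> D" and v: "v \<in> p0_space"
  shows "dderiv P y v = 2 *\<^sub>R (s y ** L y v ** adj_mat (s y))"
proof -
  note inv = matrix_inv_left_right[OF s_inv[OF y]]
  have adj: "(\<lambda>z. adj_mat (s z)) differentiable_on D"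
    using Ck_on_bounded_linear[OF bounded_linear_adj_mat s_Ck, of 1] by simp
  have "dderiv P y v = s y ** adj_mat (dderiv s y v) + dderiv s y v ** adj_mat (s y)"
    unfolding Phi_def dderiv_matrix_mult[OF s_diff adj y v]
      dderiv_bounded_linear[OF bounded_linear_adj_mat s_diff y v] ..
  moreover have "adj_mat (matrix_inv (s y)) ** adj_mat (s y) = mat 1"
    by (simp add: adj_mat_mult[symmetric] inv)
  moreover have "2 *\<^sub>R (s y ** L y v ** adj_mat (s y)) =
      (s y ** matrix_inv (s y)) ** dderiv s y v ** adj_mat (s y)
      + s y ** adj_mat (dderiv s y v) ** (adj_mat (matrix_inv (s y)) ** adj_mat (s y))"
    by (simp add: lift_diff_def p_part_def adj_mat_mult mm.scaleR_left mm.scaleR_right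
        mm.add_left mm.add_right matrix_mul_assoc)
  ultimately show ?thesis by (simp add: inv)
qed

text \<open>Since \<open>s y\<close> enters here only as a constant invertible factor,
  \<open>L y\<close> inherits linearity from the derivative of \<open>P\<close>, and its kernel is
  that of the derivative of \<open>P\<close>, which is the same for all lifts.\<close>

lemma L_conv_P:
  assumes y: "y \<in> D" and v: "v \<in> p0_space"
  shows "L y v = (1/2) *\<^sub>R (matrix_inv (s y) ** dderiv P y v ** adj_mat (matrix_inv (s y)))"
proof -
  note inv = matrix_inv_left_right[OF s_inv[OF y]]
  have "adj_mat (s y) ** adj_mat (matrix_inv (s y)) = mat 1"
    by (simp add: adj_mat_mult[symmetric] inv)
  then have "matrix_inv (s y) ** (s y ** L y v ** adj_mat (s y)) ** adj_mat (matrix_inv (s y)) = L y v"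
    by (metis (no_types, lifting) inv(1) matrix_mul_assoc matrix_mul_lid matrix_mul_rid)
  then show ?thesis
    unfolding dderiv_P[OF y v] by (simp add: mm.scaleR_left mm.scaleR_right)
qed

end

locale immersed_chart = smooth_lift_chart D \<sigma> s
  for D :: "'n::finite cmat set" and \<sigma> s +
  assumes immersion: "y \<in> D \<Longrightarrow> v \<in> p0_space \<Longrightarrow> lift_diff s y v = 0 \<Longrightarrow> v = 0"
begin

text \<open>The immersion condition makes an endomorphism of \<open>p0_space\<close> injective, and
  equality of dimensions makes it onto. The map \<open>L'\<close> extends \<open>L y\<close>
  linearly to all matrices, so that dimension theory applies.\<close>

lemma L_bij:
  assumes y: "y \<in> D"
  obtains L' where "linear L'" "\<And>v. v \<in> p0_space \<Longrightarrow> L y v = L' v" "bij_betw L' p0_space p0_space"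
proof -
  obtain f' where f': "linear f'" "\<And>v. v \<in> p0_space \<Longrightarrow> dderiv P y v = f' v"
    using dderiv_linear[OF P_diff y] by blast
  define L' where "L' v = (1/2) *\<^sub>R (matrix_inv (s y) ** f' v ** adj_mat (matrix_inv (s y)))" for v
  have lin: "linear L'"
    using f'(1) by (intro linearI)
      (simp_all add: L'_def linear_add linear_scale mm.add_left mm.add_right mm.scaleR_left mm.scaleR_right scaleR_add_right)
  have LL: "L y v = L' v" if "v \<in> p0_space" for v
    unfolding L'_def L_conv_P[OF y that] f'(2)[OF that] ..
  have inj: "inj_on L' p0_space"
  proof (rule inj_onI)
    fix u v assume uv: "u \<in> (p0_space :: 'n cmat set)" "v \<in> p0_space" "L' u = L' v"
    have "u - v \<in> p0_space" by (rule subspace_diff[OF subspace_p0_space uv(1,2)])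
    moreover from LL[OF this] have "L y (u - v) = 0" using lin uv(3) by (simp add: linear_diff)
    ultimately have "u - v = 0" by (rule immersion[OF y])
    then show "u = v" by simp
  qed
  have sub: "L' ` p0_space \<subseteq> p0_space" using L_p0[OF y] LL by auto
  have "dim (L' ` p0_space) = dim (p0_space :: 'n cmat set)"
    by (rule dim_image_eq[OF lin]) (simp only: span_eq_iff[THEN iffD2, OF subspace_p0_space] inj)
  then have "L' ` p0_space = p0_space"
    using subspace_dim_equal[OF linear_subspace_image[OF lin subspace_p0_space] subspace_p0_space sub] by simp
  then show thesis using that[OF lin LL] inj by (simp add: bij_betw_def)
qed

abbreviation g :: "'n cmat \<Rightarrow> 'n cmat \<Rightarrow> 'n cmat \<Rightarrow> real" where
  "g y v w \<equiv> trace_form (L y v) (L y w)"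

text \<open>The metric is the pull-back of \<open>trace_form\<close> along \<open>L y\<close>, so
  preimages of an orthonormal basis of \<open>p0_space\<close> form a frame at \<open>y\<close>; all
  signs are 1 since the form is positive definite there.\<close>

definition frame_vec :: "'n cmat \<Rightarrow> 'n cmat \<Rightarrow> 'n cmat" where
  "frame_vec y E = (THE v. v \<in> p0_space \<and> L y v = E)"

lemma frame_vec:
  assumes y: "y \<in> D" and E: "E \<in> p0_space"
  shows "frame_vec y E \<in> p0_space" "L y (frame_vec y E) = E"
proof -
  obtain L' where L': "linear L'" "\<And>v. v \<in> p0_space \<Longrightarrow> L y v = L' v" "bij_betw L' p0_space p0_space"
    by (rule L_bij[OF y]) (assumption | rule that)+
  have "\<exists>!v. v \<in> p0_space \<and> L y v = E"
    using L'(2) bij_betwE[OF L'(3)] E L'(3) unfolding bij_betw_def inj_on_def image_iff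
    by (metis (no_types, lifting) image_iff)
  from theI'[OF this] show "frame_vec y E \<in> p0_space" "L y (frame_vec y E) = E"
    unfolding frame_vec_def by blast+
qed

lemma frame_expand:
  assumes y: "y \<in> D" and C: "onb p0_space C" and u: "u \<in> p0_space"
  shows "(\<Sum>E\<in>C. (1 * g y u (frame_vec y E)) *\<^sub>R frame_vec y E) = u"
proof -
  obtain L' where L': "linear L'" "\<And>v. v \<in> p0_space \<Longrightarrow> L y v = L' v" "bij_betw L' p0_space p0_space"
    by (rule L_bij[OF y]) (assumption | rule that)+
  let ?w = "\<Sum>E\<in>C. (1 * g y u (frame_vec y E)) *\<^sub>R frame_vec y E"
  have CV: "E \<in> C \<Longrightarrow> E \<in> p0_space" for E by (rule onbD(2)[OF C])
  have w: "?w \<in> p0_space"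
    using CV frame_vec(1)[OF y] subspace_p0_space by (intro subspace_sum subspace_scale) auto
  have "L' ?w = (\<Sum>E\<in>C. (L y u \<bullet> E) *\<^sub>R E)"
    unfolding linear_sum[OF L'(1)]
  proof (rule sum.cong[OF refl])
    fix E assume "E \<in> C"
    then have E: "E \<in> p0_space" by (rule CV)
    show "L' ((1 * g y u (frame_vec y E)) *\<^sub>R frame_vec y E) = (L y u \<bullet> E) *\<^sub>R E"
      using E frame_vec[OF y E] L'(2)[OF frame_vec(1)[OF y E]] trace_form_p[of E]
      by (simp add: linear_scale[OF L'(1)] p0_space_iff)
  qed
  also have "\<dots> = L y u" by (rule onb_project[OF C L_p0[OF y u]]) simp
  finally have "L' ?w = L' u" using L'(2)[OF u] by simp
  then show ?thesis
    using L'(3) w u unfolding bij_betw_def inj_on_def by blast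
qed

sublocale trace_chart p0_space D P "1/4" g
proof unfold_locales
  show "Ck_on 2 p0_space D P" by (rule P_Ck)
  show "invertible (P y)" if "y \<in> D" for y by (rule Phi_invertible[OF s_U[OF that]])
  show "g y u w = 1/4 * Re (trace (matrix_inv (P y) ** dderiv P y u ** (matrix_inv (P y) ** dderiv P y w)))"
    if y: "y \<in> D" and u: "u \<in> p0_space" and w: "w \<in> p0_space" for y u w
  proof -
    let ?T = "adj_mat (matrix_inv (s y))"
    note inv = matrix_inv_left_right[OF s_inv[OF y]]
    have T: "adj_mat (s y) ** ?T = mat 1" by (simp add: adj_mat_mult[symmetric] inv)
    have QP: "matrix_inv (P y) ** dderiv P y u = 2 *\<^sub>R (?T ** L y u ** adj_mat (s y))"
      if "u \<in> p0_space" for u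
    proof -
      have "matrix_inv (P y) ** dderiv P y u = 2 *\<^sub>R (?T ** (matrix_inv (s y) ** s y) ** L y u ** adj_mat (s y))"
        unfolding dderiv_P[OF y that] Phi_inv[OF s_U[OF y]] by (simp add: mm.scaleR_right matrix_mul_assoc)
      then show ?thesis by (simp add: inv)
    qed
    \<comment> \<open>The factors 2 of the two derivatives give 4. The inner pair of translation
      factors cancels here, the outer pair below by cyclicity of the trace.\<close>
    have "matrix_inv (P y) ** dderiv P y u ** (matrix_inv (P y) ** dderiv P y w)
        = 4 *\<^sub>R (?T ** L y u ** (adj_mat (s y) ** ?T) ** L y w ** adj_mat (s y))"
      unfolding QP[OF u] QP[OF w] by (simp only: mm.scaleR_left mm.scaleR_right matrix_mul_assoc scaleR_scaleR) simp
    also have "\<dots> = 4 *\<^sub>R (?T ** (L y u ** L y w ** adj_mat (s y)))"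
      unfolding T by (simp add: matrix_mul_assoc)
    finally have 1: "matrix_inv (P y) ** dderiv P y u ** (matrix_inv (P y) ** dderiv P y w)
        = 4 *\<^sub>R (?T ** (L y u ** L y w ** adj_mat (s y)))" .
    have "trace (?T ** (L y u ** L y w ** adj_mat (s y))) = trace (L y u ** L y w ** adj_mat (s y) ** ?T)"
      by (rule trace_mul_sym)
    also have "L y u ** L y w ** adj_mat (s y) ** ?T = L y u ** L y w ** (adj_mat (s y) ** ?T)"
      by (simp only: matrix_mul_assoc)
    finally have "Re (trace (matrix_inv (P y) ** dderiv P y u ** (matrix_inv (P y) ** dderiv P y w)))
        = 4 * Re (trace (L y u ** L y w ** (adj_mat (s y) ** ?T)))"
      unfolding 1 trace_scaleR by simp
    then show ?thesis unfolding T by (simp add: trace_form_def)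
  qed
  show "\<exists>(B :: 'n cmat set) e \<epsilon>. finite B \<and> (\<forall>E\<in>B. e E \<in> p0_space) \<and>
      (\<forall>u\<in>p0_space. (\<Sum>E\<in>B. (\<epsilon> E * g y u (e E)) *\<^sub>R e E) = u)" if y: "y \<in> D" for y
  proof -
    obtain C :: "'n cmat set" where C: "onb p0_space C" by (rule onb_exists[OF subspace_p0_space])
    have "\<forall>E\<in>C. frame_vec y E \<in> p0_space" using onbD(2)[OF C] frame_vec(1)[OF y] by blast
    moreover have "finite C" by (rule onbD(1)[OF C])
    moreover have "\<forall>u\<in>p0_space. (\<Sum>E\<in>C. (1 * g y u (frame_vec y E)) *\<^sub>R frame_vec y E) = u"
      using frame_expand[OF y C] by blast
    ultimately show ?thesis
      by (intro exI[of _ C] exI[of _ "frame_vec y"] exI[of _ "\<lambda>_. 1 :: real"] conjI)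
  qed
qed

end

lemma p_space_sandwich: "A \<in> u_star_alg \<Longrightarrow> X \<in> p_space \<Longrightarrow> A ** X ** adj_mat A \<in> p_space"
  by (auto simp: p_space_iff adj_mat_mult matrix_mul_assoc intro!: u_star_alg_mult u_star_alg_adj)

context immersed_chart
begin

text \<open>
  The Koszul formula tests only against the directions \<open>s Y s\<^sup>*\<close> with \<open>Y\<close> in \<open>p0_space\<close>, whose
  orthogonal complement in \<open>p_space\<close> is spanned by \<open>mat 1\<close>. The multiple \<open>r\<close> of \<open>P y\<close> comes from there.
\<close>

lemma second_derivative_P:
  assumes y: "y \<in> D" and E: "E \<in> p0_space"
  defines "e \<equiv> frame_vec y E" and "Z \<equiv> christoffel p0_space g y (frame_vec y E) (frame_vec y E)"
  shows "\<exists>r. dderiv (\<lambda>z. dderiv P z e) y e - dderiv P y Z = 4 *\<^sub>R (s y ** (E ** E) ** adj_mat (s y)) + r *\<^sub>R P y"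
proof -
  let ?S = "s y" and ?I = "matrix_inv (s y)" and ?T = "adj_mat (matrix_inv (s y))"
  note inv = matrix_inv_left_right[OF s_inv[OF y]]
  have T: "adj_mat ?S ** ?T = mat 1" "?T ** adj_mat ?S = mat 1"
    by (simp_all add: adj_mat_mult[symmetric] inv)
  note Q = Phi_inv[OF s_U[OF y]]
  have e: "e \<in> p0_space" "L y e = E" unfolding e_def using frame_vec[OF y E] by auto
  have Z: "Z \<in> p0_space"
    unfolding Z_def e_def[symmetric] by (rule christoffel_props(1)[OF y e(1) e(1)])
  have Pe: "dderiv P y e = 2 *\<^sub>R (?S ** E ** adj_mat ?S)"
    using dderiv_P[OF y e(1)] e(2) by simp
  have PQP: "dderiv P y e ** Q y ** dderiv P y e = 4 *\<^sub>R (?S ** (E ** E) ** adj_mat ?S)"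
  proof -
    have "dderiv P y e ** Q y ** dderiv P y e
        = 4 *\<^sub>R (?S ** E ** (adj_mat ?S ** ?T) ** (?I ** ?S) ** E ** adj_mat ?S)"
      unfolding Pe Q by (simp only: mm.scaleR_left mm.scaleR_right matrix_mul_assoc scaleR_scaleR) simp
    then show ?thesis by (simp add: T inv matrix_mul_assoc)
  qed
  \<comment> \<open>\<open>M\<close> measures the failure of the derivative along \<open>Z\<close>
    to equal the representing matrix of the Christoffel vector. \<open>N\<close> is its translate to
    the base point, and the Koszul formula says that \<open>N\<close> is orthogonal to
    \<open>p0_space\<close>.\<close>
  define M where "M = dderiv (\<lambda>z. dderiv P z e) y e - dderiv P y e ** Q y ** dderiv P y e - dderiv P y Z"
  define N where "N = ?I ** M ** ?T"
  have P_p: "P z \<in> p_space" if "z \<in> D" for z by (rule Phi_in_p[OF s_U[OF that]])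
  have dP_p: "dderiv P z v \<in> p_space" if "z \<in> D" "v \<in> p0_space" for z v
    by (rule dderiv_in_subspace[OF subspace_p_space P_diff P_p that])
  have ddP_p: "dderiv (\<lambda>z. dderiv P z e) y e \<in> p_space"
    by (rule dderiv_in_subspace[OF subspace_p_space P2_diff[OF e(1)] dP_p[OF _ e(1)] y e(1)])
  have EE: "E ** E \<in> p_space"
    using E by (auto simp: p0_space_iff p_space_iff adj_mat_mult intro: u_star_alg_mult)
  have S: "?S \<in> u_star_alg" "?I \<in> u_star_alg"
    using s_U[OF y] U_star_closed(2)[OF s_U[OF y]] by (auto simp: U_star_iff)
  have "M \<in> p_space"
    unfolding M_def PQP
    by (intro subspace_diff[OF subspace_p_space] ddP_p dP_p y Z subspace_scale[OF subspace_p_space]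
        p_space_sandwich S EE)
  then have N_p: "N \<in> p_space"
    unfolding N_def by (rule p_space_sandwich[OF S(2)])
  have "N \<bullet> Y = 0" if Y: "Y \<in> p0_space" for Y
  proof -
    define x where "x = frame_vec y Y"
    have x: "x \<in> p0_space" "L y x = Y" unfolding x_def using frame_vec[OF y Y] by auto
    have QP: "Q y ** dderiv P y x = 2 *\<^sub>R (?T ** Y ** adj_mat ?S)"
    proof -
      have "Q y ** dderiv P y x = 2 *\<^sub>R (?T ** (?I ** ?S) ** Y ** adj_mat ?S)"
        unfolding Q dderiv_P[OF y x(1)] x(2) by (simp add: mm.scaleR_right matrix_mul_assoc)
      then show ?thesis by (simp add: inv)
    qed
    have "g y Z x = Dg y e e x - Dg y x e e / 2"
      using christoffel_props(2)[OF y e(1) e(1) x(1)] unfolding Z_def e_def by simp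
    then have "Re (trace (Q y ** dderiv P y Z ** (Q y ** dderiv P y x))) =
      Re (trace (Q y ** (dderiv (\<lambda>z. dderiv P z e) y e - dderiv P y e ** Q y ** dderiv P y e)
        ** (Q y ** dderiv P y x)))"
      using g_eq[OF y Z x(1)] koszul_eq[OF y e(1) x(1)] by simp
    then have "Re (trace (Q y ** M ** (Q y ** dderiv P y x))) = 0"
      unfolding M_def by (simp add: mm.diff_left mm.diff_right Re_trace_simps)
    moreover have "trace (Q y ** M ** (Q y ** dderiv P y x)) = 2 *\<^sub>R trace (N ** Y)"
    proof -
      have "trace (Q y ** M ** (Q y ** dderiv P y x)) = 2 *\<^sub>R trace (?T ** (N ** Y ** adj_mat ?S))"
        unfolding QP N_def unfolding Q
        by (simp only: mm.scaleR_right matrix_mul_assoc trace_scaleR)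
      also have "trace (?T ** (N ** Y ** adj_mat ?S)) = trace (N ** Y ** adj_mat ?S ** ?T)"
        by (rule trace_mul_sym)
      also have "N ** Y ** adj_mat ?S ** ?T = N ** Y ** (adj_mat ?S ** ?T)"
        by (simp only: matrix_mul_assoc)
      finally show ?thesis by (simp add: T)
    qed
    ultimately have "Re (trace (N ** Y)) = 0" by simp
    then show "N \<bullet> Y = 0" using Y by (simp add: inner_cmat p0_space_iff)
  qed
  then obtain r where r: "N = r *\<^sub>R mat 1" by (rule p0_onb_eqD[OF N_p])
  have "?S ** N ** adj_mat ?S = (?S ** ?I) ** M ** (?T ** adj_mat ?S)"
    unfolding N_def by (simp only: matrix_mul_assoc)
  then have "M = r *\<^sub>R P y"
    unfolding r by (simp add: inv T mm.scaleR_left mm.scaleR_right Phi_def)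
  then have "dderiv (\<lambda>z. dderiv P z e) y e - dderiv P y Z = 4 *\<^sub>R (?S ** (E ** E) ** adj_mat ?S) + r *\<^sub>R P y"
    unfolding M_def PQP by (simp add: algebra_simps)
  then show ?thesis ..
qed

lemma P_entry_Ck: "Ck_on k p0_space D (\<lambda>y. P y $ i $ j)"
  by (rule Ck_on_component[OF P_Ck])

lemma dderiv_P_entry:
  assumes "y \<in> D" "v \<in> p0_space"
  shows "dderiv (\<lambda>x. P x $ i $ j) y v = dderiv P y v $ i $ j"
    "w \<in> p0_space \<Longrightarrow> dderiv (\<lambda>z. dderiv (\<lambda>x. P x $ i $ j) z v) y w = dderiv (\<lambda>z. dderiv P z v) y w $ i $ j"
proof -
  have *: "dderiv (\<lambda>x. P x $ i $ j) y v = dderiv P y v $ i $ j" if "y \<in> D" for y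
    by (rule dderiv_bounded_linear[OF bounded_linear_entry P_diff that assms(2)])
  then show "dderiv (\<lambda>x. P x $ i $ j) y v = dderiv P y v $ i $ j" using assms(1) .
  assume w: "w \<in> p0_space"
  have "dderiv (\<lambda>z. dderiv (\<lambda>x. P x $ i $ j) z v) y w = dderiv (\<lambda>z. dderiv P z v $ i $ j) y w"
    by (rule dderiv_cong[OF * assms(1) w])
  also have "\<dots> = dderiv (\<lambda>z. dderiv P z v) y w $ i $ j"
    by (rule dderiv_bounded_linear[OF bounded_linear_entry P2_diff[OF assms(2)] assms(1) w])
  finally show "dderiv (\<lambda>z. dderiv (\<lambda>x. P x $ i $ j) z v) y w = dderiv (\<lambda>z. dderiv P z v) y w $ i $ j" .
qed

lemma frame_is_frame: "y \<in> D \<Longrightarrow> onb p0_space C \<Longrightarrow> is_frame y C (frame_vec y) (\<lambda>_. 1)"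
  unfolding is_frame_def using onbD frame_vec(1) frame_expand by blast

text \<open>Each derivative of \<open>P\<close> carries a factor 2, so the constant is
  \<open>4 * (1/2 - \<gamma>)\<close> with \<open>\<gamma> = 1 / (2n)\<close>.\<close>

lemma P_kappa_sum:
  assumes y: "y \<in> D" and C: "onb p0_space C"
  shows "kappa_sum C (frame_vec y) (\<lambda>_. 1) (\<lambda>x. P x $ k $ l) (\<lambda>x. P x $ m $ l) y
    = (2 - 4 * (1 / (2 * of_nat CARD('n)))) * P y $ k $ l * P y $ m $ l"
proof -
  interpret kernel_sum C "1 / (2 * of_nat CARD('n))" using p0_kernel[OF C] by unfold_locales
  have "kappa_sum C (frame_vec y) (\<lambda>_. 1) (\<lambda>x. P x $ k $ l) (\<lambda>x. P x $ m $ l) y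
    = (\<Sum>E\<in>C. 4 * ((s y ** E ** adj_mat (s y)) $ k $ l * (s y ** E ** adj_mat (s y)) $ m $ l))"
  proof (rule sum.cong[OF refl])
    fix E assume "E \<in> C"
    then have E: "E \<in> p0_space" by (rule onbD(2)[OF C])
    show "of_real 1 * (dderiv (\<lambda>x. P x $ k $ l) y (frame_vec y E) * dderiv (\<lambda>x. P x $ m $ l) y (frame_vec y E))
      = 4 * ((s y ** E ** adj_mat (s y)) $ k $ l * (s y ** E ** adj_mat (s y)) $ m $ l)"
      unfolding dderiv_P_entry(1)[OF y frame_vec(1)[OF y E]] dderiv_P[OF y frame_vec(1)[OF y E]] frame_vec(2)[OF y E]
      by (simp add: scaleR_complex)
  qed
  also have "\<dots> = (2 - 4 * (1 / (2 * of_nat CARD('n)))) * P y $ k $ l * P y $ m $ l"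
    unfolding sum_distrib_left[symmetric] sum_sandwich by (simp add: Phi_def algebra_simps)
  finally show ?thesis .
qed

text \<open>The undetermined multiples of \<open>P y\<close> from the single directions add up to
  one real number, the same for every entry. They merely shift the eigenvalue, which is why \<nu> is
  obtained before \<open>k\<close> and \<open>l\<close>.\<close>

lemma P_laplacian_sum:
  assumes y: "y \<in> D" and C: "onb p0_space C"
  defines "Z \<equiv> \<lambda>E. christoffel p0_space g y (frame_vec y E) (frame_vec y E)"
  obtains \<nu> where "\<And>k l. laplace_sum C (frame_vec y) (\<lambda>_. 1) Z (\<lambda>x. P x $ k $ l) y = \<nu> * P y $ k $ l"
proof -
  interpret kernel_sum C "1 / (2 * of_nat CARD('n))" using p0_kernel[OF C] by unfold_locales
  have "\<forall>E\<in>C. \<exists>r. dderiv (\<lambda>z. dderiv P z (frame_vec y E)) y (frame_vec y E) - dderiv P y (Z E)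
      = 4 *\<^sub>R (s y ** (E ** E) ** adj_mat (s y)) + r *\<^sub>R P y"
    unfolding Z_def using second_derivative_P[OF y] onbD(2)[OF C] by blast
  then obtain r where r: "\<And>E. E \<in> C \<Longrightarrow> dderiv (\<lambda>z. dderiv P z (frame_vec y E)) y (frame_vec y E) - dderiv P y (Z E)
      = 4 *\<^sub>R (s y ** (E ** E) ** adj_mat (s y)) + r E *\<^sub>R P y"
    by metis
  let ?\<nu> = "4 * (of_nat CARD('n) - 1/2 - 1 / (2 * of_nat CARD('n))) + of_real (\<Sum>E\<in>C. r E)"
  have "laplace_sum C (frame_vec y) (\<lambda>_. 1) Z (\<lambda>x. P x $ k $ l) y = ?\<nu> * P y $ k $ l" for k l
  proof -
    have "laplace_sum C (frame_vec y) (\<lambda>_. 1) Z (\<lambda>x. P x $ k $ l) y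
      = (\<Sum>E\<in>C. 4 * (s y ** (E ** E) ** adj_mat (s y)) $ k $ l + of_real (r E) * P y $ k $ l)"
    proof (rule sum.cong[OF refl])
      fix E assume EC: "E \<in> C"
      then have E: "E \<in> p0_space" by (rule onbD(2)[OF C])
      note fE = frame_vec(1)[OF y E]
      have ZE: "Z E \<in> p0_space" unfolding Z_def by (rule christoffel_props(1)[OF y fE fE])
      have "dderiv (\<lambda>z. dderiv (\<lambda>x. P x $ k $ l) z (frame_vec y E)) y (frame_vec y E) - dderiv (\<lambda>x. P x $ k $ l) y (Z E)
        = (dderiv (\<lambda>z. dderiv P z (frame_vec y E)) y (frame_vec y E) - dderiv P y (Z E)) $ k $ l"
        unfolding dderiv_P_entry(2)[OF y fE fE] dderiv_P_entry(1)[OF y ZE] by simp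
      then show "of_real 1 * (dderiv (\<lambda>z. dderiv (\<lambda>x. P x $ k $ l) z (frame_vec y E)) y (frame_vec y E)
        - dderiv (\<lambda>x. P x $ k $ l) y (Z E))
        = 4 * (s y ** (E ** E) ** adj_mat (s y)) $ k $ l + of_real (r E) * P y $ k $ l"
        unfolding r[OF EC] by (simp add: scaleR_complex)
    qed
    also have "\<dots> = ?\<nu> * P y $ k $ l"
      unfolding sum.distrib sum_distrib_left[symmetric] sum_distrib_right[symmetric] sum_sandwich_square of_real_sum
      by (simp only: Phi_def[symmetric] distrib_right mult.assoc)
    finally show ?thesis .
  qed
  then show thesis by (rule that)
qed

lemma P_diag_nonzero: "y \<in> D \<Longrightarrow> P y $ l $ l \<noteq> 0"
  by (rule Phi_diag_nonzero[OF s_inv])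

lemma quotient_chart_harmonic:
  assumes F: "\<And>z. z \<in> D \<Longrightarrow> F z = P z $ k $ l / P z $ l $ l" and y: "y \<in> D"
  shows "Complex (laplacian_in p0_space g (Re \<circ> F) y) (laplacian_in p0_space g (Im \<circ> F) y) = 0"
proof -
  obtain C :: "'n cmat set" where C: "onb p0_space C" by (rule onb_exists[OF subspace_p0_space])
  let ?Z = "\<lambda>E. christoffel p0_space g y (frame_vec y E) (frame_vec y E)"
  obtain \<nu> where \<nu>: "\<And>k l. laplace_sum C (frame_vec y) (\<lambda>_. 1) ?Z (\<lambda>x. P x $ k $ l) y = \<nu> * P y $ k $ l"
    by (rule P_laplacian_sum[OF y C]) (rule that)
  note f = frame_vec(1)[OF y onbD(2)[OF C]]
  show ?thesis
  proof (rule quotient_harmonic[OF F P_entry_Ck P_entry_Ck P_diag_nonzero y frame_is_frame[OF y C]])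
    show "?Z E \<in> p0_space" if "E \<in> C" for E
      by (rule christoffel_props(1)[OF y f[OF that] f[OF that]])
    show "g y (?Z E) x = Dg y (frame_vec y E) (frame_vec y E) x - Dg y x (frame_vec y E) (frame_vec y E) / 2"
      if "E \<in> C" "x \<in> p0_space" for E x
      using christoffel_props(2)[OF y f[OF that(1)] f[OF that(1)] that(2)] by simp
  qed (rule \<nu> P_kappa_sum[OF y C] | assumption)+
qed

lemma quotient_chart_kappa:
  assumes F: "\<And>z. z \<in> D \<Longrightarrow> F z = P z $ k $ l / P z $ l $ l"
    and F': "\<And>z. z \<in> D \<Longrightarrow> F' z = P z $ m $ l / P z $ l $ l" and y: "y \<in> D"
  shows "(let G = g y; a = grad_in p0_space g (Re \<circ> F) y; b = grad_in p0_space g (Im \<circ> F) y;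
         c = grad_in p0_space g (Re \<circ> F') y; d = grad_in p0_space g (Im \<circ> F') y
     in Complex (G a c - G b d) (G a d + G b c)) = 0"
proof -
  obtain C :: "'n cmat set" where C: "onb p0_space C" by (rule onb_exists[OF subspace_p0_space])
  note fr = frame_is_frame[OF y C]
  have diff: "F differentiable_on D" if F: "\<And>z. z \<in> D \<Longrightarrow> F z = P z $ k $ l / P z $ l $ l" for F k
  proof (rule iffD2)
    show "F differentiable_on D \<longleftrightarrow> (\<lambda>z. P z $ k $ l / P z $ l $ l) differentiable_on D"
      by (rule differentiable_on_cong) (rule F)
    show "(\<lambda>z. P z $ k $ l / P z $ l $ l) differentiable_on D"
      by (rule Ck_on_2D(1)[OF Ck_on_divide[OF P_entry_Ck P_entry_Ck P_diag_nonzero]])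
  qed
  have 0: "kappa_sum C (frame_vec y) (\<lambda>_. 1) F F' y = 0"
    by (rule quotient_kappa[OF F F' _ _ _ _ y fr])
      (rule Ck_on_2D(1)[OF P_entry_Ck] P_kappa_sum[OF y C] P_diag_nonzero | assumption)+
  have dF: "F differentiable_on D" and dF': "F' differentiable_on D"
    by (rule diff, erule F, rule diff, erule F')
  show ?thesis
    by (rule trans[OF grad_in_product_complex[OF dF dF' y fr] 0])
qed

end

section \<open>From parametrizations to immersed charts\<close>

lemma smooth_lift_chart_param:
  assumes "openin (top_of_set p0_space) D" "\<sigma> ` D \<subseteq> SU_star_mod_Sp" "smooth_lift D \<sigma> s"
  shows "smooth_lift_chart D \<sigma> s"
  using assms subspace_p0_space
  by (simp add: smooth_lift_chart_def smooth_lift_chart_axioms_def chart_domain_def)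

abbreviation chosen_lift ::
  "'n::finite cmat set \<Rightarrow> ('n cmat \<Rightarrow> 'n cmat set) \<Rightarrow> 'n cmat \<Rightarrow> 'n cmat"
where
  "chosen_lift D \<sigma> \<equiv> SOME s. smooth_lift D \<sigma> s"

text \<open>A parametrization comes with some immersive lift, whereas the metric uses a lift chosen
  by \<open>SOME\<close>. Both give the same \<open>Phi\<close>, and by \<open>L_conv_P\<close>
  immersivity is a property of the derivative of \<open>Phi\<close> along the lift.\<close>

lemma immersed_chart_param:
  assumes "(D, \<sigma>) \<in> quotient_params"
  shows "immersed_chart D \<sigma> (chosen_lift D \<sigma>)"
proof -
  have "openin (top_of_set p0_space) D \<and> inj_on \<sigma> D \<and> \<sigma> ` D \<subseteq> SU_star_mod_Sp \<and>
       (\<exists>s. smooth_lift D \<sigma> s \<and> (\<forall>y\<in>D. \<forall>v\<in>p0_space. lift_diff s y v = 0 \<longrightarrow> v = 0))"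
    using assms by (simp only: quotient_params_def mem_Collect_eq prod.case)
  then obtain s where D: "openin (top_of_set p0_space) D" "\<sigma> ` D \<subseteq> SU_star_mod_Sp"
    and s: "smooth_lift D \<sigma> s" and imm: "\<And>y v. y \<in> D \<Longrightarrow> v \<in> p0_space \<Longrightarrow> lift_diff s y v = 0 \<Longrightarrow> v = 0"
    by (elim conjE exE) (rule that, assumption+, simp)
  define s' where "s' = chosen_lift D \<sigma>"
  have s': "smooth_lift D \<sigma> s'" unfolding s'_def using s by (rule someI[where P = "smooth_lift D \<sigma>"])
  interpret A: smooth_lift_chart D \<sigma> s by (rule smooth_lift_chart_param[OF D s])
  interpret B: smooth_lift_chart D \<sigma> s' by (rule smooth_lift_chart_param[OF D s'])
  have Phi_eq: "Phi (s y) = Phi (s' y)" if "y \<in> D" for y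
    using self_in_Sp_coset[of "s y"] A.\<sigma>_eq[OF that] B.\<sigma>_eq[OF that]
    by (intro Phi_coset) simp
  have "v = 0" if y: "y \<in> D" and v: "v \<in> p0_space" and L: "lift_diff s' y v = 0" for y v
  proof -
    have "dderiv A.P y v = dderiv B.P y v" by (rule A.dderiv_cong[OF Phi_eq y v])
    also have "\<dots> = 0" using B.dderiv_P[OF y v] L by (simp add: mm.zero_left mm.zero_right)
    finally have "lift_diff s y v = 0" using A.L_conv_P[OF y v] by (simp add: mm.zero_left mm.zero_right)
    then show "v = 0" by (rule imm[OF y v])
  qed
  then have "immersed_chart D \<sigma> s'" by unfold_locales
  then show ?thesis by (simp add: s'_def)
qed

section \<open>Existence of parametrizations\<close>

lemma det_scaleR: "det (r *\<^sub>R A) = of_real r ^ (2 * CARD('n)) * det A" for A :: "'n::finite cmat"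
  unfolding det_def
  by (simp add: scaleR_complex prod.distrib sum_distrib_left mult_ac mult_2 mult_2_right)

text \<open>Taking determinants in \<open>A J = J cnj(A)\<close> and cancelling the one of
  \<open>J\<close> shows that the determinant equals its conjugate. A real power of its real part
  can then normalize it.\<close>

lemma det_real: "A \<in> u_star_alg \<Longrightarrow> det A = of_real (Re (det A))" for A :: "'n::finite cmat"
proof -
  assume "A \<in> u_star_alg"
  then have "det (A ** Jmat) = det (Jmat ** cnj_mat A)" by (simp add: u_star_alg_iff)
  then have "det A * det (Jmat :: 'n cmat) = cnj (det A) * det (Jmat :: 'n cmat)"
    by (simp add: det_mul det_cnj_mat)
  moreover have "det (Jmat :: 'n cmat) \<noteq> 0"
  proof -
    have "Jmat ** (- Jmat) = (mat 1 :: 'n cmat)" by (simp add: mm.minus_right Jmat_square)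
    then have "det (Jmat ** (- Jmat) :: 'n cmat) = 1" by simp
    then show ?thesis by (auto simp: det_mul)
  qed
  ultimately have "det A = cnj (det A)" by simp
  then show ?thesis by (simp add: complex_eq_iff)
qed

text \<open>
  The parametrization around \<open>x Sp(n)\<close> is \<open>y \<mapsto> x (1 + y)\<close>, normalized to determinant 1. Both its
  injectivity and its immersivity reduce to an equation \<open>w A + A w = 0\<close> with \<open>A\<close> near 1.
\<close>

lemma sylvester_near_one:
  obtains \<delta> where "\<delta> > 0" "\<And>y w :: 'n::finite cmat. \<lbrakk>norm y < \<delta>; adj_mat y = y; adj_mat w = w;
    w ** (mat 1 + y) + (mat 1 + y) ** w = 0\<rbrakk> \<Longrightarrow> w = 0"
proof -
  obtain K where K: "K > 0" "\<And>(a :: 'n cmat) (b :: 'n cmat). norm (a ** b) \<le> norm a * norm b * K"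
  proof -
    have "\<exists>K>0. \<forall>(a :: 'n cmat) (b :: 'n cmat). norm (a ** b) \<le> norm a * norm b * K" by (rule mm.pos_bounded)
    then show thesis using that by auto
  qed
  have "w = 0" if y: "norm y < 1 / K" "adj_mat y = y" and w: "adj_mat w = w"
    and eq: "w ** (mat 1 + y) + (mat 1 + y) ** w = 0" for y w :: "'n cmat"
  proof (rule ccontr)
    assume "w \<noteq> 0"
    \<comment> \<open>After multiplication by \<open>w\<close> both terms have the same trace by
      cyclicity, so \<open>tr (w w) + tr (w w y) = 0\<close>. For Hermitian matrices this bounds the
      squared norm of \<open>w\<close> by \<open>K\<close> times itself times the norm of
      \<open>y\<close>, which is impossible when \<open>norm y < 1 / K\<close>.\<close>
    have "w ** (w ** (mat 1 + y)) + w ** ((mat 1 + y) ** w) = 0"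
      by (simp only: mm.add_right[of w, symmetric] eq mm.zero_right)
    from arg_cong[OF this, of trace]
    have "trace (w ** (w ** (mat 1 + y))) + trace (w ** ((mat 1 + y) ** w)) = 0"
      by (simp only: trace_add) (simp add: trace_def)
    moreover have "trace (w ** ((mat 1 + y) ** w)) = trace ((mat 1 + y) ** w ** w)"
      by (rule trace_mul_sym)
    moreover have "trace ((mat 1 + y) ** w ** w) = trace (w ** (w ** (mat 1 + y)))"
      using trace_mul_sym[of "mat 1 + y" "w ** w"] by (simp add: matrix_mul_assoc)
    ultimately have "trace (w ** (w ** (mat 1 + y))) = 0" by simp
    then have "trace (w ** w) + trace (w ** w ** y) = 0"
      by (simp add: mm.add_right matrix_mul_assoc trace_add)
    from arg_cong[OF this, of Re] have "w \<bullet> w + (w ** w) \<bullet> y = 0"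
      using w y(2) by (simp add: inner_cmat)
    then have "(norm w)\<^sup>2 \<le> norm (w ** w) * norm y"
      using Cauchy_Schwarz_ineq2[of "w ** w" y] by (simp add: power2_norm_eq_inner)
    also have "\<dots> \<le> (norm w * norm w * K) * norm y"
      by (intro mult_right_mono K) simp
    also have "\<dots> < (norm w * norm w * K) * (1 / K)"
      using y(1) K(1) \<open>w \<noteq> 0\<close> by (intro mult_strict_left_mono) auto
    also have "\<dots> = (norm w)\<^sup>2" using K(1) by (simp add: power2_eq_square)
    finally show False by simp
  qed
  then show thesis using K(1) by (intro that[of "1 / K"]) auto
qed

lemma small_ball:
  obtains \<delta> where "\<delta> > 0" "\<And>y :: 'n::finite cmat. norm y < \<delta> \<Longrightarrow> Re (det (mat 1 + y)) > 0"
    "\<And>y w :: 'n cmat. \<lbrakk>norm y < \<delta>; adj_mat y = y; adj_mat w = w;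
      w ** (mat 1 + y) + (mat 1 + y) ** w = 0\<rbrakk> \<Longrightarrow> w = 0"
proof -
  obtain \<delta>1 where d1: "\<delta>1 > 0" "\<And>y w :: 'n cmat. \<lbrakk>norm y < \<delta>1; adj_mat y = y; adj_mat w = w;
    w ** (mat 1 + y) + (mat 1 + y) ** w = 0\<rbrakk> \<Longrightarrow> w = 0"
    by (rule sylvester_near_one) (rule that; assumption)
  have "continuous_on UNIV (\<lambda>y :: 'n cmat. Re (det (mat 1 + y)))"
    unfolding det_def by (intro continuous_intros)
  then have "open {y :: 'n cmat. 0 < Re (det (mat 1 + y))}"
    by (intro open_Collect_less) auto
  moreover have "(0 :: 'n cmat) \<in> {y. 0 < Re (det (mat 1 + y))}" by simp
  ultimately obtain \<delta>2 where d2: "\<delta>2 > 0" "ball (0 :: 'n cmat) \<delta>2 \<subseteq> {y. 0 < Re (det (mat 1 + y))}"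
    by (meson openE)
  show thesis
  proof (rule that[of "min \<delta>1 \<delta>2"])
    show "min \<delta>1 \<delta>2 > 0" using d1 d2 by simp
    show "Re (det (mat 1 + y)) > 0" if "norm y < min \<delta>1 \<delta>2" for y :: "'n cmat"
    proof -
      have "y \<in> ball 0 \<delta>2" using that by simp
      then show ?thesis using d2(2) by blast
    qed
    show "w = 0" if "norm y < min \<delta>1 \<delta>2" "adj_mat y = y" "adj_mat w = w"
      "w ** (mat 1 + y) + (mat 1 + y) ** w = 0" for y w :: "'n cmat"
      using that by (intro d1(2)[of y w]) auto
  qed
qed

lemma trace_mat_one_plus: "y \<in> p0_space \<Longrightarrow> trace (r *\<^sub>R (mat 1 + y)) = of_real (r * (2 * real CARD('n)))"
  for y :: "'n::finite cmat"
  by (simp add: trace_scaleR trace_add trace_one p0_space_iff scaleR_complex)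

text \<open>Ensures that the choice in \<open>param_at\<close> really picks a parametrization around
  the given coset.\<close>

lemma quotient_param_exists:
  fixes x :: "'n::finite cmat"
  assumes x: "x \<in> SU_star"
  obtains D \<sigma> where "(D, \<sigma>) \<in> quotient_params" "Sp_coset x \<in> \<sigma> ` D"
proof -
  obtain \<delta> where \<delta>: "\<delta> > 0" "\<And>y :: 'n cmat. norm y < \<delta> \<Longrightarrow> Re (det (mat 1 + y)) > 0"
    and syl: "\<And>y w :: 'n cmat. \<lbrakk>norm y < \<delta>; adj_mat y = y; adj_mat w = w;
      w ** (mat 1 + y) + (mat 1 + y) ** w = 0\<rbrakk> \<Longrightarrow> w = 0"
    by (rule small_ball) (rule that; assumption)
  define D :: "'n cmat set" where "D = p0_space \<inter> ball 0 \<delta>"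
  \<comment> \<open>The determinant of a \<open>2n\<close> by \<open>2n\<close> matrix scales with
    the power \<open>2n\<close> of a scalar, which dictates the exponent; the base is positive on
    the chosen ball.\<close>
  define c where "c y = Re (det (mat 1 + y)) powr (- 1 / (2 * real CARD('n)))" for y :: "'n cmat"
  define A where "A y = c y *\<^sub>R (mat 1 + y)" for y
  define s where "s y = x ** A y" for y
  define \<sigma> where "\<sigma> y = Sp_coset (s y)" for y
  have Dp: "y \<in> p0_space" "norm y < \<delta>" "adj_mat y = y" "trace y = 0" "y \<in> u_star_alg" if "y \<in> D" for y
    using that by (auto simp: D_def p0_space_iff)
  have openD: "openin (top_of_set p0_space) D"
    unfolding D_def by (simp add: openin_open_Int)
  interpret chart_domain p0_space D by (simp add: chart_domain_def openD subspace_p0_space)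
  have pos: "Re (det (mat 1 + y)) > 0" if "y \<in> D" for y using \<delta>(2) Dp(2)[OF that] .
  have c_pos: "c y > 0" if "y \<in> D" for y using pos[OF that] by (simp add: c_def)
  have x': "x \<in> u_star_alg" "det x = 1" "invertible x"
    using x by (auto simp: SU_star_def u_star_alg_iff invertible_det_nz)
  have one_y: "mat 1 + y \<in> u_star_alg" if "y \<in> D" for y
    using Dp(5)[OF that] u_star_alg_one subspace_u_star_alg by (intro subspace_add) auto
  have A_u: "A y \<in> u_star_alg" if "y \<in> D" for y
    unfolding A_def using one_y[OF that] subspace_u_star_alg by (intro subspace_scale) auto
  have A_adj: "adj_mat (A y) = A y" if "y \<in> D" for y
    using Dp(3)[OF that] by (simp add: A_def)
  have det_A: "det (A y) = 1" if y: "y \<in> D" for y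
  proof -
    have "c y ^ (2 * CARD('n)) = Re (det (mat 1 + y)) powr (- 1)"
      using pos[OF y] by (simp add: c_def powr_realpow[symmetric] powr_powr)
    then have "c y ^ (2 * CARD('n)) * Re (det (mat 1 + y)) = 1"
      using pos[OF y] by (simp add: powr_minus field_simps)
    then have "of_real (c y ^ (2 * CARD('n))) * complex_of_real (Re (det (mat 1 + y))) = 1"
      unfolding of_real_mult[symmetric] by simp
    then show ?thesis
      unfolding A_def det_scaleR det_real[OF one_y[OF y], symmetric] by simp
  qed
  have s_SU: "s y \<in> SU_star" if "y \<in> D" for y
    using u_star_alg_mult[OF x'(1) A_u[OF that]] det_A[OF that] x'(2)
    by (simp add: SU_star_def s_def u_star_alg_iff det_mul)
  have one_Ck: "Ck_on k p0_space D (\<lambda>y. mat 1 + y)" for k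
    by (intro Ck_on_add Ck_on_const Ck_on_bounded_linear_id bounded_linear_ident)
  have c_Ck: "Ck_on k p0_space D c" for k
    unfolding c_def
    by (intro Ck_on_powr Ck_on_bounded_linear[OF bounded_linear_Re] Ck_on_det Ck_on_component one_Ck pos)
  have A_Ck: "Ck_on k p0_space D A" for k
    unfolding A_def by (rule Ck_on_bilinear[OF bounded_bilinear_scaleR c_Ck one_Ck])
  have s_Ck: "Ck_on k p0_space D s" for k
    unfolding s_def
    by (rule Ck_on_bounded_linear[OF mm.bounded_linear_right A_Ck])
  have lift: "smooth_lift D \<sigma> s"
    using s_Ck s_SU SU_star_subset by (auto simp: smooth_lift_def smooth_on_def \<sigma>_def)
  have range: "\<sigma> ` D \<subseteq> SU_star_mod_Sp"
    using s_SU by (auto simp: \<sigma>_def SU_star_mod_Sp_def)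
  interpret smooth_lift_chart D \<sigma> s by (rule smooth_lift_chart_param[OF openD range lift])
  have Phi_s: "Phi (s y) = x ** (A y ** A y) ** adj_mat x" if "y \<in> D" for y
    using A_adj[OF that] by (simp add: Phi_def s_def adj_mat_mult matrix_mul_assoc)
  have cancel: "M = N" if "x ** M ** adj_mat x = x ** N ** adj_mat x" for M N
  proof -
    have *: "matrix_inv x ** (x ** M ** adj_mat x) ** adj_mat (matrix_inv x) = M" for M
    proof -
      have "matrix_inv x ** (x ** M ** adj_mat x) ** adj_mat (matrix_inv x)
          = (matrix_inv x ** x) ** M ** adj_mat (matrix_inv x ** x)"
        by (simp only: matrix_mul_assoc adj_mat_mult)
      then show ?thesis by (simp add: matrix_inv_left_right[OF x'(3)])
    qed
    have "M = matrix_inv x ** (x ** M ** adj_mat x) ** adj_mat (matrix_inv x)" by (rule *[symmetric])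
    also have "\<dots> = matrix_inv x ** (x ** N ** adj_mat x) ** adj_mat (matrix_inv x)" by (simp only: that)
    also have "\<dots> = N" by (rule *)
    finally show ?thesis .
  qed
  have inj: "inj_on \<sigma> D"
  proof (rule inj_onI)
    fix y z assume y: "y \<in> D" and z: "z \<in> D" and "\<sigma> y = \<sigma> z"
    then have "Phi (s y) = Phi (s z)"
      using self_in_Sp_coset[of "s y"] by (intro Phi_coset) (simp add: \<sigma>_def)
    then have AA: "A y ** A y = A z ** A z"
      unfolding Phi_s[OF y] Phi_s[OF z] by (rule cancel)
    \<comment> \<open>Equal squares mean that the difference \<open>C\<close> anticommutes with the
      sum of \<open>A y\<close> and \<open>A z\<close>. Divided by \<open>t\<close>, that sum is
      \<open>mat 1 + u\<close> with \<open>u\<close> a convex combination of \<open>y\<close> and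
      \<open>z\<close>, so \<open>u\<close> stays in the ball and \<open>syl\<close>
      applies.\<close>
    define C where "C = A y - A z"
    define t where "t = c y + c z"
    define u where "u = (c y / t) *\<^sub>R y + (c z / t) *\<^sub>R z"
    have t: "t > 0" using c_pos[OF y] c_pos[OF z] by (simp add: t_def)
    have "t *\<^sub>R u = c y *\<^sub>R y + c z *\<^sub>R z"
      using t by (simp add: u_def scaleR_add_right)
    then have S: "A y + A z = t *\<^sub>R (mat 1 + u)"
      by (simp add: scaleR_add_right) (simp add: A_def t_def scaleR_add_right scaleR_add_left)
    have "C ** (A y + A z) + (A y + A z) ** C = 0"
      using AA by (simp add: C_def mm.add_left mm.add_right mm.diff_left mm.diff_right)
    then have "t *\<^sub>R (C ** (mat 1 + u) + (mat 1 + u) ** C) = 0"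
      unfolding S mm.scaleR_left mm.scaleR_right scaleR_add_right[symmetric] .
    then have "C ** (mat 1 + u) + (mat 1 + u) ** C = 0" using t by simp
    moreover have "norm u < \<delta>"
    proof -
      have "u \<in> ball 0 \<delta>"
        unfolding u_def
        using c_pos[OF y] c_pos[OF z] t Dp(2)[OF y] Dp(2)[OF z]
        by (intro convexD[OF convex_ball]) (auto simp: t_def add_divide_distrib[symmetric])
      then show ?thesis by simp
    qed
    moreover have "adj_mat u = u" using Dp(3)[OF y] Dp(3)[OF z] by (simp add: u_def)
    moreover have "adj_mat C = C" using A_adj[OF y] A_adj[OF z] by (simp add: C_def)
    ultimately have "C = 0" by (intro syl[of u C])
    then have "A y = A z" by (simp add: C_def)
    \<comment> \<open>As \<open>y\<close> and \<open>z\<close> are traceless, the trace sees only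
      the scalar factor; once the factors agree, so do \<open>y\<close> and
      \<open>z\<close>.\<close>
    moreover from arg_cong[OF this, of trace] have "c y = c z"
      unfolding A_def trace_mat_one_plus[OF Dp(1)[OF y]] trace_mat_one_plus[OF Dp(1)[OF z]]
      by (simp only: of_real_eq_iff) simp
    ultimately show "y = z" using c_pos[OF z] by (simp add: A_def)
  qed
  have imm: "v = 0" if y: "y \<in> D" and v: "v \<in> p0_space" and L0: "lift_diff s y v = 0" for y v
  proof -
    have A_diff: "A differentiable_on D" and c_diff: "c differentiable_on D"
      and one_diff: "(\<lambda>y. mat 1 + y) differentiable_on D"
      using A_Ck[of 1] c_Ck[of 1] one_Ck[of 1] by simp_all
    define A' where "A' = dderiv A y v"
    define c' where "c' = dderiv c y v"
    have "dderiv (\<lambda>y. mat 1 + y) y v = v"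
    proof -
      have "dderiv (\<lambda>y. mat 1 + y) y v = dderiv (\<lambda>y. mat 1 :: 'n cmat) y v + dderiv (\<lambda>y. y) y v"
        by (rule dderiv_add[OF _ _ y v]) (simp_all add: differentiable_on_def)
      then show ?thesis by (simp add: dderiv_bounded_linear_id[OF bounded_linear_ident])
    qed
    then have A': "A' = c y *\<^sub>R v + c' *\<^sub>R (mat 1 + y)"
      unfolding A'_def c'_def A_def
      using dderiv_bilinear[OF bounded_bilinear_scaleR c_diff one_diff y v] by simp
    have AA_diff: "(\<lambda>y. A y ** A y) differentiable_on D"
      by (rule differentiable_on_matrix_mult[OF A_diff A_diff])
    have bl: "bounded_linear (\<lambda>M. x ** M ** adj_mat x)"
      by (intro bounded_linear_compose[OF mm.bounded_linear_left
          mm.bounded_linear_right])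
    have "x ** (A y ** A' + A' ** A y) ** adj_mat x = dderiv (\<lambda>y. x ** (A y ** A y) ** adj_mat x) y v"
      unfolding dderiv_bounded_linear[OF bl AA_diff y v]
        dderiv_matrix_mult[OF A_diff A_diff y v] A'_def ..
    also have "\<dots> = dderiv P y v" by (rule dderiv_cong[OF Phi_s[symmetric] y v])
    also have "\<dots> = 0" using dderiv_P[OF y v] L0 by (simp add: mm.zero_left mm.zero_right)
    finally have "x ** (A y ** A' + A' ** A y) ** adj_mat x = x ** 0 ** adj_mat x"
      by (simp add: mm.zero_left mm.zero_right)
    then have "A y ** A' + A' ** A y = 0" by (rule cancel)
    then have "c y *\<^sub>R ((mat 1 + y) ** A' + A' ** (mat 1 + y)) = 0"
      unfolding A_def mm.scaleR_left mm.scaleR_right scaleR_add_right[symmetric] .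
    then have "A' ** (mat 1 + y) + (mat 1 + y) ** A' = 0" using c_pos[OF y] by (simp add: add.commute)
    moreover have "adj_mat A' = A'"
      using v Dp(3)[OF y] by (simp add: A' p0_space_iff)
    \<comment> \<open>It remains to split \<open>c y v + c' (1 + y) = 0\<close>. The trace removes
      \<open>v\<close> and \<open>y\<close> and leaves \<open>2n c' = 0\<close>, after which
      positivity of \<open>c y\<close> gives \<open>v = 0\<close>.\<close>
    ultimately have A'0: "A' = 0" using Dp[OF y] by (intro syl[of y A'])
    then have "trace A' = 0" by (simp add: trace_def)
    then have "of_real (c' * (2 * real CARD('n))) = (0::complex)"
      using v trace_mat_one_plus[OF Dp(1)[OF y], of c']
      by (simp add: A' trace_add[of "c y *\<^sub>R v"] trace_scaleR[of "c y"] p0_space_iff)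
    then have "c' = 0" by (simp only: of_real_eq_0_iff) simp
    then show "v = 0" using A'0 c_pos[OF y] by (simp add: A')
  qed
  have "(D, \<sigma>) \<in> quotient_params"
    unfolding quotient_params_def mem_Collect_eq prod.case
    by (intro conjI exI[of _ s] ballI impI openD inj range lift) (rule imm)
  moreover have "Sp_coset x \<in> \<sigma> ` D"
  proof (rule image_eqI[of _ _ 0])
    show "Sp_coset x = \<sigma> 0" by (simp add: \<sigma>_def s_def A_def c_def)
    show "0 \<in> D" using \<delta>(1) subspace_0[OF subspace_p0_space] by (simp add: D_def)
  qed
  ultimately show thesis by (rule that)
qed

section \<open>The induced family on \<open>SU\<^sup>*(2n)/Sp(n)\<close>\<close>

lemma param_at_quotient:
  fixes p :: "'n::finite cmat set"
  assumes "p \<in> SU_star_mod_Sp"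
  obtains D \<sigma> y where "param_at SU_star_mod_Sp_manifold p = (D, \<sigma>)" "(D, \<sigma>) \<in> quotient_params"
    "coord SU_star_mod_Sp_manifold p = y" "y \<in> D" "\<sigma> y = p"
proof -
  let ?Q = "\<lambda>c. c \<in> params SU_star_mod_Sp_manifold \<and> p \<in> snd c ` fst c"
  obtain x where x: "x \<in> SU_star" "p = Sp_coset x" using assms by (auto simp: SU_star_mod_Sp_def)
  obtain D0 \<sigma>0 where "(D0, \<sigma>0) \<in> quotient_params" "Sp_coset x \<in> \<sigma>0 ` D0"
    by (rule quotient_param_exists[OF x(1)])
  then have "?Q (D0, \<sigma>0)" by (simp add: SU_star_mod_Sp_manifold_def x(2))
  then have Q: "?Q (param_at SU_star_mod_Sp_manifold p)"
    unfolding param_at_def by (rule someI[of ?Q])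
  obtain D \<sigma> where D: "param_at SU_star_mod_Sp_manifold p = (D, \<sigma>)" by (cases "param_at SU_star_mod_Sp_manifold p")
  have q: "(D, \<sigma>) \<in> quotient_params" and p: "p \<in> \<sigma> ` D"
    using Q unfolding D by (simp_all add: SU_star_mod_Sp_manifold_def)
  have inj: "inj_on \<sigma> D" using q by (simp add: quotient_params_def)
  have c: "coord SU_star_mod_Sp_manifold p = the_inv_into D \<sigma> p" by (simp add: coord_def D)
  show thesis
    using that[OF D q c] the_inv_into_into[OF inj p order_refl] f_the_inv_into_f[OF inj p] by simp
qed

lemma induced_family_coord:
  assumes "(D, \<sigma>) \<in> quotient_params" "\<phi> \<in> induced ` family l"
  obtains k where "\<And>z. z \<in> D \<Longrightarrow> (\<phi> \<circ> \<sigma>) z =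
    Phi (chosen_lift D \<sigma> z) $ k $ l / Phi (chosen_lift D \<sigma> z) $ l $ l"
proof -
  interpret immersed_chart D \<sigma> "chosen_lift D \<sigma>" by (rule immersed_chart_param[OF assms(1)])
  obtain f where f: "f \<in> family l" "\<phi> = induced f" using assms(2) by blast
  then obtain k where k: "f = (\<lambda>x. Phi x $ k $ l / Phi x $ l $ l)" by (auto simp: family_def)
  have "(\<phi> \<circ> \<sigma>) z = f (chosen_lift D \<sigma> z)" if "z \<in> D" for z
    using induced_eq[OF f(1)] \<sigma>_eq[OF that] by (simp add: f(2))
  then show thesis by (intro that[of k]) (simp add: k)
qed

lemma quotient_metric_eq:
  "quotient_metric (D, \<sigma>) = (\<lambda>y v w. trace_form (lift_diff (chosen_lift D \<sigma>) y v)
    (lift_diff (chosen_lift D \<sigma>) y w))"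
  by (simp add: fun_eq_iff quotient_metric_def Let_def)

lemma quotient_orthogonal_harmonic:
  "orthogonal_harmonic_family SU_star_mod_Sp_manifold (induced ` family (l :: 'n::finite ix))"
  unfolding orthogonal_harmonic_family_def
proof (intro conjI ballI)
  fix \<phi> :: "'n cmat set \<Rightarrow> complex" assume \<phi>: "\<phi> \<in> induced ` family l"
  show "smooth_fun SU_star_mod_Sp_manifold \<phi>"
    unfolding smooth_fun_def
  proof (intro ballI)
    fix c :: "'n cmat set \<times> ('n cmat \<Rightarrow> 'n cmat set)" assume "c \<in> params SU_star_mod_Sp_manifold"
    moreover obtain D \<sigma> where c: "c = (D, \<sigma>)" by (cases c)
    ultimately have q: "(D, \<sigma>) \<in> quotient_params" by (simp add: SU_star_mod_Sp_manifold_def)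
    interpret immersed_chart D \<sigma> "chosen_lift D \<sigma>" by (rule immersed_chart_param[OF q])
    obtain k where k: "\<And>z. z \<in> D \<Longrightarrow> (\<phi> \<circ> \<sigma>) z = P z $ k $ l / P z $ l $ l"
      by (rule induced_family_coord[OF q \<phi>]) (rule that)
    have "Ck_on j p0_space D (\<lambda>z. P z $ k $ l / P z $ l $ l)" for j
      by (rule Ck_on_divide[OF P_entry_Ck P_entry_Ck P_diag_nonzero])
    moreover have "Ck_on j p0_space D (\<phi> \<circ> \<sigma>) \<longleftrightarrow> Ck_on j p0_space D (\<lambda>z. P z $ k $ l / P z $ l $ l)" for j
      by (rule Ck_on_cong) (rule k)
    ultimately show "case c of (D, \<sigma>) \<Rightarrow> smooth_on (model SU_star_mod_Sp_manifold) D (\<phi> \<circ> \<sigma>)"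
      by (simp add: c SU_star_mod_Sp_manifold_def smooth_on_def)
  qed
  {
    fix p :: "'n cmat set" assume "p \<in> points SU_star_mod_Sp_manifold"
    then have p: "p \<in> SU_star_mod_Sp" by (simp add: SU_star_mod_Sp_manifold_def)
    obtain D \<sigma> y where c: "param_at SU_star_mod_Sp_manifold p = (D, \<sigma>)" "coord SU_star_mod_Sp_manifold p = y"
      and q: "(D, \<sigma>) \<in> quotient_params" and y: "y \<in> D"
      by (rule param_at_quotient[OF p])
    interpret immersed_chart D \<sigma> "chosen_lift D \<sigma>" by (rule immersed_chart_param[OF q])
    obtain k where k: "\<And>z. z \<in> D \<Longrightarrow> (\<phi> \<circ> \<sigma>) z = P z $ k $ l / P z $ l $ l"
      by (rule induced_family_coord[OF q \<phi>]) (rule that)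
    show "laplacian SU_star_mod_Sp_manifold \<phi> p = 0"
      using quotient_chart_harmonic[of "\<phi> \<circ> \<sigma>", OF k y]
      unfolding laplacian_def real_laplacian_def c
      by (simp add: SU_star_mod_Sp_manifold_def quotient_metric_eq comp_assoc)
  }
  fix \<psi> and p :: "'n cmat set" assume \<psi>: "\<psi> \<in> induced ` family l" and "p \<in> points SU_star_mod_Sp_manifold"
  then have p: "p \<in> SU_star_mod_Sp" by (simp add: SU_star_mod_Sp_manifold_def)
  obtain D \<sigma> y where c: "param_at SU_star_mod_Sp_manifold p = (D, \<sigma>)" "coord SU_star_mod_Sp_manifold p = y"
    and q: "(D, \<sigma>) \<in> quotient_params" and y: "y \<in> D"
    by (rule param_at_quotient[OF p])
  interpret immersed_chart D \<sigma> "chosen_lift D \<sigma>" by (rule immersed_chart_param[OF q])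
  obtain k where k: "\<And>z. z \<in> D \<Longrightarrow> (\<phi> \<circ> \<sigma>) z = P z $ k $ l / P z $ l $ l"
    by (rule induced_family_coord[OF q \<phi>]) (rule that)
  obtain m where m: "\<And>z. z \<in> D \<Longrightarrow> (\<psi> \<circ> \<sigma>) z = P z $ m $ l / P z $ l $ l"
    by (rule induced_family_coord[OF q \<psi>]) (rule that)
  show "kappa SU_star_mod_Sp_manifold \<phi> \<psi> p = 0"
    using quotient_chart_kappa[of "\<phi> \<circ> \<sigma>" _ _ "\<psi> \<circ> \<sigma>", OF k m y]
    unfolding kappa_def metric_at_def real_grad_def c
    by (simp add: SU_star_mod_Sp_manifold_def quotient_metric_eq comp_assoc)
qed

lemma Phi_scaleR: "Phi (r *\<^sub>R x) = (r * r) *\<^sub>R Phi x"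
  by (simp add: Phi_def mm.scaleR_left mm.scaleR_right)

lemma family_invariant:
  assumes "f \<in> family l"
  shows "r > 0 \<Longrightarrow> f (r *\<^sub>R x) = f x" "k \<in> Sp_group \<Longrightarrow> f (x ** k) = f x"
  using assms by (auto simp: family_def Phi_scaleR scaleR_complex Phi_Sp)

theorem theorem5p1:
  fixes l :: "'n::finite"
  shows "(\<forall>x\<in>U_star. \<forall>k\<in>Sp_group. Phi (x ** k) = (Phi x :: 'n cmat))
    \<and> (\<forall>x\<in>U_star. Phi x $ Inl l $ Inl l \<noteq> 0)
    \<and> orthogonal_harmonic_family U_star_manifold (family (Inl l))
    \<and> (\<forall>f\<in>family (Inl l). \<forall>x\<in>U_star.
          (\<forall>r>0. f (r *\<^sub>R x) = f x) \<and> (\<forall>k\<in>Sp_group. f (x ** k) = f x))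
    \<and> (\<forall>f\<in>family (Inl l). \<forall>x\<in>SU_star. induced f (Sp_coset x) = f x)
    \<and> orthogonal_harmonic_family SU_star_mod_Sp_manifold (induced ` family (Inl l))"
proof (intro conjI)
  show "\<forall>x\<in>U_star. \<forall>k\<in>Sp_group. Phi (x ** k) = (Phi x :: 'n cmat)"
    by (simp add: Phi_Sp)
  show "\<forall>x\<in>(U_star :: 'n cmat set). Phi x $ Inl l $ Inl l \<noteq> 0"
    by (simp add: U_star_iff Phi_diag_nonzero)
  show "\<forall>f\<in>family (Inl l). \<forall>x\<in>U_star.
      (\<forall>r>0. f (r *\<^sub>R x) = f x) \<and> (\<forall>k\<in>Sp_group. f (x ** k) = f x)"
    by (simp add: family_invariant)
  show "\<forall>f\<in>family (Inl l). \<forall>x\<in>SU_star. induced f (Sp_coset x) = f x"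
    by (simp add: induced_eq)
qed (rule U_star_orthogonal_harmonic quotient_orthogonal_harmonic)+

end
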